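(* Let $k$ be a field of characteristic zero, let $H=\langle x,y\mid [[y,x],x]=[[y,x],y]=0\rangle$ be the Heisenberg Lie $k$-algebra, let $U(H)$ be its universal enveloping algebra and $\mathfrak{D}(H)$ the Ore division ring of fractions of $U(H)$. Set $z=[y,x]$, $V=\frac12(xy+yx)$, and consider the following elements of $\mathfrak{D}(H)$: $$S=(V-\tfrac13z)(V+\tfrac13z)^{-1},$$ $$T=(z+y^2)^{-1}(z-y^2)S(z+y^2)(z-y^2)^{-1},$$ $$S_1=z^{-1}\Big((V-\tfrac13z)(V+\tfrac13z)^{-1}+(V-\tfrac13z)^{-1}(V+\tfrac13z)\Big)z^{-1},$$ $$S_2=z\Big((V-\tfrac13z)(V+\tfrac13z)^{-1}+(V-\tfrac13z)^{-1}(V+\tfrac13z)\Big)z,$$ $$T_1=(z+y^2)^{-1}(z-y^2)S_1(z+y^2)(z-y^2)^{-1},$$ $$T_2=(z^2+y^3)^{-1}(z^2-y^3)S_1(z^2+y^3)(z^2-y^3)^{-1},$$ $$T_3=(z+y^2)^{-1}(z-y^2)S_2(z+y^2)(z-y^2)^{-1},$$ $$T_4=(z^2+y^3)^{-1}(z^2-y^3)S_2(z^2+y^3)(z^2-y^3)^{-1}.$$ Let $\eta_1,\eta_2,\eta_3$ be the $k$-involutions of $H$ determined by $\eta_1(x)=x,\ \eta_1(y)=-y,\ \eta_1(z)=z$; $\eta_2(x)=x,\ \eta_2(y)=y,\ \eta_2(z)=-z$; $\eta_3(x)=-x,\ \eta_3(y)=-y,\ \eta_3(z)=-z$, each extended to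 $\mathfrak{D}(H)$. The following hold. (1) The $k$-subalgebra of $\mathfrak{D}(H)$ generated by $\{S,S^{-1},T,T^{-1}\}$ is the free group $k$-algebra on $\{S,T\}$. (2) (a) The elements $S_1,S_1^2,T_1,T_1^2$ are symmetric with respect to $\eta_2$ and with respect to $\eta_3$. (b) The $k$-subalgebra generated by $\{S_1,T_1\}$ is the free $k$-algebra on $\{S_1,T_1\}$. (c) The $k$-subalgebra generated by $\{1+S_1,(1+S_1)^{-1},1+T_1,(1+T_1)^{-1}\}$ is the free group $k$-algebra on $\{1+S_1,1+T_1\}$. (d) The $k$-subalgebra generated by $\{S_1^2,T_1^2\}$ is the free $k$-algebra on $\{S_1^2,T_1^2\}$. (e) The $k$-subalgebra generated by $\{1+S_1^2,(1+S_1^2)^{-1},1+T_1^2,(1+T_1^2)^{-1}\}$ is the free group $k$-algebra on $\{1+S_1^2,1+T_1^2\}$. (3) (a) The elements $S_1,S_1^2,T_2,T_2^2$ are symmetric with respect to $\eta_1$. (b) The $k$-subalgebra generated by $\{S_1,T_2\}$ is the free $k$-algebra on $\{S_1,T_2\}$. (c) The $k$-subalgebra generated by $\{1+S_1,(1+S_1)^{-1},1+T_2,(1+T_2)^{-1}\}$ is the free group $k$-algebra on $\{1+S_1,1+T_2\}$. (d) The $k$-subalgebra generated by $\{S_1^2,T_2^2\}$ is the free $k$-algebra on $\{S_1^2,T_2^2\}$. (e) The $k$-subalgebra generated by $\{1+S_1^2,(1+S_1^2)^{-1},1+T_2^2,(1+T_2^2)^{-1}\}$ is the free group $k$-algebra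 on $\{1+S_1^2,1+T_2^2\}$. (4) (a) The elements $S_2,S_2^2,T_3,T_3^2$ are symmetric with respect to $\eta_2$ and with respect to $\eta_3$. (b) The $k$-subalgebra generated by $\{S_2^2,T_3^2\}$ is the free $k$-algebra on $\{S_2^2,T_3^2\}$. (5) (a) The elements $S_2,S_2^2,T_4,T_4^2$ are symmetric with respect to $\eta_1$. (b) The $k$-subalgebra generated by $\{S_2^2,T_4^2\}$ is the free $k$-algebra on $\{S_2^2,T_4^2\}$.
   Context: $H$ has $k$-basis $x,y,z$ with $z=[y,x]$ central; $U(H)$ is an Ore domain. A $k$-involution of a Lie $k$-algebra $L$ is a $k$-linear map $*\colon L\to L$ with $[a,b]^*=[b^*,a^*]$, $a^{**}=a$; it extends uniquely to a $k$-linear anti-automorphism of order dividing two of $U(L)$ and of its Ore ring of fractions. An element $a$ is symmetric with respect to $*$ if $a^*=a$. For invertible $A,B$ in a $k$-algebra, "the $k$-subalgebra generated by $\{A,A^{-1},B,B^{-1}\}$ is the free group $k$-algebra on $\{A,B\}$" means that the natural homomorphism from the group algebra over $k$ of the free group on two letters, sending the letters to $A$ and $B$, is injective; similarly for the free $k$-algebra (noncommutative polynomials in two letters). *)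

theory Defs
  imports Complex_Main "HOL-Library.Poly_Mapping"
begin

section \<open>Algebras over a field\<close>

text \<open>
  A (unital, associative) \<open>k\<close>-algebra is given by a ring \<open>'a\<close> together with its structure map
  \<open>e\<close>, a unital ring homomorphism from \<open>k\<close> to the centre of \<open>'a\<close>.
\<close>

definition k_algebra :: "('k::field \<Rightarrow> 'a::ring_1) \<Rightarrow> bool" where
  "k_algebra e \<longleftrightarrow>
     e 1 = 1 \<and> (\<forall>c d. e (c + d) = e c + e d) \<and> (\<forall>c d. e (c * d) = e c * e d) \<and>
     (\<forall>c a. e c * a = a * e c)"

definition k_algebra_hom ::
  "('k::field \<Rightarrow> 'a::ring_1) \<Rightarrow> ('k \<Rightarrow> 'b::ring_1) \<Rightarrow> ('a \<Rightarrow> 'b) \<Rightarrow> bool" where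
  "k_algebra_hom e e' \<phi> \<longleftrightarrow>
     (\<forall>p q. \<phi> (p + q) = \<phi> p + \<phi> q) \<and> (\<forall>p q. \<phi> (p * q) = \<phi> p * \<phi> q) \<and>
     (\<forall>c. \<phi> (e c) = e' c)"

inductive_set ideal_gen :: "'a::ring_1 set \<Rightarrow> 'a set" for G :: "'a set" where
  ideal_base: "g \<in> G \<Longrightarrow> g \<in> ideal_gen G"
| ideal_zero: "0 \<in> ideal_gen G"
| ideal_add: "p \<in> ideal_gen G \<Longrightarrow> q \<in> ideal_gen G \<Longrightarrow> p + q \<in> ideal_gen G"
| ideal_mult_left: "p \<in> ideal_gen G \<Longrightarrow> r * p \<in> ideal_gen G"
| ideal_mult_right: "p \<in> ideal_gen G \<Longrightarrow> p * r \<in> ideal_gen G"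

lemma ideal_uminus: "p \<in> ideal_gen G \<Longrightarrow> - p \<in> ideal_gen G"
  using ideal_mult_left[of p G "- 1"] by simp

lemma ideal_diff: "p \<in> ideal_gen G \<Longrightarrow> q \<in> ideal_gen G \<Longrightarrow> p - q \<in> ideal_gen G"
  using ideal_add[of p G "- q"] ideal_uminus[of q G] by simp


section \<open>Free monoids, free groups and their algebras\<close>

text \<open>
  Both are written additively, so that \<open>g \<Rightarrow>\<^sub>0 k\<close> (finitely supported functions with
  the convolution product of \<^theory>\<open>HOL-Library.Poly_Mapping\<close>) is the monoid algebra of \<open>g\<close>
  over \<open>k\<close>; neither addition is commutative.
\<close>

datatype 'a free_monoid = Word "'a list"

instantiation free_monoid :: (type) monoid_add
begin
definition zero_free_monoid :: "'a free_monoid" where "0 = Word []"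
fun plus_free_monoid :: "'a free_monoid \<Rightarrow> 'a free_monoid \<Rightarrow> 'a free_monoid" where
  "Word u + Word v = Word (u @ v)"
instance
proof
  fix a b c :: "'a free_monoid"
  show "a + b + c = a + (b + c)" by (cases a; cases b; cases c) simp
  show "0 + a = a" "a + 0 = a" by (cases a; simp add: zero_free_monoid_def)+
qed
end

text \<open>A signed letter \<open>(a, True)\<close> stands for \<open>a\<close> and \<open>(a, False)\<close> for its inverse.\<close>

inductive fg_rel :: "('a \<times> bool) list \<Rightarrow> ('a \<times> bool) list \<Rightarrow> bool" where
  fg_cancel: "fg_rel (u @ [(a, s), (a, \<not> s)] @ v) (u @ v)"
| fg_refl: "fg_rel u u"
| fg_sym: "fg_rel u v \<Longrightarrow> fg_rel v u"
| fg_trans: "fg_rel u v \<Longrightarrow> fg_rel v w \<Longrightarrow> fg_rel u w"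

quotient_type 'a free_group = "('a \<times> bool) list" / fg_rel
  by (rule equivpI) (auto intro: reflpI sympI transpI fg_refl fg_sym fg_trans)

lemma fg_rel_append_left: "fg_rel u v \<Longrightarrow> fg_rel (w @ u) (w @ v)"
proof (induction rule: fg_rel.induct)
  case (fg_cancel u a s v)
  show ?case using fg_rel.fg_cancel[of "w @ u" a s v] by simp
qed (auto intro: fg_rel.intros)

lemma fg_rel_append_right: "fg_rel u v \<Longrightarrow> fg_rel (u @ w) (v @ w)"
proof (induction rule: fg_rel.induct)
  case (fg_cancel u a s v)
  show ?case using fg_rel.fg_cancel[of u a s "v @ w"] by simp
qed (auto intro: fg_rel.intros)

definition inv_word :: "('a \<times> bool) list \<Rightarrow> ('a \<times> bool) list" where
  "inv_word u = rev (map (\<lambda>(a, s). (a, \<not> s)) u)"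

lemma fg_rel_inv_word: "fg_rel u v \<Longrightarrow> fg_rel (inv_word u) (inv_word v)"
proof (induction rule: fg_rel.induct)
  case (fg_cancel u a s v)
  show ?case
    using fg_rel.fg_cancel[of "inv_word v" a s "inv_word u"] by (simp add: inv_word_def)
qed (auto intro: fg_rel.intros)

lemma fg_rel_inv_word_append: "fg_rel (inv_word u @ u) []"
proof (induction u)
  case (Cons x u)
  obtain a s where x: "x = (a, s)" by (cases x)
  have "fg_rel (inv_word (x # u) @ x # u) (inv_word u @ u)"
    using fg_cancel[of "inv_word u" a "\<not> s" u] by (simp add: inv_word_def x)
  then show ?case using Cons fg_trans by blast
qed (simp add: inv_word_def fg_refl)

instantiation free_group :: (type) group_add
begin
lift_definition zero_free_group :: "'a free_group" is "[]" .
lift_definition plus_free_group :: "'a free_group \<Rightarrow> 'a free_group \<Rightarrow> 'a free_group" is "(@)"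
  by (meson fg_rel_append_left fg_rel_append_right fg_trans)
lift_definition uminus_free_group :: "'a free_group \<Rightarrow> 'a free_group" is inv_word
  by (rule fg_rel_inv_word)
definition minus_free_group :: "'a free_group \<Rightarrow> 'a free_group \<Rightarrow> 'a free_group" where
  "a - b = a + (- b)" for a b :: "'a free_group"
instance
proof
  fix a b c :: "'a free_group"
  show "a + b + c = a + (b + c)" by transfer (simp add: fg_refl)
  show "0 + a = a" "a + 0 = a" by (transfer, simp add: fg_refl)+
  show "- a + a = 0" by transfer (rule fg_rel_inv_word_append)
  show "a + (- b) = a - b" by (simp add: minus_free_group_def)
qed
end

lift_definition fg_gen :: "'a \<Rightarrow> 'a free_group" is "\<lambda>a. [(a, True)]" .

datatype letter = La | Lb

definition is_free_algebra_on :: "('k::field \<Rightarrow> 'a::ring_1) \<Rightarrow> 'a \<Rightarrow> 'a \<Rightarrow> bool" where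
  "is_free_algebra_on e A B \<longleftrightarrow>
     (\<exists>\<phi> :: (letter free_monoid \<Rightarrow>\<^sub>0 'k) \<Rightarrow> 'a.
        k_algebra_hom (Poly_Mapping.single 0) e \<phi> \<and>
        \<phi> (Poly_Mapping.single (Word [La]) 1) = A \<and>
        \<phi> (Poly_Mapping.single (Word [Lb]) 1) = B \<and> inj \<phi>)"

text \<open>The homomorphism exists only if \<open>A\<close> and \<open>B\<close> are invertible, and is then unique.\<close>

definition is_free_group_algebra_on :: "('k::field \<Rightarrow> 'a::ring_1) \<Rightarrow> 'a \<Rightarrow> 'a \<Rightarrow> bool" where
  "is_free_group_algebra_on e A B \<longleftrightarrow>
     (\<exists>\<phi> :: (letter free_group \<Rightarrow>\<^sub>0 'k) \<Rightarrow> 'a.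
        k_algebra_hom (Poly_Mapping.single 0) e \<phi> \<and>
        \<phi> (Poly_Mapping.single (fg_gen La) 1) = A \<and>
        \<phi> (Poly_Mapping.single (fg_gen Lb) 1) = B \<and> inj \<phi>)"


section \<open>Lie algebras and the Heisenberg Lie algebra\<close>

locale lie_algebra = vector_space scale
  for scale :: "'k::field \<Rightarrow> 'l::ab_group_add \<Rightarrow> 'l" +
  fixes bracket :: "'l \<Rightarrow> 'l \<Rightarrow> 'l"
  assumes bracket_add_left: "bracket (a + b) c = bracket a c + bracket b c"
    and bracket_add_right: "bracket a (b + c) = bracket a b + bracket a c"
    and bracket_scale_left: "bracket (scale r a) b = scale r (bracket a b)"
    and bracket_scale_right: "bracket a (scale r b) = scale r (bracket a b)"
    and bracket_alternating: "bracket a a = 0"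
    and jacobi: "bracket a (bracket b c) + bracket b (bracket c a) + bracket c (bracket a b) = 0"

definition k_involution ::
  "('k::field \<Rightarrow> 'l::ab_group_add \<Rightarrow> 'l) \<Rightarrow> ('l \<Rightarrow> 'l \<Rightarrow> 'l) \<Rightarrow> ('l \<Rightarrow> 'l) \<Rightarrow> bool" where
  "k_involution scale bracket star \<longleftrightarrow>
     Vector_Spaces.linear scale scale star \<and>
     (\<forall>a b. star (bracket a b) = bracket (star b) (star a)) \<and> (\<forall>a. star (star a) = a)"

text \<open>\<open>Heis a b c\<close> is \<open>a x + b y + c z\<close>.\<close>

datatype 'k heis = Heis (cx: 'k) (cy: 'k) (cz: 'k)

instantiation heis :: (ab_group_add) ab_group_add
begin
definition zero_heis :: "'a heis" where "0 = Heis 0 0 0"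
definition plus_heis :: "'a heis \<Rightarrow> 'a heis \<Rightarrow> 'a heis" where
  "g + h = Heis (cx g + cx h) (cy g + cy h) (cz g + cz h)"
definition uminus_heis :: "'a heis \<Rightarrow> 'a heis" where
  "- g = Heis (- cx g) (- cy g) (- cz g)"
definition minus_heis :: "'a heis \<Rightarrow> 'a heis \<Rightarrow> 'a heis" where
  "g - h = Heis (cx g - cx h) (cy g - cy h) (cz g - cz h)"
instance
  by standard (auto simp: zero_heis_def plus_heis_def uminus_heis_def minus_heis_def add_ac)
end

definition heis_scale :: "'k::field \<Rightarrow> 'k heis \<Rightarrow> 'k heis" where
  "heis_scale r g = Heis (r * cx g) (r * cy g) (r * cz g)"

text \<open>The bilinear extension of \<open>[y, x] = z\<close>, \<open>z\<close> central.\<close>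

definition heis_bracket :: "'k::field heis \<Rightarrow> 'k heis \<Rightarrow> 'k heis" where
  "heis_bracket g h = Heis 0 0 (cy g * cx h - cx g * cy h)"

lemmas heis_ops = zero_heis_def plus_heis_def uminus_heis_def minus_heis_def
  heis_scale_def heis_bracket_def

interpretation heis: lie_algebra heis_scale heis_bracket
  by unfold_locales (auto simp: heis_ops algebra_simps)

definition heis_x :: "'k::field heis" where "heis_x = Heis 1 0 0"
definition heis_y :: "'k::field heis" where "heis_y = Heis 0 1 0"
definition heis_z :: "'k::field heis" where "heis_z = Heis 0 0 1"

lemma heis_relations:
  "heis_bracket heis_y heis_x = heis_z"
  "heis_bracket (heis_bracket heis_y heis_x) heis_x = 0"
  "heis_bracket (heis_bracket heis_y heis_x) heis_y = 0"
  by (auto simp: heis_ops heis_x_def heis_y_def heis_z_def)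

text \<open>
  The coordinate model is the Lie algebra presented by generators \<open>x, y\<close> and relations
  \<open>[[y,x],x] = [[y,x],y] = 0\<close>.
\<close>

theorem heis_presentation:
  fixes s :: "'k::field \<Rightarrow> 'l::ab_group_add \<Rightarrow> 'l"
  assumes "lie_algebra s br" and ba: "br (br b a) a = 0" and bb: "br (br b a) b = 0"
  shows "\<exists>!f. Vector_Spaces.linear heis_scale s f \<and> (\<forall>g h. f (heis_bracket g h) = br (f g) (f h)) \<and>
              f heis_x = a \<and> f heis_y = b"
proof -
  interpret L: lie_algebra s br by fact
  have skew: "br u v = - br v u" for u v
    using L.bracket_alternating[of "u + v"] L.bracket_alternating[of u] L.bracket_alternating[of v]
    by (simp add: L.bracket_add_left L.bracket_add_right eq_neg_iff_add_eq_0 add.commute)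
  have ab: "br a (br b a) = 0" "br b (br b a) = 0"
    using skew[of a "br b a"] skew[of b "br b a"] ba bb by simp_all
  have sw: "br a b = - br b a" by (rule skew)
  define f where "f g = s (cx g) a + s (cy g) b + s (cz g) (br b a)" for g :: "'k heis"
  have lin: "Vector_Spaces.linear heis_scale s f"
    unfolding Vector_Spaces.linear_iff
    by (auto simp: heis.vector_space_axioms L.vector_space_axioms f_def heis_ops
        L.scale_left_distrib L.scale_right_distrib L.scale_scale)
  have br: "f (heis_bracket g h) = br (f g) (f h)" for g h
    by (simp add: f_def heis_bracket_def L.bracket_add_left L.bracket_add_right
        L.bracket_scale_left L.bracket_scale_right L.bracket_alternating ba bb ab sw
        L.scale_left_diff_distrib mult.commute)
  show ?thesis
  proof (rule ex1I[of _ f])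
    show "Vector_Spaces.linear heis_scale s f \<and> (\<forall>g h. f (heis_bracket g h) = br (f g) (f h)) \<and>
      f heis_x = a \<and> f heis_y = b"
      using lin br by (simp add: f_def heis_x_def heis_y_def)
  next
    fix f' assume f': "Vector_Spaces.linear heis_scale s f' \<and>
      (\<forall>g h. f' (heis_bracket g h) = br (f' g) (f' h)) \<and> f' heis_x = a \<and> f' heis_y = b"
    then have z: "f' heis_z = br b a" by (metis heis_relations(1))
    have add: "f' (u + v) = f' u + f' v" and sc: "f' (heis_scale r u) = s r (f' u)" for u v r
      using f' by (auto simp: Vector_Spaces.linear_iff)
    show "f' = f"
    proof
      fix g :: "'k heis"
      have "g = heis_scale (cx g) heis_x + heis_scale (cy g) heis_y + heis_scale (cz g) heis_z"
        by (cases g) (simp add: heis_ops heis_x_def heis_y_def heis_z_def)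
      then have "f' g = f' (heis_scale (cx g) heis_x + heis_scale (cy g) heis_y
                          + heis_scale (cz g) heis_z)"
        by simp
      then show "f' g = f g" using f' z by (simp add: add sc f_def)
    qed
  qed
qed

definition eta1 :: "'k::field heis \<Rightarrow> 'k heis" where
  "eta1 g = Heis (cx g) (- cy g) (cz g)"
definition eta2 :: "'k::field heis \<Rightarrow> 'k heis" where
  "eta2 g = Heis (cx g) (cy g) (- cz g)"
definition eta3 :: "'k::field heis \<Rightarrow> 'k heis" where
  "eta3 g = Heis (- cx g) (- cy g) (- cz g)"

lemma k_involution_etas:
  "k_involution heis_scale heis_bracket eta1"
  "k_involution heis_scale heis_bracket eta2"
  "k_involution heis_scale heis_bracket eta3"
  by (auto simp: k_involution_def Vector_Spaces.linear_iff heis.vector_space_axioms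
      eta1_def eta2_def eta3_def heis_ops algebra_simps)


section \<open>Universal enveloping algebras\<close>

text \<open>
  The enveloping algebra of a Lie algebra \<open>L\<close> is the quotient of the free algebra on the set \<open>L\<close>
  by the ideal generated by the following elements; the first two families turn the free algebra
  into the tensor algebra of the vector space \<open>L\<close>.
\<close>

abbreviation (input) gen :: "'l \<Rightarrow> ('l free_monoid \<Rightarrow>\<^sub>0 'k::field)" where
  "gen a \<equiv> Poly_Mapping.single (Word [a]) 1"

definition env_relators ::
  "('k::field \<Rightarrow> 'l::ab_group_add \<Rightarrow> 'l) \<Rightarrow> ('l \<Rightarrow> 'l \<Rightarrow> 'l) \<Rightarrow> ('l free_monoid \<Rightarrow>\<^sub>0 'k) set" where
  "env_relators scale bracket =
     {gen (a + b) - (gen a + gen b) |a b. True} \<union>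
     {gen (scale r a) - Poly_Mapping.single 0 r * gen a |r a. True} \<union>
     {gen a * gen b - gen b * gen a - gen (bracket a b) |a b. True}"

definition env_rel :: "('k::field heis free_monoid \<Rightarrow>\<^sub>0 'k) \<Rightarrow> ('k heis free_monoid \<Rightarrow>\<^sub>0 'k) \<Rightarrow> bool"
  where "env_rel p q \<longleftrightarrow> p - q \<in> ideal_gen (env_relators heis_scale heis_bracket)"

lemma equivp_env_rel: "equivp (env_rel :: ('k::field heis free_monoid \<Rightarrow>\<^sub>0 'k) \<Rightarrow> _)"
proof (rule equivpI)
  show "reflp (env_rel :: ('k heis free_monoid \<Rightarrow>\<^sub>0 'k) \<Rightarrow> _)" by (rule reflpI) (simp add: env_rel_def ideal_zero)
  show "symp (env_rel :: ('k heis free_monoid \<Rightarrow>\<^sub>0 'k) \<Rightarrow> _)"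
    by (rule sympI) (metis env_rel_def ideal_uminus minus_diff_eq)
  show "transp (env_rel :: ('k heis free_monoid \<Rightarrow>\<^sub>0 'k) \<Rightarrow> _)"
  proof (rule transpI)
    fix p q r :: "'k heis free_monoid \<Rightarrow>\<^sub>0 'k"
    assume "env_rel p q" "env_rel q r"
    then show "env_rel p r" unfolding env_rel_def
      using ideal_add[of "p - q" _ "q - r"] by simp
  qed
qed

quotient_type (overloaded) 'k UH = "('k::field heis free_monoid \<Rightarrow>\<^sub>0 'k)" / env_rel
  by (rule equivp_env_rel)

text \<open>Additive extension of a family \<open>m\<close> indexed by a monoid to the monoid algebra.\<close>

definition meval :: "('k::field \<Rightarrow> 'a::ring_1) \<Rightarrow> ('g \<Rightarrow> 'a) \<Rightarrow> ('g \<Rightarrow>\<^sub>0 'k) \<Rightarrow> 'a" where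
  "meval e m p = (\<Sum>g\<in>Poly_Mapping.keys p. e (Poly_Mapping.lookup p g) * m g)"

lemma k_algebra_zero: "k_algebra e \<Longrightarrow> e 0 = 0"
  unfolding k_algebra_def by (metis add.right_neutral add_left_cancel)

lemma k_algebra_add: "k_algebra e \<Longrightarrow> e (c + d) = e c + e d"
  by (simp add: k_algebra_def)

lemma meval_single: "k_algebra e \<Longrightarrow> meval e m (Poly_Mapping.single g c) = e c * m g"
  by (simp add: meval_def k_algebra_zero)

lemma meval_add: "k_algebra e \<Longrightarrow> meval e m (p + q) = meval e m p + meval e m q"
  unfolding meval_def
  by (rule setsum_keys_plus_distrib) (simp_all add: k_algebra_zero k_algebra_add distrib_right)

lemma poly_mapping_single_induct [case_names zero add]:
  assumes "P 0" and "\<And>p g c. P p \<Longrightarrow> P (Poly_Mapping.single g c + p)"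
  shows "P (p :: 'g \<Rightarrow>\<^sub>0 'k::field)"
proof (induction p rule: update_induct)
  case (update f a b)
  have "Poly_Mapping.update a b f = Poly_Mapping.single a b + f"
    using update(1)
    by (intro poly_mapping_eqI)
       (auto simp: lookup_update lookup_add lookup_single in_keys_iff when_def)
  then show ?case using assms(2) update by simp
qed (rule assms)

lemma meval_mult:
  assumes e: "k_algebra e" and m: "\<And>g h. m (g + h) = m g * m h"
  shows "meval e m (p * q) = meval e m p * meval e m q"
proof (induction p rule: poly_mapping_single_induct)
  case (add p g c)
  have "meval e m (Poly_Mapping.single g c * q) = e c * m g * meval e m q"
  proof (induction q rule: poly_mapping_single_induct)
    case (add q h d)
    have "e (c * d) * m (g + h) = e c * m g * (e d * m h)"
      using e m unfolding k_algebra_def by (metis mult.assoc)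
    then show ?case using add
      by (simp add: distrib_left mult_single meval_add[OF e] meval_single[OF e])
  qed (simp add: meval_def)
  then show ?case using add by (simp add: distrib_right meval_add[OF e] meval_single[OF e])
qed (simp add: meval_def)

lemma meval_mult_anti:
  assumes e: "k_algebra e" and m: "\<And>g h. m (g + h) = m h * m g"
  shows "meval e m (p * q) = meval e m q * meval e m p"
proof (induction p rule: poly_mapping_single_induct)
  case (add p g c)
  have "meval e m (Poly_Mapping.single g c * q) = meval e m q * (e c * m g)"
  proof (induction q rule: poly_mapping_single_induct)
    case (add q h d)
    have "e (c * d) * m (g + h) = (e d * m h) * (e c * m g)"
      using e m unfolding k_algebra_def by (metis mult.assoc)
    then show ?case using add
      by (simp add: distrib_left distrib_right mult_single meval_add[OF e] meval_single[OF e])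
  qed (simp add: meval_def)
  then show ?case using add
    by (simp add: distrib_left distrib_right meval_add[OF e] meval_single[OF e])
qed (simp add: meval_def)

lemma meval_diff: "k_algebra e \<Longrightarrow> meval e m (p - q) = meval e m p - meval e m q"
  using meval_add[of e m "p - q" q] by simp

lemma env_rel_one_zero: "\<not> env_rel (0 :: 'k::field heis free_monoid \<Rightarrow>\<^sub>0 'k) 1"
proof
  assume *: "env_rel (0 :: 'k heis free_monoid \<Rightarrow>\<^sub>0 'k) 1"
  define m :: "'k heis free_monoid \<Rightarrow> 'k" where "m w = (if w = 0 then 1 else 0)" for w
  have e: "k_algebra (\<lambda>c::'k. c)" by (simp add: k_algebra_def)
  have m: "m (u + v) = m u * m v" for u v
    by (cases u; cases v) (simp add: m_def zero_free_monoid_def)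
  have m1: "m (Word [a]) = 0" for a by (simp add: m_def zero_free_monoid_def)
  let ?E = "meval (\<lambda>c. c) m"
  have "?E p = 0" if "p \<in> ideal_gen (env_relators heis_scale heis_bracket)" for p
    using that
  proof induction
    case (ideal_base g)
    then show ?case
      by (auto simp: env_relators_def meval_diff[OF e] meval_add[OF e] meval_single[OF e]
          meval_mult[OF e m] m1)
  qed (simp_all add: meval_add[OF e] meval_mult[OF e m], simp add: meval_def)
  then have "?E (0 - 1) = 0" using * by (simp only: env_rel_def)
  moreover have "?E 1 = 1"
    using meval_single[OF e, of m 0 1] by (simp add: m_def)
  moreover have "?E 0 = 0" by (simp add: meval_def)
  ultimately show False by (simp only: meval_diff[OF e]) simp
qed

instantiation UH :: (field) ring_1
begin
lift_definition zero_UH :: "'a UH" is 0 .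
lift_definition one_UH :: "'a UH" is 1 .
lift_definition plus_UH :: "'a UH \<Rightarrow> 'a UH \<Rightarrow> 'a UH" is "(+)"
  unfolding env_rel_def by (simp add: add_diff_add ideal_add)
lift_definition uminus_UH :: "'a UH \<Rightarrow> 'a UH" is uminus
  unfolding env_rel_def
proof -
  fix p q :: "'a heis free_monoid \<Rightarrow>\<^sub>0 'a"
  assume "p - q \<in> ideal_gen (env_relators heis_scale heis_bracket)"
  from ideal_uminus[OF this]
  show "- p - - q \<in> ideal_gen (env_relators heis_scale heis_bracket)" by simp
qed
lift_definition minus_UH :: "'a UH \<Rightarrow> 'a UH \<Rightarrow> 'a UH" is minus
  unfolding env_rel_def
proof -
  fix p q p' q' :: "'a heis free_monoid \<Rightarrow>\<^sub>0 'a"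
  assume "p - q \<in> ideal_gen (env_relators heis_scale heis_bracket)"
    "p' - q' \<in> ideal_gen (env_relators heis_scale heis_bracket)"
  from ideal_diff[OF this]
  show "p - p' - (q - q') \<in> ideal_gen (env_relators heis_scale heis_bracket)"
    by (simp add: algebra_simps)
qed
lift_definition times_UH :: "'a UH \<Rightarrow> 'a UH \<Rightarrow> 'a UH" is "(*)"
  unfolding env_rel_def
proof -
  fix p q p' q' :: "'a heis free_monoid \<Rightarrow>\<^sub>0 'a"
  assume "p - q \<in> ideal_gen (env_relators heis_scale heis_bracket)"
    "p' - q' \<in> ideal_gen (env_relators heis_scale heis_bracket)"
  from ideal_add[OF ideal_mult_right[OF this(1), of p'] ideal_mult_left[OF this(2), of q]]
  show "p * p' - q * q' \<in> ideal_gen (env_relators heis_scale heis_bracket)"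
    by (simp add: algebra_simps)
qed
instance
proof
  have eq: "env_rel p q" if "p = q" for p q :: "'a heis free_monoid \<Rightarrow>\<^sub>0 'a"
    using that by (simp add: env_rel_def ideal_zero)
  fix a b c :: "'a UH"
  show "a + b + c = a + (b + c)" by (transfer, rule eq, simp add: add.assoc)
  show "a + b = b + a" by (transfer, rule eq, simp add: add.commute)
  show "0 + a = a" by (transfer, rule eq, simp)
  show "- a + a = 0" by (transfer, rule eq, simp)
  show "a - b = a + - b" by (transfer, rule eq, simp)
  show "a * b * c = a * (b * c)" by (transfer, rule eq, simp add: mult.assoc)
  show "(a + b) * c = a * c + b * c" by (transfer, rule eq, simp add: distrib_right)
  show "a * (b + c) = a * b + a * c" by (transfer, rule eq, simp add: distrib_left)
  show "1 * a = a" "a * 1 = a" by (transfer, rule eq, simp)+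
  show "(0::'a UH) \<noteq> 1" by (transfer, rule env_rel_one_zero)
qed
end

text \<open>The structure map of the \<open>k\<close>-algebra \<open>U(H)\<close> and the canonical map from \<open>H\<close> to \<open>U(H)\<close>.\<close>

lift_definition UH_const :: "'k::field \<Rightarrow> 'k UH" is "Poly_Mapping.single 0" .
lift_definition UH_of :: "'k::field heis \<Rightarrow> 'k UH" is "\<lambda>a. Poly_Mapping.single (Word [a]) 1" .

lemma UH_const_k_algebra: "k_algebra (UH_const :: 'k::field \<Rightarrow> 'k UH)"
proof -
  have eq: "env_rel p q" if "p = q" for p q :: "'k heis free_monoid \<Rightarrow>\<^sub>0 'k"
    using that by (simp add: env_rel_def ideal_zero)
  have comm: "Poly_Mapping.single 0 c * p = p * Poly_Mapping.single 0 c"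
    for c :: 'k and p :: "'k heis free_monoid \<Rightarrow>\<^sub>0 'k"
    by (induction p rule: poly_mapping_single_induct)
       (simp_all add: distrib_left distrib_right mult_single mult.commute)
  show ?thesis
    unfolding k_algebra_def
  proof (intro conjI allI)
    show "UH_const (1::'k) = 1" by (transfer, rule eq, simp)
    fix c d :: 'k and a :: "'k UH"
    show "UH_const (c + d) = UH_const c + UH_const d" by (transfer, rule eq, simp add: single_add)
    show "UH_const (c * d) = UH_const c * UH_const d" by (transfer, rule eq, simp add: mult_single)
    show "UH_const c * a = a * UH_const c" by (transfer, rule eq, rule comm)
  qed
qed

lemma UH_of_add: "UH_of (a + b) = UH_of a + UH_of b"
  by transfer (auto simp: env_rel_def env_relators_def intro!: ideal_base)

lemma UH_of_scale: "UH_of (heis_scale r a) = UH_const r * UH_of a"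
  by transfer (unfold env_rel_def, rule ideal_base, auto simp: env_relators_def)

lemma UH_of_bracket: "UH_of (heis_bracket a b) = UH_of a * UH_of b - UH_of b * UH_of a"
proof (transfer, unfold env_rel_def)
  fix a b :: "'a heis"
  have "gen a * gen b - gen b * gen a - gen (heis_bracket a b)
      \<in> ideal_gen (env_relators heis_scale heis_bracket)"
    by (rule ideal_base) (auto simp: env_relators_def)
  from ideal_uminus[OF this]
  show "gen (heis_bracket a b) - (gen a * gen b - gen b * gen a)
      \<in> ideal_gen (env_relators heis_scale heis_bracket)"
    by simp
qed

lemma UH_induct [case_names const of_heis add mult]:
  assumes c: "\<And>c. P (UH_const c)" and h: "\<And>h. P (UH_of h)"
    and a: "\<And>u v. P u \<Longrightarrow> P v \<Longrightarrow> P (u + v)" and m: "\<And>u v. P u \<Longrightarrow> P v \<Longrightarrow> P (u * v)"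
  shows "P (u :: 'k::field UH)"
proof -
  have w: "P (abs_UH (Poly_Mapping.single (Word w) 1))" for w
  proof (induction w)
    case Nil
    show ?case using c[of 1]
      by (simp add: UH_const.abs_eq flip: zero_free_monoid_def)
  next
    case (Cons h w)
    have "abs_UH (Poly_Mapping.single (Word (h # w)) 1)
        = UH_of h * abs_UH (Poly_Mapping.single (Word w) 1)"
      by (simp add: UH_of.abs_eq times_UH.abs_eq mult_single)
    then show ?case using m h Cons by simp
  qed
  have "P (abs_UH p)" for p
  proof (induction p rule: poly_mapping_single_induct)
    case zero
    show ?case using c[of 0] by (simp add: UH_const.abs_eq)
  next
    case (add p g r)
    obtain w where g: "g = Word w" by (cases g)
    have "abs_UH (Poly_Mapping.single g r + p)
        = UH_const r * abs_UH (Poly_Mapping.single (Word w) 1) + abs_UH p"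
      by (simp add: g UH_const.abs_eq times_UH.abs_eq plus_UH.abs_eq mult_single)
    then show ?case using add w a m c by simp
  qed
  then show ?thesis by (metis Quotient3_abs_rep Quotient3_UH)
qed

text \<open>
  Additive maps on the free algebra that kill the relators and are multiplicative or
  anti-multiplicative descend to \<open>U(H)\<close>.
\<close>

lemma UH_descend:
  fixes F :: "('k::field heis free_monoid \<Rightarrow>\<^sub>0 'k) \<Rightarrow> 'a::ring_1"
  assumes add: "\<And>p q. F (p + q) = F p + F q"
    and mult: "(\<forall>p q. F (p * q) = F p * F q) \<or> (\<forall>p q. F (p * q) = F q * F p)"
    and rel: "\<And>r. r \<in> env_relators heis_scale heis_bracket \<Longrightarrow> F r = 0"
  obtains \<phi> where "\<And>p. \<phi> (abs_UH p) = F p"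
proof -
  have F0: "F 0 = 0" using add[of 0 0] by simp
  have ideal: "F p = 0" if "p \<in> ideal_gen (env_relators heis_scale heis_bracket)" for p
    using that
  proof induction
    case (ideal_mult_left p r) then show ?case using mult by auto
  next
    case (ideal_mult_right p r) then show ?case using mult by auto
  qed (simp_all add: rel F0 add)
  have F: "F p = F q" if "env_rel p q" for p q
    using add[of "p - q" q] ideal[of "p - q"] that by (simp add: env_rel_def)
  have "F (rep_UH (abs_UH p)) = F p" for p
    by (rule F) (simp add: Quotient3_UH rep_abs_rsp_left equivp_reflp[OF equivp_env_rel])
  then show ?thesis using that[of "\<lambda>u. F (rep_UH u)"] by blast
qed

theorem UH_universal_property:
  fixes e :: "'k::field \<Rightarrow> 'a::ring_1" and f :: "'k heis \<Rightarrow> 'a"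
  assumes e: "k_algebra e"
    and add: "\<And>g h. f (g + h) = f g + f h" and sc: "\<And>r g. f (heis_scale r g) = e r * f g"
    and br: "\<And>g h. f (heis_bracket g h) = f g * f h - f h * f g"
  shows "\<exists>!\<phi>. k_algebra_hom UH_const e \<phi> \<and> (\<forall>h. \<phi> (UH_of h) = f h)"
proof -
  define m where "m w = (case w of Word u \<Rightarrow> prod_list (map f u))" for w
  have m: "m (g + h) = m g * m h" for g h by (cases g; cases h) (simp add: m_def)
  have m1: "m (Word [a]) = f a" and m0: "m 0 = 1" for a
    by (simp_all add: m_def zero_free_monoid_def)
  have e1: "e 1 = 1" using e by (simp add: k_algebra_def)
  note simps = meval_add[OF e] meval_diff[OF e] meval_mult[of e m, OF e m] meval_single[OF e]
  obtain \<phi> where \<phi>: "\<And>p. \<phi> (abs_UH p) = meval e m p"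
    by (rule UH_descend[of "meval e m"])
       (auto simp: simps env_relators_def m1 m0 e1 add sc br)
  have abs: "\<exists>p. u = abs_UH p" for u :: "'k UH" by (metis Quotient3_abs_rep Quotient3_UH)
  have "k_algebra_hom UH_const e \<phi>"
    unfolding k_algebra_hom_def
  proof (intro conjI allI)
    fix u v :: "'k UH" and c
    obtain p q where "u = abs_UH p" "v = abs_UH q" using abs by meson
    then show "\<phi> (u + v) = \<phi> u + \<phi> v" "\<phi> (u * v) = \<phi> u * \<phi> v"
      by (simp_all add: plus_UH.abs_eq times_UH.abs_eq \<phi> simps)
    show "\<phi> (UH_const c) = e c" by (simp add: UH_const.abs_eq \<phi> simps m0)
  qed
  moreover have "\<phi> (UH_of h) = f h" for h by (simp add: UH_of.abs_eq \<phi> simps m1 e1)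
  moreover have "\<psi> = \<phi>" if \<psi>: "k_algebra_hom UH_const e \<psi> \<and> (\<forall>h. \<psi> (UH_of h) = f h)" for \<psi>
  proof
    fix u show "\<psi> u = \<phi> u"
      using \<psi> calculation by (induction u rule: UH_induct) (auto simp: k_algebra_hom_def)
  qed
  ultimately show ?thesis by blast
qed

lemma UH_anti_involution:
  fixes \<eta> :: "'k::field heis \<Rightarrow> 'k heis"
  assumes \<eta>: "k_involution heis_scale heis_bracket \<eta>"
  obtains \<sigma> where "\<And>u v. \<sigma> (u + v) = \<sigma> u + \<sigma> v" "\<And>u v. \<sigma> (u * v) = \<sigma> v * \<sigma> u"
    "\<And>c. \<sigma> (UH_const c) = UH_const c" "\<And>h. \<sigma> (UH_of h) = UH_of (\<eta> h)" "\<And>u. \<sigma> (\<sigma> u) = u"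
proof -
  let ?e = "UH_const :: 'k \<Rightarrow> 'k UH"
  note e = UH_const_k_algebra
  define m where "m w = (case w of Word u \<Rightarrow> prod_list (rev (map (\<lambda>h. UH_of (\<eta> h)) u)))" for w
  have m: "m (g + h) = m h * m g" for g h by (cases g; cases h) (simp add: m_def)
  have m1: "m (Word [a]) = UH_of (\<eta> a)" and m0: "m 0 = 1" for a
    by (simp_all add: m_def zero_free_monoid_def)
  have e1: "?e 1 = 1" and comm: "?e c * u = u * ?e c" for c u
    using e by (auto simp: k_algebra_def)
  have \<eta>': "\<eta> (a + b) = \<eta> a + \<eta> b" "\<eta> (heis_scale r a) = heis_scale r (\<eta> a)"
    "\<eta> (heis_bracket a b) = heis_bracket (\<eta> b) (\<eta> a)" "\<eta> (\<eta> a) = a" for a b r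
    using \<eta> by (auto simp: k_involution_def Vector_Spaces.linear_iff)
  note simps = meval_add[OF e] meval_diff[OF e] meval_mult_anti[of ?e m, OF e m] meval_single[OF e]
  obtain \<sigma> where \<sigma>: "\<And>p. \<sigma> (abs_UH p) = meval ?e m p"
    by (rule UH_descend[of "meval ?e m"])
       (auto simp: simps env_relators_def m1 m0 e1 \<eta>' UH_of_add UH_of_scale UH_of_bracket comm)
  have abs: "\<exists>p. u = abs_UH p" for u :: "'k UH" by (metis Quotient3_abs_rep Quotient3_UH)
  have 1: "\<sigma> (u + v) = \<sigma> u + \<sigma> v" "\<sigma> (u * v) = \<sigma> v * \<sigma> u" for u v
  proof -
    obtain p q where "u = abs_UH p" "v = abs_UH q" using abs by meson
    then show "\<sigma> (u + v) = \<sigma> u + \<sigma> v" "\<sigma> (u * v) = \<sigma> v * \<sigma> u"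
      by (simp_all add: plus_UH.abs_eq times_UH.abs_eq \<sigma> simps)
  qed
  have 2: "\<sigma> (UH_const c) = UH_const c" for c by (simp add: UH_const.abs_eq[of c] \<sigma> simps m0)
  have 3: "\<sigma> (UH_of h) = UH_of (\<eta> h)" for h by (simp add: UH_of.abs_eq[of h] \<sigma> simps m1 e1)
  have "\<sigma> (\<sigma> u) = u" for u
    by (induction u rule: UH_induct) (simp_all add: 1 2 3 \<eta>')
  then show ?thesis using that 1 2 3 by blast
qed


section \<open>Ore division rings of fractions\<close>

text \<open>
  \<open>j\<close> exhibits the division ring \<open>'d\<close> as an Ore division ring of fractions of \<open>'u\<close>; this
  determines the pair up to unique isomorphism.
\<close>

definition ore_division_ring_of_fractions :: "('u::ring_1 \<Rightarrow> 'd::division_ring) \<Rightarrow> bool" where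
  "ore_division_ring_of_fractions j \<longleftrightarrow>
     j 1 = 1 \<and> (\<forall>u v. j (u + v) = j u + j v) \<and> (\<forall>u v. j (u * v) = j u * j v) \<and> inj j \<and>
     (\<forall>d. \<exists>u v. v \<noteq> 0 \<and> d = j u * inverse (j v))"

text \<open>\<open>star\<close> is a \<open>k\<close>-linear anti-automorphism, of order dividing two, extending \<open>\<eta>\<close>.\<close>

definition extends_involution ::
  "('k::field UH \<Rightarrow> 'd::division_ring) \<Rightarrow> ('k heis \<Rightarrow> 'k heis) \<Rightarrow> ('d \<Rightarrow> 'd) \<Rightarrow> bool" where
  "extends_involution j \<eta> star \<longleftrightarrow>
     (\<forall>a b. star (a + b) = star a + star b) \<and>
     (\<forall>c a. star (j (UH_const c) * a) = j (UH_const c) * star a) \<and>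
     (\<forall>a b. star (a * b) = star b * star a) \<and>
     (\<forall>a. star (star a) = a) \<and>
     (\<forall>h. star (j (UH_of h)) = j (UH_of (\<eta> h)))"

definition involution_ext ::
  "('k::field UH \<Rightarrow> 'd::division_ring) \<Rightarrow> ('k heis \<Rightarrow> 'k heis) \<Rightarrow> 'd \<Rightarrow> 'd" where
  "involution_ext j \<eta> = (THE star. extends_involution j \<eta> star)"

definition symmetric_wrt ::
  "('k::field UH \<Rightarrow> 'd::division_ring) \<Rightarrow> ('k heis \<Rightarrow> 'k heis) \<Rightarrow> 'd \<Rightarrow> bool" where
  "symmetric_wrt j \<eta> a \<longleftrightarrow> involution_ext j \<eta> a = a"

lemma division_ring_swap:
  fixes b c u v :: "'d::division_ring"
  assumes "b * u = c * v" "b \<noteq> 0" "v \<noteq> 0"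
  shows "u * inverse v = inverse b * c"
proof -
  have "u * inverse v = (inverse b * b) * u * inverse v" using assms by simp
  also have "\<dots> = inverse b * (b * u) * inverse v" by (simp only: mult.assoc)
  also have "\<dots> = inverse b * c * (v * inverse v)" using assms(1) by (simp only: mult.assoc)
  finally show ?thesis using assms by simp
qed

text \<open>The description in \<open>involution_ext\<close> is proper.\<close>

lemma extends_involution_ex1:
  fixes j :: "'k::field UH \<Rightarrow> 'd::division_ring"
  assumes j: "ore_division_ring_of_fractions j" and \<eta>: "k_involution heis_scale heis_bracket \<eta>"
  shows "\<exists>!star. extends_involution j \<eta> star"
proof -
  have j1: "j 1 = 1" and ja: "j (u + v) = j u + j v" and jm: "j (u * v) = j u * j v"
    and inj: "inj j" and frac: "\<exists>u v. v \<noteq> 0 \<and> d = j u * inverse (j v)" for u v d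
    using j by (auto simp: ore_division_ring_of_fractions_def)
  have j0: "j 0 = 0" using ja[of 0 0] by simp
  have jz: "j u = 0 \<longleftrightarrow> u = 0" for u using inj j0 by (metis injD)
  obtain \<sigma> where \<sigma>a: "\<And>u v. \<sigma> (u + v) = \<sigma> u + \<sigma> v" and \<sigma>m: "\<And>u v. \<sigma> (u * v) = \<sigma> v * \<sigma> u"
    and \<sigma>c: "\<And>c. \<sigma> (UH_const c) = UH_const c" and \<sigma>h: "\<And>h. \<sigma> (UH_of h) = UH_of (\<eta> h)"
    and \<sigma>\<sigma>: "\<And>u. \<sigma> (\<sigma> u) = u"
    using UH_anti_involution[OF \<eta>] by blast
  have \<sigma>0: "\<sigma> 0 = 0" using \<sigma>a[of 0 0] by simp
  have \<sigma>z: "\<sigma> u = 0 \<longleftrightarrow> u = 0" for u by (metis \<sigma>0 \<sigma>\<sigma>)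
  have \<sigma>1: "\<sigma> 1 = 1" by (metis \<sigma>m \<sigma>\<sigma> mult_1)
  have ore: "\<exists>u v. v \<noteq> 0 \<and> b * u = c * v" if "b \<noteq> 0" for b c :: "'k UH"
  proof -
    obtain u v where uv: "v \<noteq> 0" "inverse (j b) * j c = j u * inverse (j v)" using frac by blast
    then have "j b * (inverse (j b) * j c) * j v = j b * (j u * inverse (j v)) * j v" by simp
    then have "j c * j v = j b * j u" using that uv(1)
      by (simp add: mult.assoc[symmetric] jz) (simp add: mult.assoc jz)
    then have "b * u = c * v" using inj by (metis injD jm)
    then show ?thesis using uv by blast
  qed
  define S where "S a b = inverse (j (\<sigma> b)) * j (\<sigma> a)" for a b
  have S_scale: "S (a * u) (b * u) = S a b" if "b \<noteq> 0" "u \<noteq> 0" for a b u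
  proof -
    have "inverse (j (\<sigma> u) * j (\<sigma> b)) * (j (\<sigma> u) * j (\<sigma> a))
        = inverse (j (\<sigma> b)) * (inverse (j (\<sigma> u)) * j (\<sigma> u)) * j (\<sigma> a)"
      using that by (simp only: nonzero_inverse_mult_distrib jz \<sigma>z mult.assoc simp_thms if_False not_False_eq_True)
    then show ?thesis using that by (simp add: S_def \<sigma>m jm jz \<sigma>z)
  qed
  have fr_scale: "j (a * u) * inverse (j (b * u)) = j a * inverse (j b)" if "b \<noteq> 0" "u \<noteq> 0" for a b u
  proof -
    have "j a * j u * inverse (j b * j u) = j a * (j u * inverse (j u)) * inverse (j b)"
      using that by (simp add: nonzero_inverse_mult_distrib jz mult.assoc del: right_inverse)
    then show ?thesis using that by (simp add: jm jz)
  qed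
  have nz: "b * u \<noteq> 0" if "b \<noteq> 0" "u \<noteq> 0" for b u :: "'k UH"
    using that by (metis jm jz mult_eq_0_iff)
  have common: "\<exists>u v. u \<noteq> 0 \<and> v \<noteq> 0 \<and> b * u = d * v" if "b \<noteq> 0" "d \<noteq> 0" for b d :: "'k UH"
    using ore[OF that(1), of d] nz[OF that(2)] by (metis mult_zero_right)
  have S_wd: "S a b = S c d"
    if eq: "j a * inverse (j b) = j c * inverse (j d)" and b: "b \<noteq> 0" and d: "d \<noteq> 0" for a b c d
  proof -
    obtain u v where uv: "u \<noteq> 0" "v \<noteq> 0" "b * u = d * v" using common[OF b d] by blast
    then have "j (a * u) * inverse (j (b * u)) = j (c * v) * inverse (j (b * u))"
      using fr_scale[OF b uv(1), of a] fr_scale[OF d uv(2), of c] eq uv(3) by simp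
    then have "j (a * u) = j (c * v)" using nz[OF b uv(1)] by (simp add: jz)
    then have "a * u = c * v" using inj by (metis injD)
    then show ?thesis using S_scale[OF b uv(1), of a] S_scale[OF d uv(2), of c] uv(3) by simp
  qed
  define f where "f x = (THE y. \<exists>a b. b \<noteq> 0 \<and> x = j a * inverse (j b) \<and> y = S a b)" for x
  have f: "f (j a * inverse (j b)) = S a b" if "b \<noteq> 0" for a b
    unfolding f_def using that S_wd by (intro the_equality) metis+
  have fj: "f (j a) = j (\<sigma> a)" for a
    using f[of 1 a] by (simp add: j1 S_def \<sigma>1)
  have fa: "f (x + y) = f x + f y" for x y
  proof -
    obtain a b where x: "b \<noteq> 0" "x = j a * inverse (j b)" using frac by blast
    obtain c d where y: "d \<noteq> 0" "y = j c * inverse (j d)" using frac by blast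
    obtain u v where uv: "u \<noteq> 0" "v \<noteq> 0" "b * u = d * v" using common[OF x(1) y(1)] by blast
    have x': "x = j (a * u) * inverse (j (b * u))" and y': "y = j (c * v) * inverse (j (b * u))"
      using x y uv fr_scale by metis+
    have xy: "x + y = j (a * u + c * v) * inverse (j (b * u))"
      by (simp add: x' y' ja distrib_right)
    have f': "f (j w * inverse (j (b * u))) = S w (b * u)" for w by (rule f[OF nz[OF x(1) uv(1)]])
    have "f (x + y) = S (a * u + c * v) (b * u)" unfolding xy by (rule f')
    moreover have "f x = S (a * u) (b * u)" unfolding x' by (rule f')
    moreover have "f y = S (c * v) (b * u)" unfolding y' by (rule f')
    ultimately show ?thesis by (simp add: S_def \<sigma>a ja distrib_left)
  qed
  have fm: "f (x * y) = f y * f x" for x y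
  proof -
    obtain a b where x: "b \<noteq> 0" "x = j a * inverse (j b)" using frac by blast
    obtain c d where y: "d \<noteq> 0" "y = j c * inverse (j d)" using frac by blast
    obtain u v where uv: "v \<noteq> 0" "b * u = c * v" using ore[OF x(1)] by blast
    have "j b * j u = j c * j v" using uv by (metis jm)
    then have swap: "j u * inverse (j v) = inverse (j b) * j c"
      by (rule division_ring_swap) (use x uv jz in auto)
    have "x * y = j a * (inverse (j b) * j c) * inverse (j d)" by (simp add: x y mult.assoc)
    also have "\<dots> = j (a * u) * inverse (j (d * v))"
      using y uv by (simp add: swap[symmetric] jm nonzero_inverse_mult_distrib jz mult.assoc)
    finally have 1: "f (x * y) = S (a * u) (d * v)" using f nz y uv by simp
    have "j (\<sigma> v) * j (\<sigma> c) = j (\<sigma> u) * j (\<sigma> b)" using uv by (metis jm \<sigma>m)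
    then have 2: "j (\<sigma> c) * inverse (j (\<sigma> b)) = inverse (j (\<sigma> v)) * j (\<sigma> u)"
      by (rule division_ring_swap) (use x uv jz \<sigma>z in auto)
    have "f y * f x = inverse (j (\<sigma> d)) * (j (\<sigma> c) * inverse (j (\<sigma> b))) * j (\<sigma> a)"
      using f x y by (simp add: S_def mult.assoc)
    also have "\<dots> = S (a * u) (d * v)"
      using y uv by (simp add: 2 S_def \<sigma>m jm nonzero_inverse_mult_distrib jz \<sigma>z mult.assoc)
    finally show ?thesis using 1 by simp
  qed
  have f1: "f 1 = 1" using fj[of 1] by (simp add: j1 \<sigma>1)
  have inv_eq: "g (inverse x) = inverse (g x)"
    if "\<And>x y. g (x * y) = g y * g x" "g 1 = 1" "x \<noteq> 0" for g :: "'d \<Rightarrow> 'd" and x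
    using that by (metis inverse_unique right_inverse left_inverse)
  have ff: "f (f x) = x" for x
  proof -
    obtain a b where x: "b \<noteq> 0" "x = j a * inverse (j b)" using frac by blast
    then have "f (f x) = f (j (\<sigma> a)) * f (inverse (j (\<sigma> b)))" using f by (simp add: S_def fm)
    also have "f (inverse (j (\<sigma> b))) = inverse (f (j (\<sigma> b)))"
      using x by (intro inv_eq fm f1) (simp add: jz \<sigma>z)
    finally show ?thesis by (simp add: fj \<sigma>\<sigma> x)
  qed
  have cent: "j (UH_const c) * d = d * j (UH_const c)" for c and d :: 'd
  proof -
    have cj: "j (UH_const c) * j u = j u * j (UH_const c)" for u
      using UH_const_k_algebra by (metis jm k_algebra_def)
    have ci: "j (UH_const c) * inverse (j u) = inverse (j u) * j (UH_const c)" if "u \<noteq> 0" for u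
      by (rule division_ring_swap[OF cj[symmetric]]) (use that jz in auto)
    obtain a b where "b \<noteq> 0" "d = j a * inverse (j b)" using frac by blast
    then show ?thesis using cj ci by (metis mult.assoc)
  qed
  have "extends_involution j \<eta> f"
    by (simp add: extends_involution_def fa fm ff fj \<sigma>h \<sigma>c cent)
  moreover have "g = f" if "extends_involution j \<eta> g" for g
  proof -
    have ga: "g (x + y) = g x + g y" and gm: "g (x * y) = g y * g x" and gg: "g (g x) = x"
      and gs: "g (j (UH_const c) * x) = j (UH_const c) * g x"
      and gh: "g (j (UH_of h)) = j (UH_of (\<eta> h))" for x y c h
      using that by (auto simp: extends_involution_def)
    have g1: "g 1 = 1" by (metis gm gg mult_1)
    have gj: "g (j u) = j (\<sigma> u)" for u
    proof (induction u rule: UH_induct)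
      case (const c)
      show ?case using gs[of c 1] by (simp add: g1 \<sigma>c)
    qed (simp_all add: gh \<sigma>h ja ga \<sigma>a jm gm \<sigma>m)
    show ?thesis
    proof
      fix x
      obtain a b where x: "b \<noteq> 0" "x = j a * inverse (j b)" using frac by blast
      then show "g x = f x"
        using inv_eq[of g "j b"] gm g1 f by (simp add: gj jz S_def)
    qed
  qed
  ultimately show ?thesis by blast
qed

end

theory Submission
  imports Defs "HOL-Computational_Algebra.Formal_Laurent_Series"
begin

text \<open>
  Over a field containing \<open>z\<close>, the rule \<open>y V = (V + z) y\<close> makes \<open>V / z\<close> act on Laurent series in \<open>X\<close>,
  up to scaling of \<open>y\<close>, as \<open>\<gamma> - X d/dX\<close> with \<open>\<gamma>\<close> transcendental. Every nonzero element of \<open>U(H)\<close> has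
  an injective initial term there, so that a relation in the division ring of fractions gives the same
  relation between series with operator coefficients. The polar parts of the powers of \<open>S\<close> become
  integrations, and \<open>f = (1 - X\<^sup>d) / (1 + X\<^sup>d)\<close> (for \<open>d = 2, 3\<close>) a multiplication, so that words in them
  produce iterated integrals; these are linearly independent over the rational functions because
  \<open>f\<close> and \<open>1/f\<close> have simple poles at distinct places. Hence \<open>S\<close> and \<open>f S f\<inverse>\<close> generate a free group
  algebra, and \<open>W = S + S\<inverse>\<close> and \<open>f W f\<inverse>\<close> a free algebra. In the scaling parameter \<open>t\<close>, where \<open>z = t\<^bsup>-d\<^esup>\<close>, the element
  \<open>S\<^sub>1\<close> is \<open>t\<^bsup>2d\<^esup> W\<close>, so Magnus' argument applies to \<open>1 + S\<^sub>1\<close> and \<open>1 + S\<^sub>1\<^sup>2\<close>.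
\<close>

unbundle fps_syntax

section \<open>Criteria for freeness\<close>

text \<open>The elements inverted in the conjugations are \<open>z^(d-1) + y^d\<close> and
  \<open>z^(d-1) - y^d\<close> with d = 2 or d = 3. The weights 1, d - 1, d of x, y, z respect z =
  [y, x] and make these elements homogeneous; this fixes the exponents of t in the representation
  and explains why a function of X^d alone remains in degree 0. Two values of d occur because
  conjugation keeps an element symmetric when the involution exchanges the two elements up to sign:
  \<open>eta2\<close> and \<open>eta3\<close> negate z and fix y^2, which suits d = 2, while
  \<open>eta1\<close> fixes z and negates y, which suits d = 3. The constant 1/3 enters the freeness
  only through the fact that 0, -\<gamma> - 1/3 and -\<gamma> + 1/3 are pairwise incongruent modulo
  the integers. Then the homogeneous equations that compare two different integrations have no
  nonzero solution, even among Laurent series, and only residues can obstruct the independence of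
  the iterated integrals.\<close>

lemma k_algebra_monoid_algebra:
  "k_algebra (Poly_Mapping.single 0 :: 'k::field \<Rightarrow> ('g::monoid_add \<Rightarrow>\<^sub>0 'k))"
proof -
  have "Poly_Mapping.single 0 c * p = p * Poly_Mapping.single 0 c"
    for c :: 'k and p :: "'g \<Rightarrow>\<^sub>0 'k"
    by (induction p rule: poly_mapping_single_induct)
       (simp_all add: distrib_left distrib_right mult_single mult.commute)
  then show ?thesis by (simp add: k_algebra_def single_add mult_single)
qed

lemma k_algebra_one: "k_algebra e \<Longrightarrow> e 1 = 1"
  and k_algebra_mult: "k_algebra e \<Longrightarrow> e (c * d) = e c * e d"
  and k_algebra_commute: "k_algebra e \<Longrightarrow> e c * a = a * e c"
  unfolding k_algebra_def by blast+

lemma k_algebra_vector_space: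
  assumes "k_algebra e"
  shows "vector_space (\<lambda>c r. e c * r)"
proof
  note e = k_algebra_one[OF assms] k_algebra_add[OF assms] k_algebra_mult[OF assms]
  fix a b x y
  show "e a * (x + y) = e a * x + e a * y" by (rule distrib_left)
  show "e (a + b) * x = e a * x + e b * x" by (simp add: e distrib_right)
  show "e a * (e b * x) = e (a * b) * x" by (simp add: e mult.assoc)
  show "e 1 * x = x" by (simp add: e)
qed

lemma k_algebra_hom_add: "k_algebra_hom e e' \<phi> \<Longrightarrow> \<phi> (x + y) = \<phi> x + \<phi> y"
  and k_algebra_hom_mult: "k_algebra_hom e e' \<phi> \<Longrightarrow> \<phi> (x * y) = \<phi> x * \<phi> y"
  and k_algebra_hom_const: "k_algebra_hom e e' \<phi> \<Longrightarrow> \<phi> (e c) = e' c"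
  unfolding k_algebra_hom_def by blast+

lemma k_algebra_hom_diff: "k_algebra_hom e e' \<phi> \<Longrightarrow> \<phi> (x - y) = \<phi> x - \<phi> y"
  using k_algebra_hom_add[of e e' \<phi> "x - y" y] by simp

lemma k_algebra_hom_zero: "k_algebra_hom e e' \<phi> \<Longrightarrow> \<phi> 0 = 0"
  using k_algebra_hom_diff[of e e' \<phi> 0 0] by simp

lemma k_algebra_hom_uminus: "k_algebra_hom e e' \<phi> \<Longrightarrow> \<phi> (- x) = - \<phi> x"
  using k_algebra_hom_diff[of e e' \<phi> 0 x] by (simp add: k_algebra_hom_zero)

lemma k_algebra_hom_one: "k_algebra e \<Longrightarrow> k_algebra e' \<Longrightarrow> k_algebra_hom e e' \<phi> \<Longrightarrow> \<phi> 1 = 1"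
  using k_algebra_hom_const[of e e' \<phi> 1] by (simp add: k_algebra_one)

lemma k_algebra_hom_power:
  "k_algebra e \<Longrightarrow> k_algebra e' \<Longrightarrow> k_algebra_hom e e' \<phi> \<Longrightarrow> \<phi> (x ^ n) = \<phi> x ^ n"
  by (induction n) (simp_all add: k_algebra_hom_one k_algebra_hom_mult)

lemma k_algebra_hom_prod_list:
  "k_algebra e \<Longrightarrow> k_algebra e' \<Longrightarrow> k_algebra_hom e e' \<phi> \<Longrightarrow>
    \<phi> (prod_list xs) = prod_list (map \<phi> xs)"
  by (induction xs) (simp_all add: k_algebra_hom_one k_algebra_hom_mult)

lemma k_algebra_hom_sum: "k_algebra_hom e e' \<phi> \<Longrightarrow> \<phi> (sum g A) = (\<Sum>x\<in>A. \<phi> (g x))"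
  by (induction A rule: infinite_finite_induct) (simp_all add: k_algebra_hom_zero k_algebra_hom_add)

lemma k_algebra_hom_inj:
  assumes "k_algebra_hom e e' \<phi>" "\<And>x. \<phi> x = 0 \<Longrightarrow> x = 0"
  shows "inj \<phi>"
  proof (rule injI)
  fix x y assume "\<phi> x = \<phi> y"
  then have "\<phi> (x - y) = 0" by (simp add: k_algebra_hom_diff[OF assms(1)])
  then show "x = y" using assms(2)[of "x - y"] by simp
qed

lemma k_algebra_hom_meval:
  fixes m :: "'g::monoid_add \<Rightarrow> 'a::ring_1"
  assumes "k_algebra e" "\<And>g h. m (g + h) = m g * m h" "m 0 = 1"
  shows "k_algebra_hom (Poly_Mapping.single 0) e (meval e m)"
  by (simp add: k_algebra_hom_def meval_add meval_mult meval_single assms)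

subsection \<open>Homomorphisms from free groups and free monoids\<close>

lemma free_group_hom_exists:
  fixes V V' :: "'a \<Rightarrow> 'r::monoid_mult"
  assumes inv: "\<And>a. V a * V' a = 1" "\<And>a. V' a * V a = 1"
  obtains m :: "'a free_group \<Rightarrow> 'r" where
    "\<And>g h. m (g + h) = m g * m h" "m 0 = 1" "\<And>a. m (fg_gen a) = V a" "\<And>a. m (- fg_gen a) = V' a"
proof -
  define p where "p u = prod_list (map (\<lambda>(a, s). if s then V a else V' a) u)" for u
  have p_app: "p (u @ v) = p u * p v" for u v by (simp add: p_def)
  have rel: "p u = p v" if "fg_rel u v" for u v
    using that
  proof induction
    case (fg_cancel u a s v)
    have "p [(a, s), (a, \<not> s)] = 1" by (cases s) (simp_all add: p_def inv)
    then have "p ([(a, s), (a, \<not> s)] @ v) = p v" unfolding p_app by simp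
    then show ?case unfolding p_app by simp
  qed auto
  define m where "m g = p (rep_free_group g)" for g
  have m: "m (abs_free_group u) = p u" for u
    unfolding m_def
    by (rule rel) (metis Quotient3_free_group Quotient3_rep_abs fg_refl)
  show ?thesis
  proof
    fix g h :: "'a free_group" and a
    obtain u v where "g = abs_free_group u" "h = abs_free_group v"
      by (metis Quotient3_abs_rep Quotient3_free_group)
    then show "m (g + h) = m g * m h" by (simp add: plus_free_group.abs_eq m p_app)
    show "m 0 = 1" by (simp add: zero_free_group.abs_eq m p_def)
    show "m (fg_gen a) = V a" by (simp add: fg_gen.abs_eq m p_def)
    show "m (- fg_gen a) = V' a"
      by (simp add: fg_gen.abs_eq uminus_free_group.abs_eq m p_def inv_word_def)
  qed
qed

lemma free_group_induct [case_names zero gen inv]: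
  assumes "P 0" "\<And>a g. P g \<Longrightarrow> P (fg_gen a + g)" "\<And>a g. P g \<Longrightarrow> P (- fg_gen a + g)"
  shows "P (g :: 'a free_group)"
proof -
  have "P (abs_free_group u)" for u :: "('a \<times> bool) list"
  proof (induction u)
    case Nil
    then show ?case using assms(1) by (simp add: zero_free_group.abs_eq)
  next
    case (Cons x u)
    obtain a s where x: "x = (a, s)" by (cases x)
    have "abs_free_group (x # u) = (if s then fg_gen a else - fg_gen a) + abs_free_group u"
      by (simp add: x fg_gen.abs_eq uminus_free_group.abs_eq plus_free_group.abs_eq inv_word_def)
    then show ?case using Cons assms by (cases s) auto
  qed
  then show ?thesis by (metis Quotient3_abs_rep Quotient3_free_group)
qed

text \<open>A pair (c, i) is a block: \<open>E c\<close> is a family attached to the letter c which,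
  in the applications, spans the Laurent polynomials in c together with 1.\<close>

definition word_val :: "('c \<Rightarrow> 'i \<Rightarrow> 'a::monoid_mult) \<Rightarrow> ('c \<times> 'i) list \<Rightarrow> 'a" where
  "word_val E w = prod_list (map (\<lambda>(c, i). E c i) w)"

lemma word_val_simps [simp]:
  "word_val E [] = 1" "word_val E ((c, i) # w) = E c i * word_val E w"
  by (simp_all add: word_val_def)

text \<open>
  The span of the alternating words in the \<open>E c i\<close> is stable under left multiplication by the letters and
  their inverses, hence is everything.
\<close>

lemma group_algebra_inj:
  fixes E :: "'c \<Rightarrow> 'i \<Rightarrow> ('c free_group \<Rightarrow>\<^sub>0 'k::field)" and e :: "'k \<Rightarrow> 'a::ring_1"
    and V V' :: "'c \<Rightarrow> 'a" and U U' :: "'c \<Rightarrow> ('c free_group \<Rightarrow>\<^sub>0 'k)"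
  defines "U \<equiv> \<lambda>c. Poly_Mapping.single (fg_gen c) 1"
    and "U' \<equiv> \<lambda>c. Poly_Mapping.single (- fg_gen c) 1"
  defines "sp \<equiv> module.span (\<lambda>c p. Poly_Mapping.single 0 c * p :: 'c free_group \<Rightarrow>\<^sub>0 'k)"
  assumes \<phi>: "k_algebra_hom (Poly_Mapping.single 0) e \<phi>"
    and base: "\<And>c. U c - 1 \<in> sp (range (E c))" "\<And>c. U' c - 1 \<in> sp (range (E c))"
    and step: "\<And>c i. (U c - 1) * E c i \<in> sp (range (E c))"
      "\<And>c i. (U' c - 1) * E c i \<in> sp (range (E c))"
    and indep: "\<And>F \<kappa>. finite F \<Longrightarrow> (\<And>w. w \<in> F \<Longrightarrow> distinct_adj (map fst w)) \<Longrightarrow>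
      (\<Sum>w\<in>F. e (\<kappa> w) * \<phi> (word_val E w)) = 0 \<Longrightarrow> \<forall>w\<in>F. \<kappa> w = 0"
  shows "inj \<phi>"
proof -
  interpret G: vector_space "\<lambda>c p. Poly_Mapping.single 0 c * p :: 'c free_group \<Rightarrow>\<^sub>0 'k"
    by (rule k_algebra_vector_space[OF k_algebra_monoid_algebra])
  have sp: "sp = G.span" by (simp add: sp_def)
  define B where "B = word_val E ` {w. distinct_adj (map fst w)}"
  have mult: "y * word_val E w \<in> G.span B"
    if "y \<in> G.span (range (E c))" and w: "distinct_adj (map fst w)" "w = [] \<or> fst (hd w) \<noteq> c" for y c w
    using that(1)
  proof (induction rule: G.span_induct_alt)
    case (step a x y)
    then obtain i where "x = E c i" by auto
    moreover have "word_val E ((c, i) # w) \<in> B"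
      unfolding B_def using w by (intro imageI) (cases w; auto simp: distinct_adj_Cons)
    ultimately show ?case
      using G.span_add[OF G.span_scale[OF G.span_base] step(2)] by (simp add: distrib_right mult.assoc)
  qed (simp add: G.span_zero)
  have left: "x * p \<in> G.span B"
    if x: "x - 1 \<in> G.span (range (E c))" "\<And>i. (x - 1) * E c i \<in> G.span (range (E c))"
      and "p \<in> G.span B" for x p c
    using that(3)
  proof (induction rule: G.span_induct_alt)
    case (step a b y)
    then obtain w where b: "b = word_val E w" and w: "distinct_adj (map fst w)" by (auto simp: B_def)
    \<comment> \<open>It is x - 1, not x, that lies in the span of \<open>E c\<close>: it adds a
      block in front of a word beginning with another letter, and otherwise changes the first block
      within the span of \<open>E c\<close>.\<close>
    have "(x - 1) * b \<in> G.span B"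
    proof (cases "w = [] \<or> fst (hd w) \<noteq> c")
      case True
      then show ?thesis using mult[OF x(1) w] b by simp
    next
      case False
      then obtain i w' where w': "w = (c, i) # w'" by (cases w) auto
      have "distinct_adj (map fst w')" "w' = [] \<or> fst (hd w') \<noteq> c"
        using w by (cases w'; auto simp: w')+
      from mult[OF x(2) this, of i] show ?thesis by (simp add: b w' mult.assoc)
    qed
    moreover have "b \<in> G.span B" using step by (simp add: G.span_base)
    ultimately have "x * b \<in> G.span B"
      using G.span_add[of "(x - 1) * b" B b] by (simp add: algebra_simps)
    moreover have "x * (Poly_Mapping.single 0 a * b + y) = Poly_Mapping.single 0 a * (x * b) + x * y"
      by (simp only: distrib_left mult.assoc[symmetric] k_algebra_commute[OF k_algebra_monoid_algebra, of a x])
    ultimately show ?case using G.span_add[OF G.span_scale step(2)] by simp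
  qed (simp add: G.span_zero)
  have 1: "Poly_Mapping.single g 1 \<in> G.span B" for g :: "'c free_group"
  proof (induction g rule: free_group_induct)
    case zero
    have "word_val E [] \<in> B" unfolding B_def by (intro imageI) simp
    then show ?case using G.span_base by fastforce
  next
    case (gen a g)
    then show ?case using left[OF base(1)[unfolded sp] step(1)[unfolded sp]]
      by (fastforce simp: U_def mult_single)
  next
    case (inv a g)
    then show ?case using left[OF base(2)[unfolded sp] step(2)[unfolded sp]]
      by (fastforce simp: U'_def mult_single)
  qed
  have all: "p \<in> G.span B" for p
  proof (induction p rule: poly_mapping_single_induct)
    case (add p g c)
    then show ?case
      using G.span_add[OF G.span_scale[OF 1, of c g] add] by (simp add: mult_single)
  qed (simp add: G.span_zero)
  show ?thesis
  proof (rule k_algebra_hom_inj[OF \<phi>])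
    fix p assume p: "\<phi> p = 0"
    obtain T r where T: "finite T" "T \<subseteq> B" "p = (\<Sum>b\<in>T. Poly_Mapping.single 0 (r b) * b)"
      using all[of p] by (auto simp: G.span_explicit)
    \<comment> \<open>Different words might a priori have the same value, so one word is chosen for
      each value that occurs.\<close>
    obtain F where F: "F \<subseteq> {w. distinct_adj (map fst w)}" "inj_on (word_val E) F" "T = word_val E ` F"
      using T(2) unfolding B_def by (meson subset_image_inj)
    then have fin: "finite F" using T finite_image_iff by blast
    have p': "p = (\<Sum>w\<in>F. Poly_Mapping.single 0 (r (word_val E w)) * word_val E w)"
      unfolding T(3) F(3) by (simp add: sum.reindex[OF F(2)])
    have "(\<Sum>w\<in>F. e (r (word_val E w)) * \<phi> (word_val E w)) = 0"
      using p \<phi> by (simp add: p' k_algebra_hom_sum[OF \<phi>] k_algebra_hom_mult[OF \<phi>] k_algebra_hom_const[OF \<phi>])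
    from indep[OF fin _ this] have "\<forall>w\<in>F. r (word_val E w) = 0" using F by blast
    then show "p = 0" by (simp add: p')
  qed
qed

section \<open>Free algebras as absence of polynomial relations\<close>

definition letter_case :: "'a \<Rightarrow> 'a \<Rightarrow> letter \<Rightarrow> 'a" where
  "letter_case A B c = (case c of La \<Rightarrow> A | Lb \<Rightarrow> B)"

lemma letter_case_simps [simp]: "letter_case A B La = A" "letter_case A B Lb = B"
  by (simp_all add: letter_case_def)

definition monoid_val :: "('c \<Rightarrow> 'a::monoid_mult) \<Rightarrow> 'c free_monoid \<Rightarrow> 'a" where
  "monoid_val V g = (case g of Word l \<Rightarrow> prod_list (map V l))"

lemma monoid_val_simps [simp]:
  "monoid_val V (Word l) = prod_list (map V l)" "monoid_val V 0 = 1"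
  by (simp_all add: monoid_val_def zero_free_monoid_def)

lemma monoid_val_add: "monoid_val V (g + h) = monoid_val V g * monoid_val V h"
  by (cases g; cases h) simp

lemma monoid_val_transform:
  assumes "k_algebra e" "k_algebra e'" "k_algebra_hom e e' \<psi>"
  shows "\<psi> (monoid_val V g) = monoid_val (\<lambda>c. \<psi> (V c)) g"
  by (cases g) (simp add: k_algebra_hom_prod_list[OF assms] comp_def)

text \<open>A homomorphism is determined by its values on the two letters, so the one in the
  definition must be evaluation at A and B. Afterwards only explicit relations between words have to
  be considered.\<close>

lemma is_free_algebra_on_iff:
  fixes e :: "'k::field \<Rightarrow> 'a::ring_1"
  assumes e: "k_algebra e"
  shows "is_free_algebra_on e A B \<longleftrightarrow>
    (\<forall>p. (\<Sum>g\<in>Poly_Mapping.keys p. e (Poly_Mapping.lookup p g) * monoid_val (letter_case A B) g) = 0 \<longrightarrow> p = 0)"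
proof -
  let ?m = "monoid_val (letter_case A B)"
  have hom: "k_algebra_hom (Poly_Mapping.single 0) e (meval e ?m)"
    by (rule k_algebra_hom_meval[OF e monoid_val_add monoid_val_simps(2)])
  note e1 = k_algebra_one[OF e]
  have uniq: "\<phi> = meval e ?m"
    if \<phi>: "k_algebra_hom (Poly_Mapping.single 0) e \<phi>"
      "\<phi> (Poly_Mapping.single (Word [La]) 1) = A" "\<phi> (Poly_Mapping.single (Word [Lb]) 1) = B" for \<phi>
  proof
    fix p
    have w: "\<phi> (Poly_Mapping.single (Word l) 1) = ?m (Word l)" for l
    proof (induction l)
      case Nil
      then show ?case
        using k_algebra_hom_one[OF k_algebra_monoid_algebra e \<phi>(1)]
        by (simp flip: zero_free_monoid_def)
    next
      case (Cons c l)
      have "Poly_Mapping.single (Word (c # l)) (1::'k) =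
          Poly_Mapping.single (Word [c]) 1 * Poly_Mapping.single (Word l) 1" by (simp add: mult_single)
      then have "\<phi> (Poly_Mapping.single (Word (c # l)) 1) =
          \<phi> (Poly_Mapping.single (Word [c]) 1) * \<phi> (Poly_Mapping.single (Word l) 1)"
        by (simp only: k_algebra_hom_mult[OF \<phi>(1)])
      then show ?case using Cons \<phi>(2,3) by (cases c) auto
    qed
    show "\<phi> p = meval e ?m p"
    proof (induction p rule: poly_mapping_single_induct)
      case zero
      then show ?case using \<phi>(1) by (simp add: k_algebra_hom_zero meval_def)
    next
      case (add p g c)
      have "Poly_Mapping.single g c = Poly_Mapping.single 0 c * Poly_Mapping.single g 1"
        by (simp add: mult_single)
      then have "\<phi> (Poly_Mapping.single g c) = e c * ?m g"
        using w by (cases g) (simp only: k_algebra_hom_mult[OF \<phi>(1)] k_algebra_hom_const[OF \<phi>(1)])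
      then show ?case using add by (simp add: k_algebra_hom_add[OF \<phi>(1)] meval_add[OF e] meval_single[OF e])
    qed
  qed
  have "is_free_algebra_on e A B \<longleftrightarrow> inj (meval e ?m)"
  proof
    assume "is_free_algebra_on e A B"
    then obtain \<phi> where \<phi>: "k_algebra_hom (Poly_Mapping.single 0) e \<phi>" "inj \<phi>"
      "\<phi> (Poly_Mapping.single (Word [La]) 1) = A" "\<phi> (Poly_Mapping.single (Word [Lb]) 1) = B"
      unfolding is_free_algebra_on_def by (elim exE conjE)
    show "inj (meval e ?m)" using \<phi>(2) unfolding uniq[OF \<phi>(1,3,4)] .
  next
    have "meval e ?m (Poly_Mapping.single (Word [La]) 1) = A" "meval e ?m (Poly_Mapping.single (Word [Lb]) 1) = B"
      by (simp_all add: meval_single[OF e] e1)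
    moreover assume "inj (meval e ?m)"
    ultimately show "is_free_algebra_on e A B"
      unfolding is_free_algebra_on_def by (intro exI[of _ "meval e ?m"] conjI hom)
  qed
  also have "\<dots> \<longleftrightarrow> (\<forall>p. meval e ?m p = 0 \<longrightarrow> p = 0)"
  proof
    assume inj: "inj (meval e ?m)"
    show "\<forall>p. meval e ?m p = 0 \<longrightarrow> p = 0"
      using injD[OF inj, of _ 0] by (simp add: k_algebra_hom_zero[OF hom])
  qed (use k_algebra_hom_inj[OF hom] in blast)
  finally show ?thesis by (simp add: meval_def)
qed

text \<open>Words are indexed through an injection because relations later arise with block words as
  indices.\<close>

lemma free_algebra_indep:
  fixes e :: "'k::field \<Rightarrow> 'a::ring_1" and G :: "'i \<Rightarrow> letter list"
  assumes "k_algebra e" "is_free_algebra_on e A B" "finite F" "inj_on G F"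
    "(\<Sum>i\<in>F. e (\<kappa> i) * prod_list (map (letter_case A B) (G i))) = 0" "i \<in> F"
  shows "\<kappa> i = 0"
proof -
  define p where "p = (\<Sum>i\<in>F. Poly_Mapping.single (Word (G i)) (\<kappa> i))"
  have lk: "Poly_Mapping.lookup p (Word (G i)) = \<kappa> i" if "i \<in> F" for i
  proof -
    have "Poly_Mapping.lookup p (Word (G i)) = (\<Sum>j\<in>F. if j = i then \<kappa> j else 0)"
      unfolding p_def lookup_sum
      by (rule sum.cong) (use assms(4) that in \<open>auto simp: lookup_single when_def inj_on_def\<close>)
    then show ?thesis using that assms(3) by simp
  qed
  have hom: "k_algebra_hom (Poly_Mapping.single 0) e (meval e (monoid_val (letter_case A B)))"
    by (rule k_algebra_hom_meval[OF assms(1) monoid_val_add]) simp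
  have "meval e (monoid_val (letter_case A B)) p = 0"
    unfolding p_def k_algebra_hom_sum[OF hom] using assms(5) by (simp add: meval_single[OF assms(1)])
  then have "p = 0" using assms(2) by (simp add: is_free_algebra_on_iff[OF assms(1)] meval_def)
  then show ?thesis using lk[OF assms(6)] by simp
qed

text \<open>Replacing every letter by n copies of itself is injective on words, since n > 0 lets the
  original letter be read off from each segment of length n.\<close>

lemma is_free_algebra_on_powers:
  fixes e :: "'k::field \<Rightarrow> 'a::ring_1"
  assumes e: "k_algebra e" and free: "is_free_algebra_on e A B" and n: "n > 0"
  shows "is_free_algebra_on e (A ^ n) (B ^ n)"
  unfolding is_free_algebra_on_iff[OF e]
proof (intro allI impI)
  fix p :: "letter free_monoid \<Rightarrow>\<^sub>0 'k"
  let ?G = "\<lambda>l. concat (map (replicate n) l)"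
  have G: "prod_list (map (letter_case (A ^ n) (B ^ n)) l) = prod_list (map (letter_case A B) (?G l))" for l
  proof (induction l)
    case (Cons c l)
    have "prod_list (map (letter_case A B) (replicate n c)) = letter_case (A ^ n) (B ^ n) c"
      by (cases c) (simp_all add: prod_list_replicate map_replicate_const)
    then show ?case using Cons by simp
  qed simp
  have inj: "l = l'" if "?G l = ?G l'" for l l' :: "letter list"
    using that
  proof (induction l arbitrary: l')
    case Nil
    then show ?case using n by (cases l') auto
  next
    case (Cons c l)
    then obtain d l'' where l': "l' = d # l''" using n by (cases l') auto
    have "replicate n c = replicate n d \<and> ?G l = ?G l''" using Cons(2) l' by simp
    then show ?case using Cons(1) n l' by simp
  qed
  define H where "H g = (case g of Word l \<Rightarrow> ?G l)" for g :: "letter free_monoid"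
  assume "(\<Sum>g\<in>Poly_Mapping.keys p. e (Poly_Mapping.lookup p g) * monoid_val (letter_case (A ^ n) (B ^ n)) g) = 0"
  moreover have "monoid_val (letter_case (A ^ n) (B ^ n)) g = prod_list (map (letter_case A B) (H g))" for g
    by (cases g) (simp only: monoid_val_simps H_def free_monoid.case G)
  ultimately have "(\<Sum>g\<in>Poly_Mapping.keys p. e (Poly_Mapping.lookup p g) * prod_list (map (letter_case A B) (H g))) = 0"
    by simp
  moreover have "inj_on H (Poly_Mapping.keys p)"
    by (rule inj_onI) (auto simp: H_def split: free_monoid.splits dest: inj)
  ultimately have "Poly_Mapping.lookup p g = 0" if "g \<in> Poly_Mapping.keys p" for g
    using free_algebra_indep[OF e free finite_keys _ _ that, of H] by simp
  then have "Poly_Mapping.lookup p g = 0" for g using not_in_keys_iff_lookup_eq_zero[of g p] by blast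
  then show "p = 0" by (intro poly_mapping_eqI) simp
qed

lemma is_free_group_algebra_onI:
  assumes "k_algebra_hom (Poly_Mapping.single 0) e \<phi>" "inj \<phi>"
    "\<phi> (Poly_Mapping.single (fg_gen La) 1) = A" "\<phi> (Poly_Mapping.single (fg_gen Lb) 1) = B"
  shows "is_free_group_algebra_on e A B"
  using assms unfolding is_free_group_algebra_on_def by blast

lemma is_free_group_algebra_on_hom:
  assumes "is_free_group_algebra_on e A B" "k_algebra_hom e e' \<psi>" "inj \<psi>"
  shows "is_free_group_algebra_on e' (\<psi> A) (\<psi> B)"
proof -
  obtain \<phi> where "k_algebra_hom (Poly_Mapping.single 0) e \<phi>" "inj \<phi>"
    "\<phi> (Poly_Mapping.single (fg_gen La) 1) = A" "\<phi> (Poly_Mapping.single (fg_gen Lb) 1) = B"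
    using assms(1) unfolding is_free_group_algebra_on_def by blast
  then show ?thesis
    using assms(2,3) by (intro is_free_group_algebra_onI[of _ "\<psi> \<circ> \<phi>"])
      (auto simp: k_algebra_hom_def intro: inj_compose)
qed

subsection \<open>Free group algebras from free algebras and conversely\<close>

text \<open>The hypothesis on \<open>E\<close> speaks of every homomorphism with the prescribed
  values because the relevant one is constructed only in the proof. What remains to be supplied is a
  calculation with one letter (\<open>base\<close>, \<open>step\<close>) and the independence of
  alternating words (\<open>indep\<close>).\<close>

lemma free_group_algebra_criterion:
  fixes E :: "letter \<Rightarrow> 'i \<Rightarrow> (letter free_group \<Rightarrow>\<^sub>0 'k::field)" and e :: "'k \<Rightarrow> 'a::ring_1"
    and V V' :: "letter \<Rightarrow> 'a" and U U' :: "letter \<Rightarrow> (letter free_group \<Rightarrow>\<^sub>0 'k)"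
    and EV :: "letter \<Rightarrow> 'i \<Rightarrow> 'a"
  defines "U \<equiv> \<lambda>c. Poly_Mapping.single (fg_gen c) 1"
    and "U' \<equiv> \<lambda>c. Poly_Mapping.single (- fg_gen c) 1"
  defines "sp \<equiv> module.span (\<lambda>c p. Poly_Mapping.single 0 c * p :: letter free_group \<Rightarrow>\<^sub>0 'k)"
  assumes e: "k_algebra e" and V: "\<And>c. V c * V' c = 1" "\<And>c. V' c * V c = 1"
    and E: "\<And>\<phi> c i. k_algebra_hom (Poly_Mapping.single 0) e \<phi> \<Longrightarrow>
      (\<And>c. \<phi> (U c) = V c) \<Longrightarrow> (\<And>c. \<phi> (U' c) = V' c) \<Longrightarrow> \<phi> (E c i) = EV c i"
    and base: "\<And>c. U c - 1 \<in> sp (range (E c))" "\<And>c. U' c - 1 \<in> sp (range (E c))"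
    and step: "\<And>c i. (U c - 1) * E c i \<in> sp (range (E c))"
      "\<And>c i. (U' c - 1) * E c i \<in> sp (range (E c))"
    and indep: "\<And>F \<kappa>. finite F \<Longrightarrow> (\<And>w. w \<in> F \<Longrightarrow> distinct_adj (map fst w)) \<Longrightarrow>
      (\<Sum>w\<in>F. e (\<kappa> w) * word_val EV w) = 0 \<Longrightarrow> \<forall>w\<in>F. \<kappa> w = 0"
  shows "is_free_group_algebra_on e (V La) (V Lb)"
proof -
  obtain m :: "letter free_group \<Rightarrow> 'a" where m: "\<And>g h. m (g + h) = m g * m h" "m 0 = 1"
    "\<And>c. m (fg_gen c) = V c" "\<And>c. m (- fg_gen c) = V' c"
    using free_group_hom_exists[of V V', OF V] by blast
  let ?\<phi> = "meval e m"
  note hom = k_algebra_hom_meval[of e m, OF e m(1,2)]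
  have single: "?\<phi> (Poly_Mapping.single g 1) = m g" for g
    by (simp add: meval_single[OF e] k_algebra_one[OF e])
  have EV: "?\<phi> (E c i) = EV c i" for c i
    by (rule E[OF hom]) (simp_all add: U_def U'_def single m)
  have val: "?\<phi> (word_val E w) = word_val EV w" for w
    unfolding word_val_def k_algebra_hom_prod_list[OF k_algebra_monoid_algebra e hom]
    by (rule arg_cong[where f = prod_list]) (auto simp: EV)
  have "inj ?\<phi>"
    by (rule group_algebra_inj[OF hom, of E, OF base[unfolded U_def U'_def sp_def]
          step[unfolded U_def U'_def sp_def]])
       (use indep in \<open>simp add: val\<close>)
  then show ?thesis
    by (rule is_free_group_algebra_onI[OF hom]) (simp_all add: single m)
qed

lemma group_algebra_gens:
  fixes c :: 'c
  defines "U \<equiv> Poly_Mapping.single (fg_gen c) (1::'k::field)"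
    and "U' \<equiv> Poly_Mapping.single (- fg_gen c) (1::'k)"
  shows "U * U' = 1" "U' * U = 1"
  by (simp_all add: U_def U'_def mult_single)

text \<open>The powers of U - 1 and of U^(-1) - 1 form, with 1, the partial fraction basis of the
  Laurent polynomials in U; mixed products reduce by (U - 1)(U^(-1) - 1) = -(U - 1) - (U^(-1) - 1).
  For the operator \<open>S\<close> of the application each of the two families has its poles at one
  place only.\<close>

lemma free_group_algebra_via_polar_words:
  fixes e :: "'k::field \<Rightarrow> 'a::ring_1" and V V' :: "letter \<Rightarrow> 'a"
  assumes e: "k_algebra e" and V: "\<And>c. V c * V' c = 1" "\<And>c. V' c * V c = 1"
    and indep: "\<And>F \<kappa>. finite F \<Longrightarrow> (\<And>w. w \<in> F \<Longrightarrow> distinct_adj (map fst w)) \<Longrightarrow>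
      (\<Sum>w\<in>F. e (\<kappa> w) * word_val (\<lambda>c (s, n). ((if s then V c else V' c) - 1) ^ Suc n) w) = 0 \<Longrightarrow>
      \<forall>w\<in>F. \<kappa> w = 0"
  shows "is_free_group_algebra_on e (V La) (V Lb)"
proof (rule free_group_algebra_criterion[OF e V _ _ _ _ _ indep,
    where E = "\<lambda>c (s, n). (Poly_Mapping.single (if s then fg_gen c else - fg_gen c) 1 - 1) ^ Suc n"])
  interpret G: vector_space "\<lambda>c p. Poly_Mapping.single 0 c * p :: letter free_group \<Rightarrow>\<^sub>0 'k"
    by (rule k_algebra_vector_space[OF k_algebra_monoid_algebra])
  fix c :: letter
  define U where "U = Poly_Mapping.single (fg_gen c) (1::'k)"
  define U' where "U' = Poly_Mapping.single (- fg_gen c) (1::'k)"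
  note UU' = group_algebra_gens[of c, where 'k = 'k, folded U_def U'_def]
  define E where
    "E = (\<lambda>(s, n). (Poly_Mapping.single (if s then fg_gen c else - fg_gen c) (1::'k) - 1) ^ Suc n)"
  have E: "E (True, n) = (U - 1) ^ Suc n" "E (False, n) = (U' - 1) ^ Suc n" for n
    by (simp_all add: E_def U_def U'_def)
  have mem: "(U - 1) ^ Suc n \<in> G.span (range E)" "(U' - 1) ^ Suc n \<in> G.span (range E)" for n
    unfolding E[symmetric] by (simp_all add: G.span_base)
  have UV: "(U - 1) * (U' - 1) = - (U - 1) - (U' - 1)" "(U' - 1) * (U - 1) = - (U - 1) - (U' - 1)"
    by (simp_all add: algebra_simps UU')
  have 1: "(U - 1) * (U' - 1) ^ Suc n \<in> G.span (range E)" for n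
  proof (induction n)
    case 0
    show ?case using G.span_diff[OF G.span_neg[OF mem(1)[of 0]] mem(2)[of 0]] by (simp add: UV)
  next
    case (Suc n)
    have "(U - 1) * (U' - 1) ^ Suc (Suc n) = ((U - 1) * (U' - 1)) * (U' - 1) ^ Suc n"
      by (simp only: power_Suc mult.assoc)
    also have "\<dots> = - ((U - 1) * (U' - 1) ^ Suc n) - (U' - 1) ^ Suc (Suc n)"
      unfolding UV by (simp only: left_diff_distrib mult_minus_left power_Suc)
    finally show ?case using G.span_diff[OF G.span_neg[OF Suc] mem(2)[of "Suc n"]] by simp
  qed
  have 2: "(U' - 1) * (U - 1) ^ Suc n \<in> G.span (range E)" for n
  proof (induction n)
    case 0
    show ?case using G.span_diff[OF G.span_neg[OF mem(1)[of 0]] mem(2)[of 0]] by (simp add: UV)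
  next
    case (Suc n)
    have "(U' - 1) * (U - 1) ^ Suc (Suc n) = ((U' - 1) * (U - 1)) * (U - 1) ^ Suc n"
      by (simp only: power_Suc mult.assoc)
    also have "\<dots> = - ((U - 1) ^ Suc (Suc n)) - ((U' - 1) * (U - 1) ^ Suc n)"
      unfolding UV by (simp only: left_diff_distrib mult_minus_left power_Suc)
    finally show ?case using G.span_diff[OF G.span_neg[OF mem(1)[of "Suc n"]] Suc] by simp
  qed
  show "Poly_Mapping.single (fg_gen c) 1 - 1 \<in> G.span (range (\<lambda>(s, n).
      (Poly_Mapping.single (if s then fg_gen c else - fg_gen c) 1 - 1) ^ Suc n))"
    using mem(1)[of 0] unfolding E_def by (simp add: U_def)
  show "Poly_Mapping.single (- fg_gen c) 1 - 1 \<in> G.span (range (\<lambda>(s, n).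
      (Poly_Mapping.single (if s then fg_gen c else - fg_gen c) 1 - 1) ^ Suc n))"
    using mem(2)[of 0] unfolding E_def by (simp add: U'_def)
  fix i :: "bool \<times> nat"
  obtain s n where i: "i = (s, n)" by (cases i)
  have "(U - 1) * E i \<in> G.span (range E)"
    using mem(1)[of "Suc n"] 1[of n] by (cases s) (simp_all add: i E)
  then show "(Poly_Mapping.single (fg_gen c) 1 - 1) * (case i of (s, n) \<Rightarrow>
      (Poly_Mapping.single (if s then fg_gen c else - fg_gen c) 1 - 1) ^ Suc n) \<in> G.span (range (\<lambda>(s, n).
      (Poly_Mapping.single (if s then fg_gen c else - fg_gen c) 1 - 1) ^ Suc n))"
    unfolding E_def U_def .
  have "(U' - 1) * E i \<in> G.span (range E)"
    using mem(2)[of "Suc n"] 2[of n] by (cases s) (simp_all add: i E)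
  then show "(Poly_Mapping.single (- fg_gen c) 1 - 1) * (case i of (s, n) \<Rightarrow>
      (Poly_Mapping.single (if s then fg_gen c else - fg_gen c) 1 - 1) ^ Suc n) \<in> G.span (range (\<lambda>(s, n).
      (Poly_Mapping.single (if s then fg_gen c else - fg_gen c) 1 - 1) ^ Suc n))"
    unfolding E_def U'_def .
  fix \<phi> :: "(letter free_group \<Rightarrow>\<^sub>0 'k) \<Rightarrow> 'a"
  assume \<phi>: "k_algebra_hom (Poly_Mapping.single 0) e \<phi>"
    "\<And>c. \<phi> (Poly_Mapping.single (fg_gen c) 1) = V c" "\<And>c. \<phi> (Poly_Mapping.single (- fg_gen c) 1) = V' c"
  note [simp] = k_algebra_hom_power[OF k_algebra_monoid_algebra e \<phi>(1)] k_algebra_hom_diff[OF \<phi>(1)]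
    k_algebra_hom_one[OF k_algebra_monoid_algebra e \<phi>(1)] \<phi>(2,3)
  show "\<phi> (case i of (s, n) \<Rightarrow> (Poly_Mapping.single (if s then fg_gen c else - fg_gen c) 1 - 1) ^ Suc n) =
      (case i of (s, n) \<Rightarrow> ((if s then V c else V' c) - 1) ^ Suc n)"
    unfolding i prod.case by (cases s) (simp_all del: power_Suc)
qed

section \<open>Initial terms of Laurent series over a noncommutative ring\<close>

lemma fls_nth_sum: "sum f A $$ n = (\<Sum>x\<in>A. f x $$ n :: 'a::comm_monoid_add)"
  by (induction A rule: infinite_finite_induct) simp_all

text \<open>The coefficient c may be 0. This keeps the notion multiplicative over coefficient rings
  with zero divisors, where an order would not be additive.\<close>

definition fls_lead :: "int \<Rightarrow> 'a::zero \<Rightarrow> 'a fls \<Rightarrow> bool" where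
  "fls_lead k c r \<longleftrightarrow> (\<forall>i<k. r $$ i = 0) \<and> r $$ k = c"

lemma fls_lead_mult:
  fixes r s :: "'a::ring_1 fls"
  assumes "fls_lead k a r" "fls_lead l b s"
  shows "fls_lead (k + l) (a * b) (r * s)"
proof -
  have z: "r $$ i * s $$ (n - i) = (if n = k + l \<and> i = k then a * b else 0)" if "n \<le> k + l" for i n
  proof (cases "i < k \<or> n - i < l")
    case True
    then show ?thesis using assms that by (auto simp: fls_lead_def)
  next
    case False
    then have "i = k" "n = k + l" using that by linarith+
    then show ?thesis using assms by (simp add: fls_lead_def)
  qed
  have "(r * s) $$ n = 0" if "n < k + l" for n
    using that by (simp add: fls_times_nth(2) z)
  moreover have "(r * s) $$ (k + l) = a * b"
  proof (cases "k \<in> {fls_subdegree r..k + l - fls_subdegree s}")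
    case False
    then have "a = 0 \<or> b = 0"
      using assms fls_eq0_below_subdegree[of k r] fls_eq0_below_subdegree[of l s]
      by (auto simp: fls_lead_def)
    then show ?thesis by (auto simp: fls_times_nth(2) z)
  qed (simp add: fls_times_nth(2) z)
  ultimately show ?thesis by (simp add: fls_lead_def)
qed

lemma fls_lead_one: "fls_lead 0 1 (1 :: 'a::ring_1 fls)"
  by (simp add: fls_lead_def)

lemma fls_lead_power:
  "fls_lead k a r \<Longrightarrow> fls_lead (k * int n) (a ^ n) (r ^ n :: 'a::ring_1 fls)"
proof (induction n)
  case (Suc n)
  then show ?case using fls_lead_mult[of k a r "k * int n" "a ^ n" "r ^ n"] by (simp add: algebra_simps)
qed (simp add: fls_lead_one)

text \<open>With constant term 1 both one-sided inverses of the power series can be computed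
  recursively over any ring, and they coincide.\<close>

lemma fls_lead_inverse_exists:
  assumes "fls_lead 0 1 (r :: 'a::ring_1 fls)"
  obtains r' where "r * r' = 1" "r' * r = 1" "fls_lead 0 1 r'"
proof -
  have "fls_subdegree r \<ge> 0"
    using assms by (cases "r = 0") (auto simp: fls_lead_def intro: fls_subdegree_geI)
  then have r: "r = fps_to_fls (fls_regpart r)" by simp
  define f where "f = fls_regpart r"
  have f0: "f $ 0 = 1" using assms by (simp add: f_def fls_lead_def)
  define g where "g = fps_left_inverse f 1"
  have "g = fps_right_inverse f 1"
    unfolding g_def by (rule fps_left_inverse_eq_fps_right_inverse) (simp_all add: f0)
  then have "f * g = 1" using fps_right_inverse[of f 1] f0 by simp
  moreover have gf: "g * f = 1" using fps_left_inverse[of 1 f] f0 by (simp add: g_def)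
  moreover have "fls_lead 0 1 (fps_to_fls g)"
    by (simp add: fls_lead_def g_def)
  ultimately show ?thesis
    using that[of "fps_to_fls g"] r by (metis f_def fls_times_fps_to_fls fps_one_to_fls)
qed

definition flatten :: "(letter \<times> nat) list \<Rightarrow> letter list" where
  "flatten w = concat (map (\<lambda>(c, i). replicate (Suc i) c) w)"

lemma flatten_simps [simp]:
  "flatten [] = []" "flatten ((c, i) # w) = replicate (Suc i) c @ flatten w"
  by (simp_all add: flatten_def)

text \<open>An alternating block word is the run-length encoding of its flattening;
  \<open>takeWhile\<close> recovers the first run.\<close>

lemma flatten_inj:
  "distinct_adj (map fst w) \<Longrightarrow> distinct_adj (map fst w') \<Longrightarrow> flatten w = flatten w' \<Longrightarrow> w = w'"
proof (induction w arbitrary: w')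
  case Nil
  then show ?case by (cases w') (auto simp del: replicate_Suc simp: replicate_Suc)
next
  case (Cons x w)
  obtain c i where x: "x = (c, i)" by (cases x)
  have "w' \<noteq> []" using Cons by (auto simp: x)
  then obtain c' i' v where w': "w' = (c', i') # v" by (cases w') auto
  have run: "takeWhile ((=) c) (flatten ((c, i) # w)) = replicate (Suc i) c"
    if "distinct_adj (map fst ((c, i) # w))" for c i w
  proof -
    have "takeWhile ((=) c) (flatten w) = []"
      using that by (cases w) (auto simp del: replicate_Suc simp: replicate_Suc)
    moreover have "takeWhile ((=) c) (replicate n c @ l) = replicate n c @ takeWhile ((=) c) l" for n l
      by (induction n) auto
    ultimately show ?thesis by (simp del: replicate_Suc)
  qed
  have c: "c = c'" using Cons(4) by (simp add: x w')
  have "replicate (Suc i) c = replicate (Suc i') c"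
    using run[of c i w] run[of c' i' v] Cons(2-4) unfolding x w' c by simp
  then have i: "i = i'" by (metis length_replicate nat.inject)
  have "flatten w = flatten v" using Cons(4) unfolding x w' c i by simp
  moreover have "distinct_adj (map fst w)" "distinct_adj (map fst v)"
    using Cons(2,3) unfolding x w' by (cases w; cases v; simp)+
  ultimately show ?case using Cons(1) x w' c i by blast
qed

text \<open>
  Magnus' argument. The products \<open>c\<^bsup>-\<lfloor>n/2\<rfloor>\<^esup> (c - 1)\<^sup>n\<close> form a basis of the Laurent polynomials in \<open>c\<close>,
  one for each order of vanishing at \<open>c = 1\<close>, so that distinct alternating words in them have distinct
  monomials as initial terms.
\<close>

lemma magnus:
  fixes e :: "'k::field \<Rightarrow> 'a::ring_1"
  assumes e: "k_algebra e" and free: "is_free_algebra_on e w w'" and d: "d > 0"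
    and A: "fls_lead d w (A - 1)" and B: "fls_lead d w' (B - 1)"
    and e': "k_algebra e'" "\<And>c. e' c = fls_const (e c)"
  shows "is_free_group_algebra_on e' A B"
proof -
  let ?V = "letter_case A B"
  have leadV: "fls_lead d (letter_case w w' c) (?V c - 1)" for c by (cases c) (simp_all add: A B)
  have lead0: "fls_lead 0 1 (?V c)" for c
    using leadV[of c] d by (auto simp: fls_lead_def)
  have "\<exists>r'. ?V c * r' = 1 \<and> r' * ?V c = 1 \<and> fls_lead 0 1 r'" for c
    using fls_lead_inverse_exists[OF lead0[of c]] by metis
  then obtain V' where V': "\<And>c. ?V c * V' c = 1" "\<And>c. V' c * ?V c = 1" "\<And>c. fls_lead 0 1 (V' c)"
    by metis
  \<comment> \<open>The factor \<open>V' c\<close> has initial term 1, so it does not affect the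
    initial term of the power of \<open>?V c - 1\<close>.\<close>
  define EV where "EV c i = V' c ^ (Suc i div 2) * (?V c - 1) ^ Suc i" for c i
  have leadE: "fls_lead (d * int (Suc i)) (letter_case w w' c ^ Suc i) (EV c i)" for c i
    using fls_lead_mult[OF fls_lead_power[OF V'(3), of "Suc i div 2"] fls_lead_power[OF leadV, of "Suc i"]]
    by (simp add: EV_def del: power_Suc)
  have lead: "fls_lead (d * int (length (flatten u))) (prod_list (map (letter_case w w') (flatten u)))
      (word_val EV u)" for u
  proof (induction u)
    case (Cons x u)
    obtain c i where x: "x = (c, i)" by (cases x)
    have "letter_case w w' c ^ Suc i = prod_list (map (letter_case w w') (replicate (Suc i) c))"
      by (simp add: prod_list_replicate)
    then show ?case
      using fls_lead_mult[OF leadE[of i c] Cons] by (simp add: x algebra_simps del: replicate_Suc)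
  qed (simp add: fls_lead_one)
  have "is_free_group_algebra_on e' (?V La) (?V Lb)"
  proof (rule free_group_algebra_criterion[OF e'(1) V'(1,2), where EV = EV and
      E = "\<lambda>c i. Poly_Mapping.single (- fg_gen c) 1 ^ (Suc i div 2) *
        (Poly_Mapping.single (fg_gen c) 1 - 1) ^ Suc i"])
    fix F :: "(letter \<times> nat) list set" and \<kappa>
    assume fin: "finite F" and alt: "\<And>u. u \<in> F \<Longrightarrow> distinct_adj (map fst u)"
      and rel: "(\<Sum>u\<in>F. e' (\<kappa> u) * word_val EV u) = 0"
    define len where "len u = length (flatten u)" for u
    show "\<forall>u\<in>F. \<kappa> u = 0"
    proof (rule ccontr)
      assume "\<not> (\<forall>u\<in>F. \<kappa> u = 0)"
      then have ne: "{u \<in> F. \<kappa> u \<noteq> 0} \<noteq> {}" by blast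
      \<comment> \<open>In the exponent d n only the words of minimal length n contribute, each with
        the monomial that is its initial term.\<close>
      define n where "n = Min (len ` {u \<in> F. \<kappa> u \<noteq> 0})"
      have n: "n \<le> len u" if "u \<in> F" "\<kappa> u \<noteq> 0" for u
        unfolding n_def using fin that by (intro Min_le) auto
      have "n \<in> len ` {u \<in> F. \<kappa> u \<noteq> 0}" unfolding n_def using fin ne by (intro Min_in) auto
      then obtain u0 where u0: "u0 \<in> F" "\<kappa> u0 \<noteq> 0" "len u0 = n" by blast
      have "(e' (\<kappa> u) * word_val EV u) $$ (d * int n) =
          (if len u = n then e (\<kappa> u) * prod_list (map (letter_case w w') (flatten u)) else 0)" if "u \<in> F" for u
      proof (cases "\<kappa> u = 0")
        case True
        then show ?thesis using k_algebra_zero[OF e] by (simp add: e')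
      next
        case False
        from n[OF that this] consider "len u = n" | "n < len u" by linarith
        then show ?thesis
        proof cases
          case 2
          then have "d * int n < d * int (len u)" using d by simp
          then show ?thesis using 2 lead[of u] by (simp add: e' len_def fls_lead_def)
        qed (use lead[of u] in \<open>auto simp: e' len_def fls_lead_def\<close>)
      qed
      then have "(\<Sum>u\<in>F. if len u = n then e (\<kappa> u) * prod_list (map (letter_case w w') (flatten u)) else 0)
          = (\<Sum>u\<in>F. (e' (\<kappa> u) * word_val EV u) $$ (d * int n))"
        by simp
      also have "\<dots> = (\<Sum>u\<in>F. e' (\<kappa> u) * word_val EV u) $$ (d * int n)" by (simp add: fls_nth_sum)
      finally have "(\<Sum>u\<in>{u \<in> F. len u = n}. e (\<kappa> u) * prod_list (map (letter_case w w') (flatten u))) = 0"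
        using fin by (simp add: rel sum.If_cases Int_def)
      from free_algebra_indep[OF e free _ _ this, of u0] fin u0 alt have "\<kappa> u0 = 0"
        by (auto simp: inj_on_def intro: flatten_inj)
      then show False using u0 by simp
    qed
  next
    interpret G: vector_space "\<lambda>c p. Poly_Mapping.single 0 c * p :: letter free_group \<Rightarrow>\<^sub>0 'k"
      by (rule k_algebra_vector_space[OF k_algebra_monoid_algebra])
    fix c :: letter
    define U where "U = Poly_Mapping.single (fg_gen c) (1::'k)"
    define U' where "U' = Poly_Mapping.single (- fg_gen c) (1::'k)"
    note UU' = group_algebra_gens[of c, where 'k = 'k, folded U_def U'_def]
    \<comment> \<open>With the exponent n div 2, \<open>E n\<close> occupies the degrees from -(n
      div 2) to n - n div 2. Each step extends this range by one, alternately on the right and on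
      the left, which gives the two basic rules \<open>Ue\<close> and \<open>U'o\<close>; the other
      two follow from them.\<close>
    define E where "E n = U' ^ (n div 2) * (U - 1) ^ n" for n
    have mem: "E (Suc n) \<in> G.span (range (\<lambda>n. E (Suc n)))" for n by (simp add: G.span_base)
    have comm: "(U - 1) * U' ^ n = U' ^ n * (U - 1)" for n
      by (rule power_commuting_commutes[symmetric]) (simp add: algebra_simps UU')
    have odd: "E (Suc (2 * n)) = U' ^ n * (U - 1) ^ Suc (2 * n)" for n by (simp add: E_def)
    have even: "E (2 * n) = U' ^ n * (U - 1) ^ (2 * n)" for n by (simp add: E_def)
    have Ue: "(U - 1) * E (2 * n) = E (Suc (2 * n))" for n
      unfolding odd even by (simp only: mult.assoc[symmetric] comm) (simp only: mult.assoc power_Suc)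
    have U'o: "(U' - 1) * E (Suc (2 * n)) = - E (2 * Suc n)" for n
    proof -
      have "U' - 1 = - (U' * (U - 1))" by (simp add: algebra_simps UU')
      then have "(U' - 1) * E (Suc (2 * n)) = - (U' * ((U - 1) * U' ^ n) * (U - 1) ^ Suc (2 * n))"
        by (simp only: odd mult.assoc mult_minus_left)
      also have "\<dots> = - E (2 * Suc n)" unfolding comm even by (simp add: mult.assoc)
      finally show ?thesis .
    qed
    have Uo: "(U - 1) * E (Suc (2 * n)) = E (2 * Suc n) + E (Suc (2 * Suc n))" for n
    proof -
      have "U * (U' - 1) = - (U - 1)" by (simp add: algebra_simps UU')
      then have "(U - 1) * E (Suc (2 * n)) = - (U * (U' - 1) * E (Suc (2 * n)))"
        by (simp only: mult_minus_left minus_minus)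
      also have "\<dots> = (1 + (U - 1)) * E (2 * Suc n)" unfolding mult.assoc U'o by simp
      also have "\<dots> = E (2 * Suc n) + E (Suc (2 * Suc n))" unfolding distrib_right Ue by simp
      finally show ?thesis .
    qed
    have U'e: "(U' - 1) * E (2 * n) = E (2 * Suc n) - E (Suc (2 * n))" for n
    proof -
      have "U' - 1 = - ((U - 1) + (U' - 1) * (U - 1))" by (simp add: algebra_simps UU')
      then have "(U' - 1) * E (2 * n) = - ((U - 1) + (U' - 1) * (U - 1)) * E (2 * n)"
        by (rule arg_cong)
      also have "\<dots> = - ((U - 1) * E (2 * n) + (U' - 1) * ((U - 1) * E (2 * n)))"
        by (simp only: distrib_right mult.assoc mult_minus_left)
      finally show ?thesis unfolding Ue U'o by simp
    qed
    have E0: "E 0 = 1" by (simp add: E_def)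
    have m: "E (2 * Suc n) \<in> G.span (range (\<lambda>n. E (Suc n)))"
      "E (Suc (2 * n)) \<in> G.span (range (\<lambda>n. E (Suc n)))" for n
      using mem[of "Suc (2 * n)"] mem[of "2 * n"] by simp_all
    have all: "(U - 1) * E n \<in> G.span (range (\<lambda>n. E (Suc n)))"
      "(U' - 1) * E n \<in> G.span (range (\<lambda>n. E (Suc n)))" for n
    proof -
      have "n = 2 * (n div 2) \<or> n = Suc (2 * (n div 2))" by presburger
      then obtain k where "n = 2 * k \<or> n = Suc (2 * k)" by blast
      then show "(U - 1) * E n \<in> G.span (range (\<lambda>n. E (Suc n)))"
        "(U' - 1) * E n \<in> G.span (range (\<lambda>n. E (Suc n)))"
        using m(2)[of k] G.span_add[OF m(1)[of k] m(2)[of "Suc k"]] G.span_neg[OF m(1)[of k]]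
          G.span_diff[OF m(1)[of k] m(2)[of k]] by (auto simp only: Ue Uo U'e U'o)
    qed
    note all = all[unfolded E_def[abs_def] U_def U'_def]
    show "Poly_Mapping.single (fg_gen c) 1 - 1 \<in> G.span (range (\<lambda>i.
        Poly_Mapping.single (- fg_gen c) 1 ^ (Suc i div 2) * (Poly_Mapping.single (fg_gen c) 1 - 1) ^ Suc i))"
      using all(1)[of 0] by simp
    show "Poly_Mapping.single (- fg_gen c) 1 - 1 \<in> G.span (range (\<lambda>i.
        Poly_Mapping.single (- fg_gen c) 1 ^ (Suc i div 2) * (Poly_Mapping.single (fg_gen c) 1 - 1) ^ Suc i))"
      using all(2)[of 0] by simp
    fix i
    show "(Poly_Mapping.single (fg_gen c) 1 - 1) *
        (Poly_Mapping.single (- fg_gen c) 1 ^ (Suc i div 2) * (Poly_Mapping.single (fg_gen c) 1 - 1) ^ Suc i)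
      \<in> G.span (range (\<lambda>i.
        Poly_Mapping.single (- fg_gen c) 1 ^ (Suc i div 2) * (Poly_Mapping.single (fg_gen c) 1 - 1) ^ Suc i))"
      by (rule all)
    show "(Poly_Mapping.single (- fg_gen c) 1 - 1) *
        (Poly_Mapping.single (- fg_gen c) 1 ^ (Suc i div 2) * (Poly_Mapping.single (fg_gen c) 1 - 1) ^ Suc i)
      \<in> G.span (range (\<lambda>i.
        Poly_Mapping.single (- fg_gen c) 1 ^ (Suc i div 2) * (Poly_Mapping.single (fg_gen c) 1 - 1) ^ Suc i))"
      by (rule all)
    fix \<phi> :: "(letter free_group \<Rightarrow>\<^sub>0 'k) \<Rightarrow> 'a fls"
    assume \<phi>: "k_algebra_hom (Poly_Mapping.single 0) e' \<phi>"
      "\<And>c. \<phi> (Poly_Mapping.single (fg_gen c) 1) = letter_case A B c"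
      "\<And>c. \<phi> (Poly_Mapping.single (- fg_gen c) 1) = V' c"
    show "\<phi> (Poly_Mapping.single (- fg_gen c) 1 ^ (Suc i div 2) *
        (Poly_Mapping.single (fg_gen c) 1 - 1) ^ Suc i) = EV c i"
      unfolding EV_def
      by (simp only: k_algebra_hom_power[OF k_algebra_monoid_algebra e'(1) \<phi>(1)] k_algebra_hom_mult[OF \<phi>(1)]
          k_algebra_hom_diff[OF \<phi>(1)] k_algebra_hom_one[OF k_algebra_monoid_algebra e'(1) \<phi>(1)] \<phi>(2,3))
  qed
  then show ?thesis by simp
qed

subsection \<open>The sums of the generators of a free group and their inverses\<close>

lift_definition fg_degree :: "'a free_group \<Rightarrow> int" is
  "\<lambda>u. sum_list (map (\<lambda>(a, s). if s then 1 else - 1) u)"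
  subgoal for u v by (induction rule: fg_rel.induct) auto
  done

lemma fg_degree_simps [simp]:
  "fg_degree 0 = 0" "fg_degree (g + h) = fg_degree g + fg_degree h"
  "fg_degree (fg_gen a) = 1" "fg_degree (- fg_gen a) = -1"
  by (transfer, simp add: inv_word_def)+

text \<open>The action of a signed letter on reduced words. Folding it over a word computes a normal
  form that is constant on the classes of \<open>fg_rel\<close>.\<close>

fun cancel_cons :: "'a \<times> bool \<Rightarrow> ('a \<times> bool) list \<Rightarrow> ('a \<times> bool) list" where
  "cancel_cons x [] = [x]"
| "cancel_cons x (y # u) = (if y = (fst x, \<not> snd x) then u else x # y # u)"

abbreviation reduced :: "('a \<times> bool) list \<Rightarrow> bool" where
  "reduced u \<equiv> successively (\<lambda>x y. y \<noteq> (fst x, \<not> snd x)) u"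

lemma reduced_foldr: "reduced (foldr cancel_cons u [])"
proof (induction u)
  case (Cons x u)
  have "reduced (cancel_cons x v)" if "reduced v" for v
    using that by (cases v) (auto simp: successively_Cons)
  then show ?case using Cons by simp
qed simp

lemma cancel_cons_cancel:
  assumes "reduced v"
  shows "cancel_cons (a, s) (cancel_cons (a, \<not> s) v) = v"
  using assms by (cases v; cases "tl v") (auto simp: successively_Cons)

lemma foldr_cancel_cons_cong:
  assumes "fg_rel u v"
  shows "foldr cancel_cons u [] = foldr cancel_cons v []"
  using assms
proof induction
  case (fg_cancel u a s v)
  then show ?case using cancel_cons_cancel[OF reduced_foldr[of v], of a s] by simp
qed auto

definition fg_positive :: "'a list \<Rightarrow> 'a free_group" where
  "fg_positive l = abs_free_group (map (\<lambda>a. (a, True)) l)"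

lemma fg_positive_simps [simp]:
  "fg_positive [] = 0" "fg_positive (a # l) = fg_gen a + fg_positive l"
  by (simp_all add: fg_positive_def zero_free_group.abs_eq fg_gen.abs_eq plus_free_group.abs_eq)

lemma fg_degree_positive: "fg_degree (fg_positive l) = int (length l)"
  by (induction l) simp_all

text \<open>A word without inverse letters is its own normal form, so equality in the free group
  forces equality of the words.\<close>

lemma fg_positive_inj:
  assumes "fg_positive l = fg_positive l'"
  shows "l = l'"
proof -
  have *: "foldr cancel_cons (map (\<lambda>a. (a, True)) l) [] = map (\<lambda>a. (a, True)) l" for l :: "'a list"
  proof (induction l)
    case (Cons a l)
    then show ?case by (cases l) simp_all
  qed simp
  have "fg_rel (map (\<lambda>a. (a, True)) l) (map (\<lambda>a. (a, True)) l')"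
    using assms by (simp add: fg_positive_def free_group.abs_eq_iff)
  from foldr_cancel_cons_cong[OF this] have "map (\<lambda>a. (a, True)) l = map (\<lambda>a. (a, True)) l'"
    unfolding * .
  then have "map fst (map (\<lambda>a. (a, True)) l) = map fst (map (\<lambda>a. (a, True)) l')" by (rule arg_cong)
  then show ?thesis by (simp add: comp_def)
qed

lemma lookup_single_times_group:
  fixes g :: "'g::group_add" and c :: "'k::field"
  shows "Poly_Mapping.lookup (Poly_Mapping.single g c * q) h = c * Poly_Mapping.lookup q (- g + h)"
proof (induction q rule: poly_mapping_single_induct)
  case (add q g' c')
  have "g + g' = h \<longleftrightarrow> g' = - g + h" by (metis add.assoc left_minus right_minus add_0)
  then show ?case using add
    by (auto simp: distrib_left lookup_add mult_single lookup_single when_def)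
qed simp

text \<open>Expanding the product of the sums c + c^(-1), every choice of an inverse lowers the
  degree by 2. In degree at least the length of l only the positive word survives.\<close>

lemma lookup_symmetric_word:
  fixes U :: "'c \<Rightarrow> ('c free_group \<Rightarrow>\<^sub>0 'k::field)"
  defines "U \<equiv> \<lambda>c. Poly_Mapping.single (fg_gen c) 1 + Poly_Mapping.single (- fg_gen c) 1"
  assumes "fg_degree h \<ge> int (length l)"
  shows "Poly_Mapping.lookup (prod_list (map U l)) h = (if h = fg_positive l then 1 else 0)"
  using assms(2)
proof (induction l arbitrary: h)
  case Nil
  then show ?case by (simp add: lookup_one when_def)
next
  case (Cons c l)
  have "fg_gen c + h \<noteq> fg_positive l"
  proof
    assume "fg_gen c + h = fg_positive l"
    then have "fg_degree (fg_gen c + h) = int (length l)" by (simp only: fg_degree_positive)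
    then show False using Cons(2) by simp
  qed
  moreover have "- fg_gen c + h = fg_positive l \<longleftrightarrow> h = fg_gen c + fg_positive l"
    by (metis add.assoc left_minus right_minus add_0)
  ultimately show ?case
    using Cons(1)[of "- fg_gen c + h"] Cons(1)[of "fg_gen c + h"] Cons(2)
    by (simp add: U_def distrib_right lookup_add lookup_single_times_group)
qed

text \<open>A word of maximal length in a relation contributes its positive group element, which no
  other word of the relation produces, so its coefficient is 0.\<close>

lemma free_algebra_of_inverse_sums:
  fixes e :: "'k::field \<Rightarrow> 'a::ring_1"
  assumes e: "k_algebra e" and free: "is_free_group_algebra_on e A B"
    and A': "A * A' = 1" and B': "B * B' = 1"
  shows "is_free_algebra_on e (A + A') (B + B')"
  unfolding is_free_algebra_on_iff[OF e]
proof (intro allI impI)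
  fix p :: "letter free_monoid \<Rightarrow>\<^sub>0 'k"
  assume rel: "(\<Sum>g\<in>Poly_Mapping.keys p. e (Poly_Mapping.lookup p g) *
    monoid_val (letter_case (A + A') (B + B')) g) = 0"
  obtain \<phi> where \<phi>: "k_algebra_hom (Poly_Mapping.single 0) e \<phi>" "inj \<phi>"
    "\<phi> (Poly_Mapping.single (fg_gen La) 1) = A" "\<phi> (Poly_Mapping.single (fg_gen Lb) 1) = B"
    using free unfolding is_free_group_algebra_on_def by (elim exE conjE)
  note [simp] = k_algebra_hom_add[OF \<phi>(1)] \<phi>(3,4)
  define U where "U c = Poly_Mapping.single (fg_gen c) (1::'k) + Poly_Mapping.single (- fg_gen c) 1"
    for c :: letter
  have inv: "\<phi> (Poly_Mapping.single (- fg_gen c) 1) = letter_case A' B' c" for c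
  proof -
    have 1: "letter_case A B c * letter_case A' B' c = 1" by (cases c) (simp_all add: A' B')
    have "\<phi> (Poly_Mapping.single (- fg_gen c) 1) * \<phi> (Poly_Mapping.single (fg_gen c) 1) = \<phi> 1"
      by (simp add: k_algebra_hom_mult[OF \<phi>(1), symmetric] mult_single)
    also have "\<phi> (Poly_Mapping.single (fg_gen c) 1) = letter_case A B c" by (cases c) simp_all
    also have "\<phi> 1 = 1" by (rule k_algebra_hom_one[OF k_algebra_monoid_algebra e \<phi>(1)])
    finally show ?thesis using 1 by (metis mult.assoc mult_1_left mult_1_right)
  qed
  have U: "\<phi> (U c) = letter_case (A + A') (B + B') c" for c
    by (cases c) (simp_all add: U_def inv)
  have "\<phi> (\<Sum>g\<in>Poly_Mapping.keys p. Poly_Mapping.single 0 (Poly_Mapping.lookup p g) * monoid_val U g) = \<phi> 0"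
    unfolding k_algebra_hom_sum[OF \<phi>(1)] k_algebra_hom_mult[OF \<phi>(1)] k_algebra_hom_const[OF \<phi>(1)]
      monoid_val_transform[OF k_algebra_monoid_algebra e \<phi>(1)] U k_algebra_hom_zero[OF \<phi>(1)]
    by (rule rel)
  then have 0: "(\<Sum>g\<in>Poly_Mapping.keys p. Poly_Mapping.single 0 (Poly_Mapping.lookup p g) * monoid_val U g) = 0"
    by (rule injD[OF \<phi>(2)])
  define len where "len g = (case g of Word l \<Rightarrow> length l)" for g :: "letter free_monoid"
  show "p = 0"
  proof (rule ccontr)
    assume "p \<noteq> 0"
    then have ne: "Poly_Mapping.keys p \<noteq> {}" by simp
    then have "Max (len ` Poly_Mapping.keys p) \<in> len ` Poly_Mapping.keys p" by (intro Max_in) auto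
    then obtain g where g: "g \<in> Poly_Mapping.keys p" "len g = Max (len ` Poly_Mapping.keys p)" by auto
    have max: "len g' \<le> len g" if "g' \<in> Poly_Mapping.keys p" for g'
      unfolding g(2) using that by (intro Max_ge) auto
    obtain l where l: "g = Word l" by (cases g)
    have "Poly_Mapping.lookup (monoid_val U g') (fg_positive l) = (if g' = g then 1 else 0)"
      if g': "g' \<in> Poly_Mapping.keys p" for g'
    proof -
      obtain l' where l': "g' = Word l'" by (cases g')
      have "int (length l') \<le> fg_degree (fg_positive l)"
        using max[OF g'] by (simp add: len_def l l' fg_degree_positive)
      from lookup_symmetric_word[OF this, where 'k = 'k] show ?thesis
        by (auto simp: l l' U_def[abs_def] dest: fg_positive_inj)
    qed
    then have "Poly_Mapping.lookup (\<Sum>g\<in>Poly_Mapping.keys p.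
          Poly_Mapping.single 0 (Poly_Mapping.lookup p g) * monoid_val U g) (fg_positive l) =
        (\<Sum>g'\<in>Poly_Mapping.keys p. if g' = g then Poly_Mapping.lookup p g' else 0)"
      unfolding lookup_sum by (intro sum.cong) (simp_all add: lookup_single_times_group)
    then have "Poly_Mapping.lookup p g = 0" using g(1) by (simp add: 0)
    then show False using g(1) by (simp add: in_keys_iff)
  qed
qed

section \<open>Linear independence of iterated integrals\<close>

text \<open>
  A relation with coefficients in the differential field \<open>C\<close> whose longest part has as few terms as
  possible and contains a word with coefficient \<open>1\<close> becomes shorter, hence trivial, after applying
  the differential operator that annihilates that term modulo shorter words.
\<close>

lemma iterated_integrals_independent:
  fixes \<delta> :: "'l::field \<Rightarrow> 'l" and h :: "'w::finite list \<Rightarrow> 'l" and b :: "'w \<Rightarrow> 'w list \<Rightarrow> 'l"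
  assumes \<delta>_add: "\<And>f g. \<delta> (f + g) = \<delta> f + \<delta> g" and \<delta>_mult: "\<And>f g. \<delta> (f * g) = \<delta> f * g + f * \<delta> g"
    and C_add: "\<And>f g. f \<in> C \<Longrightarrow> g \<in> C \<Longrightarrow> f + g \<in> C" and C_mult: "\<And>f g. f \<in> C \<Longrightarrow> g \<in> C \<Longrightarrow> f * g \<in> C"
    and C_inv: "\<And>f. f \<in> C \<Longrightarrow> inverse f \<in> C" and C_0: "0 \<in> C" and C_m: "\<And>f. f \<in> C \<Longrightarrow> - f \<in> C"
    and C_\<delta>: "\<And>f. f \<in> C \<Longrightarrow> \<delta> f \<in> C"
    and W: "\<And>x u. x # u \<in> W \<Longrightarrow> u \<in> W"
    and h_Nil: "h [] = 1" and ev_Nil: "ev [] = 0"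
    and h_Cons: "\<And>x u. x # u \<in> W \<Longrightarrow> \<delta> (h (x # u)) + ev (x # u) * h (x # u) = b x u * h u"
    and b_C: "\<And>x u. b x u \<in> C" and ev_C: "\<And>u. ev u \<in> C"
    and no_sol: "\<And>q u v. q \<in> C \<Longrightarrow> u \<in> W \<Longrightarrow> v \<in> W \<Longrightarrow> ev u \<noteq> ev v \<Longrightarrow> \<delta> q + (ev u - ev v) * q = 0 \<Longrightarrow> q = 0"
    and res: "\<And>q x u \<kappa>. x # u \<in> W \<Longrightarrow> q \<in> C \<Longrightarrow> (\<And>y. \<delta> (\<kappa> y) = 0) \<Longrightarrow>
      (\<And>y. \<not> (y # u \<in> W \<and> ev (y # u) = ev (x # u)) \<Longrightarrow> \<kappa> y = 0) \<Longrightarrow>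
      \<delta> q + (ev (x # u) - ev u) * q + (\<Sum>y\<in>UNIV. \<kappa> y * b y u) = 0 \<Longrightarrow> \<kappa> x = 0"
    and F: "finite F" "F \<subseteq> W" "\<And>w. w \<in> F \<Longrightarrow> q w \<in> C" and rel: "(\<Sum>w\<in>F. q w * h w) = 0"
  shows "\<forall>w\<in>F. q w = 0"
proof -
  define L where "L n = {w :: 'w list. length w \<le> n}" for n
  have fin: "finite (L n)" for n
    using finite_lists_length_le[of "UNIV :: 'w set" n] by (simp add: L_def)
  have \<delta>0: "\<delta> 0 = 0" using \<delta>_add[of 0 0] by (metis add_cancel_right_left add_0)
  have \<delta>1: "\<delta> 1 = 0" using \<delta>_mult[of 1 1] by (metis add_cancel_right_left mult_1 mult_1_right)
  have \<delta>_sum: "\<delta> (sum f A) = (\<Sum>x\<in>A. \<delta> (f x))" for f and A :: "'w list set"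
    by (induction A rule: infinite_finite_induct) (simp_all add: \<delta>0 \<delta>_add)
  have C_sum: "sum f A \<in> C" if "\<And>x. f x \<in> C" for f and A :: "'w set"
    by (induction A rule: infinite_finite_induct) (simp_all add: C_0 C_add that)
  \<comment> \<open>Lexicographic induction on the bound n for the length of the words and on the
    number m of words of length n with nonzero coefficient.\<close>
  have main: "\<forall>w. q w = 0"
    if "\<And>w. q w \<in> C" "\<And>w. w \<notin> W \<Longrightarrow> q w = 0" "\<And>w. length w > n \<Longrightarrow> q w = 0"
      "card {w. length w = n \<and> q w \<noteq> 0} = m" "(\<Sum>w\<in>L n. q w * h w) = 0" for n m q
    using that
  proof (induction n arbitrary: m q)
    case 0
    have "L 0 = {[]}" by (auto simp: L_def)
    then have "q [] = 0" using 0(5) by (simp add: h_Nil)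
    then show ?case using 0(3) by (metis length_greater_0_conv)
  next
    case (Suc n)
    note IH = Suc.IH
    show ?case
      using Suc.prems
    proof (induction m arbitrary: q rule: less_induct)
      case (less m)
      note q = less.prems
      define T where "T q = {w. length w = Suc n \<and> q w \<noteq> 0}" for q :: "'w list \<Rightarrow> 'l"
      have finT: "finite (T q)" for q by (rule finite_subset[OF _ fin[of "Suc n"]]) (auto simp: T_def L_def)
      show ?case
      proof (cases "T q = {}")
        case True
        then have 0: "q w = 0" if "length w = Suc n" for w using that by (auto simp: T_def)
        have "q w = 0" if "length w > n" for w using 0[of w] q(3)[of w] that by (cases "length w = Suc n") auto
        moreover have "(\<Sum>w\<in>L (Suc n). q w * h w) = (\<Sum>w\<in>L n. q w * h w)"
          by (rule sum.mono_neutral_right[OF fin]) (auto simp: L_def le_Suc_eq 0)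
        ultimately show ?thesis using q(5) by (intro IH[OF q(1,2) _ refl]) simp_all
      next
        case False
        then obtain w0 where w0: "length w0 = Suc n" "q w0 \<noteq> 0" by (auto simp: T_def)
        then obtain x0 u0 where w0': "w0 = x0 # u0" by (cases w0) auto
        have w0W: "w0 \<in> W" using q(2) w0 by blast
        define p where "p w = inverse (q w0) * q w" for w
        have pC: "p w \<in> C" for w by (simp add: p_def C_mult C_inv q(1))
        have p0: "p w0 = 1" using w0 by (simp add: p_def)
        have pW: "p w = 0" if "w \<notin> W" for w using q(2)[OF that] by (simp add: p_def)
        have pn: "p w = 0" if "length w > Suc n" for w using q(3)[OF that] by (simp add: p_def)
        have prel: "(\<Sum>w\<in>L (Suc n). p w * h w) = 0"
          using q(5) by (simp add: p_def mult.assoc flip: sum_distrib_left)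
        \<comment> \<open>The operator \<delta> + \<open>ev w0\<close> is applied to the relation.
          The part \<open>r w\<close> stays with \<open>h w\<close>, and the inhomogeneous term of
          the equation for \<open>h w\<close> passes to the tail of w; \<open>q'\<close> collects
          both. Since \<open>p w0 = 1\<close>, the new coefficient at \<open>w0\<close> is
          0.\<close>
        define r where "r w = \<delta> (p w) + (ev w0 - ev w) * p w" for w
        define q' where "q' w = r w + (\<Sum>x\<in>UNIV. p (x # w) * b x w)" for w
        have rC: "r w \<in> C" for w
          unfolding r_def diff_conv_add_uminus by (intro C_add C_mult C_\<delta> pC C_m ev_C)
        have q'n: "q' w = r w" if "length w \<ge> Suc n" for w using that by (simp add: q'_def pn)
        have leibniz: "\<delta> (p w * h w) + ev w0 * (p w * h w) =
            r w * h w + (case w of [] \<Rightarrow> 0 | x # u \<Rightarrow> p (x # u) * b x u * h u)" for w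
        proof (cases w)
          case Nil
          then show ?thesis by (simp add: \<delta>_mult h_Nil \<delta>1 r_def ev_Nil algebra_simps)
        next
          case (Cons x u)
          show ?thesis
          proof (cases "w \<in> W")
            case True
            have "\<delta> (p w * h w) + ev w0 * (p w * h w) =
                r w * h w + p w * (\<delta> (h w) + ev w * h w)"
              by (simp add: \<delta>_mult r_def algebra_simps)
            then show ?thesis using True Cons h_Cons[of x u] by simp
          qed (use Cons in \<open>simp add: pW r_def \<delta>0\<close>)
        qed
        have shift: "(\<Sum>w\<in>L (Suc n). case w of [] \<Rightarrow> 0 | x # u \<Rightarrow> p (x # u) * b x u * h u) =
            (\<Sum>u\<in>L (Suc n). (\<Sum>x\<in>UNIV. p (x # u) * b x u) * h u)" (is "?lhs = ?rhs")
        proof -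
          have "?lhs = (\<Sum>w\<in>(\<lambda>(u, x). x # u) ` (L n \<times> UNIV). case w of [] \<Rightarrow> 0 | x # u \<Rightarrow> p (x # u) * b x u * h u)"
          proof (rule sum.mono_neutral_right[OF fin])
            show "\<forall>w\<in>L (Suc n) - (\<lambda>(u, x). x # u) ` (L n \<times> UNIV).
              (case w of [] \<Rightarrow> 0 | x # u \<Rightarrow> p (x # u) * b x u * h u) = 0"
            proof
              fix w assume "w \<in> L (Suc n) - (\<lambda>(u, x). x # u) ` (L n \<times> UNIV)"
              then have "w = []" by (cases w) (auto simp: L_def image_iff)
              then show "(case w of [] \<Rightarrow> 0 | x # u \<Rightarrow> p (x # u) * b x u * h u) = 0" by simp
            qed
          qed (auto simp: L_def)
          also have "\<dots> = (\<Sum>(u, x)\<in>L n \<times> UNIV. p (x # u) * b x u * h u)"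
            by (subst sum.reindex) (auto simp: inj_on_def intro!: sum.cong)
          also have "\<dots> = (\<Sum>u\<in>L n. (\<Sum>x\<in>UNIV. p (x # u) * b x u) * h u)"
            by (simp add: sum.cartesian_product[symmetric] sum_distrib_right)
          also have "\<dots> = ?rhs"
            by (rule sum.mono_neutral_left[OF fin]) (auto simp: L_def le_Suc_eq pn)
          finally show ?thesis .
        qed
        have "0 = \<delta> (\<Sum>w\<in>L (Suc n). p w * h w) + ev w0 * (\<Sum>w\<in>L (Suc n). p w * h w)"
          by (simp add: prel \<delta>0)
        also have "\<dots> = (\<Sum>w\<in>L (Suc n). \<delta> (p w * h w) + ev w0 * (p w * h w))"
          by (simp add: \<delta>_sum sum.distrib sum_distrib_left)
        also have "\<dots> = (\<Sum>w\<in>L (Suc n). q' w * h w)"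
          unfolding leibniz sum.distrib shift q'_def distrib_right ..
        finally have q'rel: "(\<Sum>w\<in>L (Suc n). q' w * h w) = 0" by simp
        have "T q' \<subset> T q"
        proof
          show "T q' \<subseteq> T q" using q'n by (auto simp: T_def r_def p_def \<delta>0)
          have "w0 \<in> T q" "w0 \<notin> T q'" using w0 q'n[of w0] p0 by (auto simp: T_def r_def \<delta>1)
          then show "T q' \<noteq> T q" by blast
        qed
        then have "card (T q') < card (T q)" by (rule psubset_card_mono[OF finT])
        then have lt: "card (T q') < m" using q(4) by (simp add: T_def)
        have 0: "\<forall>w. q' w = 0"
        proof (rule less.IH[OF lt])
          show "q' w \<in> C" for w unfolding q'_def by (intro C_add C_sum C_mult pC b_C rC)
          show "q' w = 0" if "w \<notin> W" for w
          proof -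
            have "p (x # w) = 0" for x using that W pW by blast
            then show ?thesis using that by (simp add: q'_def r_def pW \<delta>0)
          qed
          show "q' w = 0" if "length w > Suc n" for w
            using that by (simp add: q'n r_def pn \<delta>0)
        qed (simp_all add: q'rel T_def)
        \<comment> \<open>Now all \<open>q'\<close> vanish. For the words \<open>y # u0\<close> this
          makes the coefficient 0 if the exponent differs from that of \<open>w0\<close>, and a
          constant otherwise; at \<open>u0\<close> it is the equation of \<open>res\<close>. Hence
          the coefficient of \<open>w0\<close> is 0, although it was normalised to 1.\<close>
        have "p (x0 # u0) = 0"
        proof (rule res[of x0 u0 "p u0" "\<lambda>y. p (y # u0)"])
          have len: "length (y # u0) = Suc n" for y using w0 w0' by simp
          have r0: "r (y # u0) = 0" for y using 0 q'n[of "y # u0"] len[of y] by simp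
          show ev: "p (y # u0) = 0" if "\<not> (y # u0 \<in> W \<and> ev (y # u0) = ev (x0 # u0))" for y
          proof (cases "y # u0 \<in> W")
            case True
            then show ?thesis
              using that r0[of y] w0W w0' by (intro no_sol[OF pC, of w0 "y # u0"]) (auto simp: r_def)
          qed (simp add: pW)
          show "\<delta> (p (y # u0)) = 0" for y
          proof (cases "ev (y # u0) = ev w0")
            case True
            then show ?thesis using r0[of y] by (simp add: r_def)
          next
            case False
            then show ?thesis using ev[of y] w0' by (simp add: \<delta>0)
          qed
          show "\<delta> (p u0) + (ev (x0 # u0) - ev u0) * p u0 + (\<Sum>y\<in>UNIV. p (y # u0) * b y u0) = 0"
            using 0 w0' by (simp add: q'_def r_def)
        qed (use w0W w0' pC in auto)
        then show ?thesis using p0 w0' by simp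
      qed
    qed
  qed
  define q0 where "q0 w = (if w \<in> F then q w else 0)" for w
  define n where "n = Max (insert 0 (length ` F))"
  have n: "length w \<le> n" if "w \<in> F" for w unfolding n_def using F(1) that by (intro Max_ge) auto
  have "(\<Sum>w\<in>L n. q0 w * h w) = (\<Sum>w\<in>F. q w * h w)"
    by (rule sum.mono_neutral_cong_right[OF fin]) (auto simp: L_def q0_def n)
  then have "\<forall>w. q0 w = 0"
    by (intro main[of q0 n, OF _ _ _ refl]) (use F(2,3) C_0 n rel in \<open>force simp: q0_def\<close>)+
  then show ?thesis by (metis q0_def)
qed

subsection \<open>Rational functions as a differential field of Laurent series\<close>

text \<open>With q = p / r and independent variable Y, the equation is D Y q' + c q = g / ((Y - s)
  m) with denominators cleared. A pole of q at s would become a pole of order at least 2 on the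
  left, because s and D are nonzero, whereas the right side has at most a simple one. So q is
  regular at s and the residue on the right vanishes.\<close>

lemma residue_obstruction:
  fixes p r g m :: "'f::field_char_0 poly"
  assumes "r \<noteq> 0" "s \<noteq> 0" "poly m s \<noteq> 0" "D \<noteq> 0"
    and eq: "[:- s, 1:] * m * (smult D ([:0, 1:] * (pderiv p * r - p * pderiv r)) + smult c (p * r)) = r\<^sup>2 * g"
  shows "poly g s = 0"
  using assms(1) eq
proof (induction "degree r" arbitrary: p r rule: less_induct)
  case less
  let ?l = "[:- s, 1:]"
  note eq = less.prems(2)
  consider "poly r s \<noteq> 0" | "poly r s = 0" "poly p s = 0" | "poly r s = 0" "poly p s \<noteq> 0" by blast
  then show ?case
  proof cases
    case 1
    have "poly (r\<^sup>2 * g) s = 0" unfolding eq[symmetric] by simp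
    then show ?thesis using 1 by simp
  next
    case 2
    then obtain p1 r1 where pr: "p = ?l * p1" "r = ?l * r1" by (auto simp: poly_eq_0_iff_dvd elim!: dvdE)
    have r1: "r1 \<noteq> 0" using less.prems(1) pr by auto
    have "?l\<^sup>2 * (?l * m * (smult D ([:0, 1:] * (pderiv p1 * r1 - p1 * pderiv r1)) + smult c (p1 * r1))) =
        ?l\<^sup>2 * (r1\<^sup>2 * g)"
      using eq unfolding pr pderiv_mult
      by (simp add: algebra_simps power2_eq_square smult_add_right smult_diff_right
          del: mult_pCons_left mult_pCons_right)
    then have "?l * m * (smult D ([:0, 1:] * (pderiv p1 * r1 - p1 * pderiv r1)) + smult c (p1 * r1)) = r1\<^sup>2 * g"
      by (subst (asm) mult_left_cancel) auto
    moreover have "degree r1 < degree r" using r1 unfolding pr by (subst degree_mult_eq) auto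
    ultimately show ?thesis using less.hyps r1 by blast
  next
    case 3
    obtain r1 where r: "r = ?l ^ order s r * r1" "\<not> ?l dvd r1" using order_decomp[OF less.prems(1)] by blast
    obtain n where n: "order s r = Suc n" using 3 less.prems(1) order_root[of r s] by (cases "order s r") auto
    \<comment> \<open>\<open>P\<close> is the cleared left side divided by (Y - s)^(n+1). The
      equation makes its value at s vanish, but that value comes from differentiating the pole and
      is nonzero in characteristic 0.\<close>
    define P where "P = ?l * m * (smult D ([:0, 1:] * pderiv p * r1) + smult c (p * r1))
      - m * smult D ([:0, 1:] * p * (of_nat (Suc n) * r1 + ?l * pderiv r1))"
    have dl: "?l * pderiv (?l ^ Suc n) = of_nat (Suc n) * ?l ^ Suc n"
    proof -
      have "pderiv (?l ^ Suc n) = smult (of_nat (Suc n)) (?l ^ n)"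
        unfolding pderiv_power_Suc by (simp add: pderiv_pCons)
      moreover have "smult (of_nat (Suc n)) u = of_nat (Suc n) * u" for u :: "'f poly"
        by (simp add: of_nat_poly)
      ultimately show ?thesis by (simp only: power_Suc mult.left_commute)
    qed
    have lr: "?l * pderiv r = ?l ^ Suc n * (of_nat (Suc n) * r1 + ?l * pderiv r1)"
    proof -
      have "?l * pderiv r = ?l * pderiv (?l ^ Suc n) * r1 + ?l ^ Suc n * (?l * pderiv r1)"
        unfolding r(1)[unfolded n] by (simp only: pderiv_mult) (simp only: algebra_simps)
      then show ?thesis unfolding dl by (simp only: algebra_simps)
    qed
    have "?l * m * (smult D ([:0, 1:] * (pderiv p * r - p * pderiv r)) + smult c (p * r)) =
        ?l * m * (smult D ([:0, 1:] * pderiv p * r) + smult c (p * r)) - m * smult D ([:0, 1:] * p * (?l * pderiv r))"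
      by (simp add: algebra_simps smult_diff_right del: mult_pCons_left mult_pCons_right)
    also have "\<dots> = ?l ^ Suc n * P"
      unfolding lr P_def unfolding r(1)[unfolded n]
      by (simp only: algebra_simps smult_add_right mult_smult_left mult_smult_right)
    finally have "?l ^ Suc n * P = r\<^sup>2 * g" using eq by simp
    also have "\<dots> = ?l ^ Suc n * (?l ^ Suc n * r1\<^sup>2 * g)"
      unfolding r(1)[unfolded n] by (simp only: power2_eq_square mult_ac)
    finally have "?l ^ Suc n * P = ?l ^ Suc n * (?l ^ Suc n * r1\<^sup>2 * g)" .
    moreover have "?l ^ Suc n \<noteq> 0" by (rule power_not_zero) simp
    ultimately have "P = ?l ^ Suc n * r1\<^sup>2 * g" by (simp only: mult_left_cancel simp_thms)
    then have "poly P s = 0" by simp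
    then have "poly m s * (D * (s * poly p s * (of_nat (Suc n) * poly r1 s))) = 0"
      by (auto simp: P_def of_nat_poly simp del: of_nat_Suc)
    then show ?thesis
      using assms(2-4) 3 r(2) by (simp add: poly_eq_0_iff_dvd del: of_nat_Suc)
  qed
qed

text \<open>The polynomial is evaluated at Y = X^d. In the variable Y the poles of \<open>f\<close>
  and \<open>1 / f\<close> are the rational points -1 and 1 for every d, so no roots of unity are
  needed.\<close>

definition poly_fls :: "nat \<Rightarrow> 'f::field poly \<Rightarrow> 'f fls" where
  "poly_fls d p = fps_to_fls (poly (map_poly fps_const p) (fps_X ^ d))"

lemma poly_fls_0 [simp]: "poly_fls d 0 = 0"
  by (simp add: poly_fls_def)

lemma poly_fls_pCons: "poly_fls d (pCons a p) = fls_const a + fls_X ^ d * poly_fls d p"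
  by (simp add: poly_fls_def map_poly_pCons fls_times_fps_to_fls fps_to_fls_power fps_X_to_fls)

lemma poly_fls_1 [simp]: "poly_fls d 1 = 1"
  by (simp add: one_pCons poly_fls_pCons)

lemma poly_fls_add: "poly_fls d (p + q) = poly_fls d p + poly_fls d q"
  by (induction p q rule: poly_induct2) (simp_all add: poly_fls_pCons algebra_simps fls_plus_const)

lemma poly_fls_smult: "poly_fls d (smult c p) = fls_const c * poly_fls d p"
  by (induction p) (simp_all add: poly_fls_pCons algebra_simps)

lemma poly_fls_mult: "poly_fls d (p * q) = poly_fls d p * poly_fls d q"
  by (induction p) (simp_all add: poly_fls_pCons poly_fls_add poly_fls_smult algebra_simps)

lemma poly_fls_uminus: "poly_fls d (- p) = - poly_fls d p"
  using poly_fls_add[of d p "- p"] by (simp add: eq_neg_iff_add_eq_0 add.commute)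

lemma poly_fls_diff: "poly_fls d (p - q) = poly_fls d p - poly_fls d q"
  using poly_fls_add[of d "p - q" q] by simp

lemma poly_fls_eq_0_iff:
  assumes "d > 0"
  shows "poly_fls d p = 0 \<longleftrightarrow> p = 0"
proof
  show "poly_fls d p = 0 \<Longrightarrow> p = 0"
  proof (induction p)
    case (pCons a p)
    let ?g = "poly (map_poly fps_const p) (fps_X ^ d)"
    have "poly_fls d (pCons a p) = fps_to_fls (fps_const a + fps_X ^ d * ?g)"
      unfolding poly_fls_def by (simp only: map_poly_pCons poly_pCons fps_const_0_eq_0)
    then have 0: "fps_const a + fps_X ^ d * ?g = 0"
      using pCons(3) by (metis fps_to_fls_eq_0_iff)
    then have "(fps_const a + fps_X ^ d * ?g) $ 0 = 0" by simp
    then have "a = 0" using assms by (simp add: fps_mult_nth_0)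
    moreover from this have "?g = 0" using 0 by simp
    ultimately show ?case using pCons(1,2) by (simp add: poly_fls_def)
  qed simp
qed simp

section \<open>The Euler derivation X d/dX and rational functions of X^d\<close>

definition fls_euler :: "'f::field fls \<Rightarrow> 'f fls" where
  "fls_euler g = fls_X * fls_deriv g"

lemma fls_euler_nth: "fls_euler g $$ n = of_int n * g $$ n"
  by (simp add: fls_euler_def fls_X_times_conv_shift)

lemma fls_euler_add: "fls_euler (f + g) = fls_euler f + fls_euler g"
  by (intro fls_eqI) (simp add: fls_euler_nth algebra_simps)

lemma fls_euler_mult: "fls_euler (f * g) = fls_euler f * g + f * fls_euler g"
  by (simp add: fls_euler_def algebra_simps)

lemma fls_euler_const [simp]: "fls_euler (fls_const c) = 0"
  by (intro fls_eqI) (simp add: fls_euler_nth fls_const_def)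

lemma fls_const_inject: "fls_const c = fls_const c' \<longleftrightarrow> c = c'"
  by (metis fls_const_nth)

lemma fls_euler_eq_0_iff:
  fixes g :: "'f::field_char_0 fls"
  shows "fls_euler g = 0 \<longleftrightarrow> g = fls_const (g $$ 0)"
proof
  assume *: "fls_euler g = 0"
  have "g $$ n = 0" if "n \<noteq> 0" for n
    using fls_euler_nth[of g n] that by (simp add: *)
  then show "g = fls_const (g $$ 0)" by (intro fls_eqI) (simp add: fls_const_nth)
qed (metis fls_euler_const)

lemma fls_euler_X_power: "fls_euler (fls_X ^ d) = of_nat d * fls_X ^ d"
  by (induction d) (simp_all add: fls_euler_mult algebra_simps, simp_all add: fls_euler_def)

lemma fls_euler_poly_fls: "fls_euler (poly_fls d p) = of_nat d * poly_fls d ([:0, 1:] * pderiv p)"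
proof (induction p)
  case (pCons a p)
  then show ?case
    by (simp add: poly_fls_pCons fls_euler_add fls_euler_mult fls_euler_X_power pderiv_pCons
        poly_fls_add algebra_simps)
qed (simp add: fls_euler_def)

definition rational_fls :: "nat \<Rightarrow> 'f::field fls set" where
  "rational_fls d = {poly_fls d p / poly_fls d r | p r. r \<noteq> 0}"

context
  fixes d :: nat
  assumes d: "d > 0"
begin

lemma rational_flsI: "poly_fls d p \<in> rational_fls d"
  unfolding rational_fls_def by (rule CollectI, rule exI[of _ p], rule exI[of _ 1]) simp

lemma rational_fls_add: "f \<in> rational_fls d \<Longrightarrow> g \<in> rational_fls d \<Longrightarrow> f + g \<in> rational_fls d"
  unfolding rational_fls_def
proof clarify
  fix p r q s :: "'a poly" assume "r \<noteq> 0" "s \<noteq> 0"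
  then show "\<exists>p' r'. poly_fls d p / poly_fls d r + poly_fls d q / poly_fls d s = poly_fls d p' / poly_fls d r' \<and> r' \<noteq> 0"
    by (intro exI[of _ "p * s + q * r"] exI[of _ "r * s"])
       (simp add: poly_fls_add poly_fls_mult poly_fls_eq_0_iff[OF d] add_frac_eq)
qed

lemma rational_fls_mult: "f \<in> rational_fls d \<Longrightarrow> g \<in> rational_fls d \<Longrightarrow> f * g \<in> rational_fls d"
  unfolding rational_fls_def
proof clarify
  fix p r q s :: "'a poly" assume "r \<noteq> 0" "s \<noteq> 0"
  then show "\<exists>p' r'. poly_fls d p / poly_fls d r * (poly_fls d q / poly_fls d s) = poly_fls d p' / poly_fls d r' \<and> r' \<noteq> 0"
    by (intro exI[of _ "p * q"] exI[of _ "r * s"]) (simp add: poly_fls_mult)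
qed

lemma rational_fls_inverse: "f \<in> rational_fls d \<Longrightarrow> inverse f \<in> rational_fls d"
  unfolding rational_fls_def
proof clarify
  fix p r :: "'a poly" assume "r \<noteq> 0"
  then show "\<exists>p' r'. inverse (poly_fls d p / poly_fls d r) = poly_fls d p' / poly_fls d r' \<and> r' \<noteq> 0"
    by (cases "p = 0") (rule exI[of _ 0], rule exI[of _ 1], simp, rule exI[of _ r], rule exI[of _ p], simp)
qed

lemma rational_fls_uminus: "f \<in> rational_fls d \<Longrightarrow> - f \<in> rational_fls d"
  using rational_fls_mult[OF rational_flsI[of "- 1"]] by (simp add: poly_fls_uminus)

lemma fls_euler_quotient:
  fixes f g :: "'f::field fls"
  assumes "g \<noteq> 0"
  shows "fls_euler (f / g) = (fls_euler f * g - f * fls_euler g) / g\<^sup>2"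
proof -
  have "fls_euler f = fls_euler (f / g) * g + f / g * fls_euler g"
    using fls_euler_mult[of "f / g" g] assms by simp
  then show ?thesis using assms by (simp add: field_simps power2_eq_square)
qed

lemma rational_fls_euler:
  fixes f :: "'f::field fls"
  assumes "f \<in> rational_fls d"
  shows "fls_euler f \<in> rational_fls d"
proof -
  obtain p r where f: "f = poly_fls d p / poly_fls d r" "r \<noteq> 0"
    using assms unfolding rational_fls_def by blast
  have "fls_euler f = (of_nat d * (poly_fls d ([:0, 1:] * pderiv p) * poly_fls d r - poly_fls d p * poly_fls d ([:0, 1:] * pderiv r)))
      / (poly_fls d r)\<^sup>2"
    using f by (simp add: fls_euler_quotient poly_fls_eq_0_iff[OF d] fls_euler_poly_fls right_diff_distrib mult_ac
        del: mult_pCons_left mult_pCons_right)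
  also have "\<dots> = poly_fls d (smult (of_nat d) ([:0, 1:] * pderiv p * r - p * ([:0, 1:] * pderiv r))) * inverse (poly_fls d (r\<^sup>2))"
    by (simp only: poly_fls_mult poly_fls_diff poly_fls_smult power2_eq_square fls_of_nat divide_inverse)
  finally have "fls_euler f = poly_fls d (smult (of_nat d) ([:0, 1:] * pderiv p * r - p * ([:0, 1:] * pderiv r))) * inverse (poly_fls d (r\<^sup>2))" .
  then show ?thesis by (simp only: rational_fls_mult rational_flsI rational_fls_inverse)
qed

end

text \<open>In Y = X^d the two fractions have simple poles at different places, -1 and 1. At each
  place only one of them contributes to the residue, so the two coefficients can be killed
  separately.\<close>

lemma simple_pole_obstruction:
  fixes q :: "'f::field_char_0 fls" and gA gB :: "'f poly"
  assumes d: "d > 0" and q: "q \<in> rational_fls d"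
    and g: "poly gA (- 1) \<noteq> 0" "poly gB 1 \<noteq> 0"
    and eq: "fls_euler q + fls_const c * q = fls_const kN +
      fls_const kA * (poly_fls d gA / (1 + fls_X ^ d)) + fls_const kB * (poly_fls d gB / (1 - fls_X ^ d))"
  shows "kA = 0" "kB = 0"
proof -
  obtain p r where pr: "q = poly_fls d p / poly_fls d r" "r \<noteq> 0"
    using q unfolding rational_fls_def by blast
  define Z where "Z = [:0, 1:] * (pderiv p * r - p * pderiv r)"
  define G where "G = smult kN ([:1, 1:] * [:1, - 1:]) + smult kA (gA * [:1, - 1:]) + smult kB (gB * [:1, 1:])"
  have R: "poly_fls d r \<noteq> 0" using pr by (simp add: poly_fls_eq_0_iff[OF d])
  have u: "1 + fls_X ^ d = poly_fls d [:1, 1:]" and v: "1 - fls_X ^ d = poly_fls d [:1, - 1:]"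
    by (simp_all add: poly_fls_pCons)
  have uv: "poly_fls d [:1, 1:] \<noteq> 0" "poly_fls d [:1, - 1 :: 'f:] \<noteq> 0"
    by (simp_all add: poly_fls_eq_0_iff[OF d])
  have "fls_euler q = fls_const (of_nat d) * poly_fls d Z / (poly_fls d r)\<^sup>2"
    unfolding pr(1) fls_euler_quotient[OF d R] fls_euler_poly_fls fls_of_nat Z_def
    by (simp add: poly_fls_mult poly_fls_diff algebra_simps del: mult_pCons_left mult_pCons_right)
  then have "(fls_const (of_nat d) * poly_fls d Z + fls_const c * (poly_fls d p * poly_fls d r)) / (poly_fls d r)\<^sup>2 =
      fls_const kN + fls_const kA * (poly_fls d gA / poly_fls d [:1, 1:]) +
      fls_const kB * (poly_fls d gB / poly_fls d [:1, - 1:])"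
    using eq R unfolding u v pr(1) by (simp add: add_divide_distrib power2_eq_square)
  moreover have "P * Q * X = R\<^sup>2 * (n * (P * Q) + a * (A * Q) + b * (B * P))"
    if "X / R\<^sup>2 = n + a * (A / P) + b * (B / Q)" "P \<noteq> 0" "Q \<noteq> 0" "R \<noteq> 0" for P Q R X n a b A B :: "'f fls"
  proof -
    have X: "X = R\<^sup>2 * (n + a * (A / P) + b * (B / Q))" using that by (simp add: nonzero_divide_eq_eq mult.commute)
    show ?thesis unfolding X using that by (simp add: field_simps)
  qed
  ultimately have "poly_fls d [:1, 1:] * poly_fls d [:1, - 1:] *
      (fls_const (of_nat d) * poly_fls d Z + fls_const c * (poly_fls d p * poly_fls d r)) =
      (poly_fls d r)\<^sup>2 * (fls_const kN * (poly_fls d [:1, 1:] * poly_fls d [:1, - 1:]) +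
        fls_const kA * (poly_fls d gA * poly_fls d [:1, - 1:]) + fls_const kB * (poly_fls d gB * poly_fls d [:1, 1:]))"
    using uv R by blast
  then have "poly_fls d ([:1, 1:] * [:1, - 1:] * (smult (of_nat d) Z + smult c (p * r)) - r\<^sup>2 * G) = 0"
    by (simp only: G_def poly_fls_diff poly_fls_mult poly_fls_add poly_fls_smult power2_eq_square) simp
  then have id: "[:1, 1:] * [:1, - 1:] * (smult (of_nat d) Z + smult c (p * r)) = r\<^sup>2 * G"
    by (simp only: poly_fls_eq_0_iff[OF d] eq_iff_diff_eq_0[symmetric])
  have "poly G (- 1) = 0"
    by (rule residue_obstruction[of r _ "[:1, - 1:]" "of_nat d" p c])
       (use pr d id in \<open>simp_all add: Z_def del: mult_pCons_left mult_pCons_right\<close>)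
  then show "kA = 0" using g by (simp add: G_def)
  \<comment> \<open>The residue lemma expects the factor Y - 1, whereas the denominator contains 1 -
    Y; the sign is moved to the other factor.\<close>
  have "[:- 1, 1:] * (- [:1, 1 :: 'f:]) = [:1, 1:] * [:1, - 1:]" by simp
  then have "poly G 1 = 0"
    by (intro residue_obstruction[of r _ "- [:1, 1:]" "of_nat d" p c])
       (use pr d id in \<open>simp_all add: Z_def del: mult_pCons_left mult_pCons_right\<close>)
  then show "kB = 0" using g by (simp add: G_def)
qed

subsection \<open>Words in the polar parts of \<open>S\<close> and in \<open>f\<close>\<close>

definition fls_diag :: "(int \<Rightarrow> 'f::field) \<Rightarrow> 'f fls \<Rightarrow> 'f fls" where
  "fls_diag \<phi> g = Abs_fls (\<lambda>n. \<phi> n * g $$ n)"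

lemma fls_diag_nth [simp]: "fls_diag \<phi> g $$ n = \<phi> n * g $$ n"
  unfolding fls_diag_def by (rule nth_Abs_fls_lower_bound[of "fls_subdegree g"]) simp

instance letter :: finite
proof
  have "(UNIV :: letter set) \<subseteq> {La, Lb}" by (auto intro: letter.exhaust)
  then show "finite (UNIV :: letter set)" by (rule finite_subset) simp
qed

text \<open>The hypotheses say that the exponents 0, -\<gamma> - a and -\<gamma> + a are pairwise
  incongruent modulo the integers.\<close>

locale polar_words =
  fixes d :: nat and \<gamma> a :: "'f::field_char_0"
  assumes d: "d > 0" and a: "a \<noteq> 0" "\<And>n::int. 2 * a \<noteq> of_int n"
    and \<gamma>: "\<And>n::int. \<gamma> + a \<noteq> of_int n" "\<And>n::int. \<gamma> - a \<noteq> of_int n"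
begin

text \<open>On X^n, where V acts as \<gamma> - n, one has (V - a) / (V + a) - 1 = 2a / (n - \<gamma>
  - a), and for the reciprocal -2a / (n - \<gamma> + a). So \<open>polar True\<close> and
  \<open>polar False\<close> are \<open>S - 1\<close> and \<open>S' - 1\<close> for the operators
  \<open>S\<close>, \<open>S'\<close> below.\<close>

definition eigen :: "bool \<Rightarrow> 'f" where "eigen s = (if s then - \<gamma> - a else - \<gamma> + a)"

definition residue :: "bool \<Rightarrow> 'f" where "residue s = (if s then 2 * a else - 2 * a)"

definition polar :: "bool \<Rightarrow> 'f fls \<Rightarrow> 'f fls" where
  "polar s = fls_diag (\<lambda>n. residue s / (of_int n + eigen s))"

definition f :: "'f fls" where "f = (1 - fls_X ^ d) / (1 + fls_X ^ d)"

text \<open>When a block of \<open>La\<close> is followed by one of \<open>Lb\<close>, the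
  conjugating factors between them combine to \<open>f\<close>, in the opposite order to
  \<open>1 / f\<close>; inside a block (\<open>None\<close>) they cancel. The innermost block is
  applied to 1 / (1 + X^d) instead of 1: the last factor is then 1 / (1 + X^d) or 1 / (1 - X^d),
  which has a pole at X^d = -1 for \<open>La\<close> and at X^d = 1 for \<open>Lb\<close>, just like
  \<open>f\<close> and \<open>1 / f\<close>.\<close>

fun coeff_fun :: "letter option \<Rightarrow> bool \<Rightarrow> 'f fls" where
  "coeff_fun None _ = 1"
| "coeff_fun (Some La) final = (if final then 1 / (1 + fls_X ^ d) else f)"
| "coeff_fun (Some Lb) final = (if final then 1 / (1 - fls_X ^ d) else 1 / f)"

fun iter :: "(bool \<times> letter option) list \<Rightarrow> 'f fls" where
  "iter [] = 1"
| "iter ((s, l) # u) = polar s (coeff_fun l (u = []) * iter u)"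

text \<open>A block \<open>(s, None)\<^sup>n (s, Some c)\<close> stands for the power \<open>n + 1\<close> of \<open>polar s\<close>.\<close>

fun valid :: "(bool \<times> letter option) list \<Rightarrow> bool" where
  "valid [] = True"
| "valid ((s, l) # u) = (valid u \<and> (l = None \<longrightarrow> u \<noteq> [] \<and> fst (hd u) = s))"

definition ev :: "(bool \<times> letter option) list \<Rightarrow> 'f" where
  "ev u = (if u = [] then 0 else eigen (fst (hd u)))"

lemma eigen_ne_int: "of_int n + eigen s \<noteq> 0"
proof
  assume "of_int n + eigen s = 0"
  then have "\<gamma> + (if s then a else - a) = of_int n"
    by (cases s) (simp_all add: eigen_def algebra_simps add_eq_0_iff)
  then show False using \<gamma>[of n] by (cases s) auto
qed

text \<open>These are the coefficients by which X d/dX + \<open>ev u\<close> - \<open>ev v\<close>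
  multiplies the powers of X; being nonzero, they exclude homogeneous solutions among all Laurent
  series.\<close>

lemma ev_diff_ne_int: "ev u \<noteq> ev v \<Longrightarrow> of_int n + (ev u - ev v) \<noteq> 0"
proof
  assume ne: "ev u \<noteq> ev v" and eq: "of_int n + (ev u - ev v) = 0"
  have eq': "of_int (- n) + (ev v - ev u) = 0"
    using arg_cong[OF eq, of uminus] by simp
  have "2 * a = of_int n \<or> 2 * a = of_int (- n)" if "u \<noteq> []" "v \<noteq> []"
    using that ne eq eq' by (auto simp: ev_def eigen_def algebra_simps add_eq_0_iff2 split: if_splits)
  then show False using eigen_ne_int[of n "fst (hd u)"] eigen_ne_int[of "- n" "fst (hd v)"] ne eq eq' a(2)[of n] a(2)[of "- n"]
    by (cases "u = []"; cases "v = []") (auto simp: ev_def)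
qed

lemma polar_equation: "fls_euler (polar s g) + fls_const (eigen s) * polar s g = fls_const (residue s) * g"
proof (rule fls_eqI)
  fix n
  have "(of_int n + eigen s) * (residue s / (of_int n + eigen s) * g $$ n) = residue s * g $$ n"
    using eigen_ne_int[of n s] by simp
  then show "(fls_euler (polar s g) + fls_const (eigen s) * polar s g) $$ n = (fls_const (residue s) * g) $$ n"
    unfolding polar_def by (simp only: fls_plus_nth fls_euler_nth fls_mult_const_nth fls_diag_nth distrib_right)
qed

lemma coeff_fun_poly:
  obtains gA gB where
    "coeff_fun (Some La) final = poly_fls d gA / (1 + fls_X ^ d)" "poly gA (- 1) \<noteq> 0"
    "coeff_fun (Some Lb) final = poly_fls d gB / (1 - fls_X ^ d)" "poly gB 1 \<noteq> 0"
proof (cases final)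
  case True
  then show ?thesis using that[of 1 1] by simp
next
  case False
  then show ?thesis using that[of "[:1, - 1:]" "[:1, 1:]"] by (simp add: f_def poly_fls_pCons)
qed

lemma coeff_fun_rational: "coeff_fun l final \<in> rational_fls d"
proof (cases l)
  case None
  then show ?thesis using rational_flsI[OF d, of 1] by simp
next
  case (Some c)
  have u: "1 + fls_X ^ d = poly_fls d [:1, 1 :: 'f:]" and v: "1 - fls_X ^ d = poly_fls d [:1, - 1 :: 'f:]"
    by (simp_all add: poly_fls_pCons)
  obtain gA gB where
    "coeff_fun (Some La) final = poly_fls d gA / (1 + fls_X ^ d)"
    "coeff_fun (Some Lb) final = poly_fls d gB / (1 - fls_X ^ d)"
    using coeff_fun_poly[of final] by metis
  then show ?thesis unfolding u v
    by (cases c) (simp_all add: Some divide_inverse rational_fls_mult[OF d] rational_flsI[OF d] rational_fls_inverse[OF d]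
      del: coeff_fun.simps)
qed

lemma iter_independent:
  assumes F: "finite F" "\<And>w. w \<in> F \<Longrightarrow> valid w" "\<And>w. w \<in> F \<Longrightarrow> q w \<in> rational_fls d"
    and rel: "(\<Sum>w\<in>F. q w * iter w) = 0"
  shows "\<forall>w\<in>F. q w = 0"
proof (rule iterated_integrals_independent[where \<delta> = fls_euler and C = "rational_fls d" and h = iter and
    W = "{w. valid w}" and ev = "\<lambda>w. fls_const (ev w)" and
    b = "\<lambda>(s, l) u. fls_const (residue s) * coeff_fun l (u = [])" and F = F and q = q])
  have const: "fls_const c \<in> rational_fls d" for c :: 'f
    using rational_flsI[OF d, of "[:c:]"] by (simp add: poly_fls_pCons)
  show "(0 :: 'f fls) \<in> rational_fls d" using const[of 0] by simp
  show "fls_const (ev u) \<in> rational_fls d" for u by (rule const)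
  show "(case x of (s, l) \<Rightarrow> \<lambda>u. fls_const (residue s) * coeff_fun l (u = [])) u \<in> rational_fls d" for x u
    by (cases x) (simp add: rational_fls_mult[OF d const coeff_fun_rational])
  show "u \<in> {w. valid w}" if "x # u \<in> {w. valid w}" for x u using that by (cases x) simp
  show "iter [] = 1" "fls_const (ev []) = 0" by (simp_all add: ev_def)
  show "fls_euler (iter (x # u)) + fls_const (ev (x # u)) * iter (x # u) =
      (case x of (s, l) \<Rightarrow> \<lambda>u. fls_const (residue s) * coeff_fun l (u = [])) u * iter u" for x u
    by (cases x) (simp add: ev_def polar_equation mult.assoc)
  show "q = 0" if "fls_const (ev u) \<noteq> fls_const (ev v)"
    "fls_euler q + (fls_const (ev u) - fls_const (ev v)) * q = 0" for q u v
  proof (rule fls_eqI)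
    fix n
    have "fls_const (ev u) - fls_const (ev v) = fls_const (ev u - ev v)" by (simp add: fls_minus_const)
    then have "(fls_euler q + fls_const (ev u - ev v) * q) $$ n = 0" using that(2) by simp
    then have "(of_int n + (ev u - ev v)) * q $$ n = 0" by (simp add: fls_euler_nth algebra_simps)
    moreover have "ev u \<noteq> ev v" using that(1) by auto
    ultimately show "q $$ n = 0 $$ n" using ev_diff_ne_int[of u v n] by simp
  qed
next
  fix q x u and \<kappa> :: "bool \<times> letter option \<Rightarrow> 'f fls"
  assume xu: "x # u \<in> {w. valid w}" and q: "q \<in> rational_fls d" and \<kappa>: "\<And>y. fls_euler (\<kappa> y) = 0"
    and \<kappa>0: "\<And>y. \<not> (y # u \<in> {w. valid w} \<and> fls_const (ev (y # u)) = fls_const (ev (x # u))) \<Longrightarrow> \<kappa> y = 0"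
    and eq: "fls_euler q + (fls_const (ev (x # u)) - fls_const (ev u)) * q +
      (\<Sum>y\<in>UNIV. \<kappa> y * (case y of (s, l) \<Rightarrow> \<lambda>u. fls_const (residue s) * coeff_fun l (u = [])) u) = 0"
  obtain s l where x: "x = (s, l)" by (cases x)
  define k where "k l = \<kappa> (s, l) $$ 0" for l
  have k: "\<kappa> (s, l) = fls_const (k l)" for l using \<kappa> unfolding k_def fls_euler_eq_0_iff by blast
  \<comment> \<open>Letters of the opposite sign have another exponent, so their coefficients are
    already known to vanish and only three letters remain in the sum.\<close>
  have "eigen (\<not> s) \<noteq> eigen s" using a(1) by (cases s) (auto simp: eigen_def eq_neg_iff_add_eq_0)
  then have z: "\<kappa> (\<not> s, l) = 0" for l by (intro \<kappa>0) (auto simp: x ev_def fls_const_inject)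
  have UNIV: "(UNIV :: (bool \<times> letter option) set) =
      {(s, None), (s, Some La), (s, Some Lb), (\<not> s, None), (\<not> s, Some La), (\<not> s, Some Lb)}"
    by (auto; metis (full_types) letter.exhaust not_None_eq)
  have "(\<Sum>y\<in>UNIV. \<kappa> y * (case y of (s, l) \<Rightarrow> \<lambda>u. fls_const (residue s) * coeff_fun l (u = [])) u) =
      fls_const (residue s * k None) + fls_const (residue s * k (Some La)) * coeff_fun (Some La) (u = []) +
      fls_const (residue s * k (Some Lb)) * coeff_fun (Some Lb) (u = [])"
    unfolding UNIV by (simp add: z k mult_ac fls_const_mult_const[symmetric] del: coeff_fun.simps(2,3) fls_const_mult_const)
  then have "fls_euler q + fls_const (ev (x # u) - ev u) * q + (fls_const (residue s * k None) +
      fls_const (residue s * k (Some La)) * coeff_fun (Some La) (u = []) +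
      fls_const (residue s * k (Some Lb)) * coeff_fun (Some Lb) (u = [])) = 0"
    using eq by (simp add: fls_minus_const)
  then have eq': "fls_euler q + fls_const (ev (x # u) - ev u) * q = fls_const (- residue s * k None) +
      fls_const (- residue s * k (Some La)) * coeff_fun (Some La) (u = []) +
      fls_const (- residue s * k (Some Lb)) * coeff_fun (Some Lb) (u = [])"
    by (simp add: add_eq_0_iff2 fls_const_uminus del: coeff_fun.simps)
  have res: "residue s \<noteq> 0" using a(1) by (simp add: residue_def)
  obtain gA gB where g:
    "coeff_fun (Some La) (u = []) = poly_fls d gA / (1 + fls_X ^ d)" "poly gA (- 1) \<noteq> 0"
    "coeff_fun (Some Lb) (u = []) = poly_fls d gB / (1 - fls_X ^ d)" "poly gB 1 \<noteq> 0"
    using coeff_fun_poly[of "u = []"] by metis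
  have AB: "k (Some La) = 0" "k (Some Lb) = 0"
    using simple_pole_obstruction[OF d q g(2,4) eq'[unfolded g(1,3)]] res by simp_all
  show "\<kappa> x = 0"
  proof (cases l)
    case None
    \<comment> \<open>Prolonging a block keeps the sign, so the exponents cancel and an Euler
      derivative is left, which has constant term 0.\<close>
    then have "ev (x # u) = ev u" using xu by (auto simp: x ev_def)
    then have "(fls_const (residue s * k None)) $$ 0 = (- fls_euler q) $$ 0"
      using eq' AB by (simp add: fls_const_uminus)
    then show ?thesis using res by (simp add: x None k fls_euler_nth)
  next
    case (Some c)
    then show ?thesis using AB by (cases c) (simp_all add: x k)
  qed
qed (use F rel in \<open>auto simp: fls_euler_add fls_euler_mult rational_fls_add[OF d] rational_fls_mult[OF d]
      rational_fls_inverse[OF d] rational_fls_uminus[OF d] rational_fls_euler[OF d]\<close>)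

end

section \<open>Linear endomorphisms of a field of Laurent series\<close>

text \<open>Endomorphisms linear over the coefficient field, as a type of rings, so that they can in
  turn be the coefficients of Laurent series in t.\<close>

typedef (overloaded) 'f lend =
  "{g :: 'f::field fls \<Rightarrow> 'f fls. (\<forall>x y. g (x + y) = g x + g y) \<and>
    (\<forall>c x. g (fls_const c * x) = fls_const c * g x)}"
  morphisms app Abs_lend
  by (rule exI[of _ "\<lambda>x. x"]) simp

lemma app_add: "app A (x + y) = app A x + app A y"
  and app_const_mult: "app A (fls_const c * x) = fls_const c * app A x"
  using app[of A] by blast+

lemma app_zero [simp]: "app A 0 = 0"
  using app_const_mult[of A 0 0] by simp

lemma lend_eqI: "(\<And>x. app A x = app B x) \<Longrightarrow> A = B"
  by (rule app_inject[THEN iffD1]) (rule ext)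

lemma app_Abs:
  "(\<And>x y. g (x + y) = g x + g y) \<Longrightarrow> (\<And>c x. g (fls_const c * x) = fls_const c * g x) \<Longrightarrow>
    app (Abs_lend g) x = g x"
  by (subst Abs_lend_inverse) auto

instantiation lend :: (field) ring_1
begin

definition zero_lend :: "'a lend" where "0 = Abs_lend (\<lambda>_. 0)"
definition one_lend :: "'a lend" where "1 = Abs_lend (\<lambda>x. x)"
definition plus_lend :: "'a lend \<Rightarrow> 'a lend \<Rightarrow> 'a lend" where
  "A + B = Abs_lend (\<lambda>x. app A x + app B x)"
definition uminus_lend :: "'a lend \<Rightarrow> 'a lend" where "- A = Abs_lend (\<lambda>x. - app A x)"
definition minus_lend :: "'a lend \<Rightarrow> 'a lend \<Rightarrow> 'a lend" where
  "A - B = Abs_lend (\<lambda>x. app A x - app B x)"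
definition times_lend :: "'a lend \<Rightarrow> 'a lend \<Rightarrow> 'a lend" where
  "A * B = Abs_lend (\<lambda>x. app A (app B x))"

lemma app_ring_ops [simp]:
  "app 0 x = 0" "app 1 x = x" "app (A + B) x = app A x + app B x" "app (- A) x = - app A x"
  "app (A - B) x = app A x - app B x" "app (A * B) x = app A (app B x)"
  unfolding zero_lend_def one_lend_def plus_lend_def uminus_lend_def minus_lend_def times_lend_def
  by (rule app_Abs; (simp only: app_add app_const_mult)?; simp add: algebra_simps)+

instance
proof
  show "(0 :: 'a lend) \<noteq> 1"
  proof
    assume "(0 :: 'a lend) = 1"
    then have "app (0 :: 'a lend) 1 = app 1 1" by (rule arg_cong)
    then show False by simp
  qed
qed (rule lend_eqI, simp add: app_add)+

end

lemma app_sum: "app (sum f A) x = (\<Sum>i\<in>A. app (f i) x)"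
  by (induction A rule: infinite_finite_induct) simp_all

lemma app_power: "app (A ^ n) x = (app A ^^ n) x"
  by (induction n) simp_all

definition lend_mult :: "'f::field fls \<Rightarrow> 'f lend" where "lend_mult g = Abs_lend (\<lambda>x. g * x)"

definition lend_diag :: "(int \<Rightarrow> 'f::field) \<Rightarrow> 'f lend" where "lend_diag \<phi> = Abs_lend (fls_diag \<phi>)"

lemma app_lend_mult [simp]: "app (lend_mult g) x = g * x"
  unfolding lend_mult_def by (rule app_Abs) (simp_all add: algebra_simps)

lemma app_lend_diag [simp]: "app (lend_diag \<phi>) = fls_diag \<phi>"
  unfolding lend_diag_def by (rule ext, rule app_Abs) (intro fls_eqI, simp add: algebra_simps)+

lemma lend_mult_mult: "lend_mult f * lend_mult g = lend_mult (f * g)"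
  by (rule lend_eqI) (simp add: mult.assoc)

lemma lend_mult_power: "lend_mult f ^ n = lend_mult (f ^ n)"
  by (induction n) (auto intro: lend_eqI simp: mult.assoc)

lemma lend_mult_add: "lend_mult f + lend_mult g = lend_mult (f + g)"
  and lend_mult_diff: "lend_mult f - lend_mult g = lend_mult (f - g)"
  by (rule lend_eqI; simp add: algebra_simps)+

lemma lend_mult_1: "lend_mult 1 = 1"
  by (rule lend_eqI) simp

lemma lend_diag_mult: "lend_diag \<phi> * lend_diag \<psi> = lend_diag (\<lambda>n. \<phi> n * \<psi> n)"
  by (intro lend_eqI fls_eqI) simp

lemma lend_diag_add: "lend_diag \<phi> + lend_diag \<psi> = lend_diag (\<lambda>n. \<phi> n + \<psi> n)"
  and lend_diag_diff: "lend_diag \<phi> - lend_diag \<psi> = lend_diag (\<lambda>n. \<phi> n - \<psi> n)"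
  by (intro lend_eqI fls_eqI, simp add: algebra_simps)+

lemma lend_diag_1: "lend_diag (\<lambda>_. 1) = 1"
  by (intro lend_eqI fls_eqI) simp

definition lend_const :: "'f::field \<Rightarrow> 'f lend" where "lend_const c = lend_mult (fls_const c)"

lemma app_lend_const [simp]: "app (lend_const c) x = fls_const c * x"
  by (simp add: lend_const_def)

lemma lend_const_commute: "lend_const c * A = A * lend_const c"
  by (rule lend_eqI) (simp add: app_const_mult)

subsection \<open>Freeness in the endomorphism ring\<close>

context polar_words
begin

text \<open>The quotient (V - a z) / (V + a z) with z scaled to 1 and V acting on X^n as \<gamma> -
  n.\<close>

definition S :: "'f lend" where "S = lend_diag (\<lambda>n. (\<gamma> - of_int n - a) / (\<gamma> - of_int n + a))"
definition S' :: "'f lend" where "S' = lend_diag (\<lambda>n. (\<gamma> - of_int n + a) / (\<gamma> - of_int n - a))"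

lemma gamma_ne: "\<gamma> - of_int n + a \<noteq> 0" "\<gamma> - of_int n - a \<noteq> 0"
  using \<gamma>[of n] by (auto simp: algebra_simps)

lemma S_inverse: "S * S' = 1" "S' * S = 1"
  unfolding S_def S'_def lend_diag_mult lend_diag_1[symmetric]
  using gamma_ne by (intro arg_cong[where f = lend_diag] ext; simp)+

lemma one_pm_X_power_ne: "1 + fls_X ^ d \<noteq> (0 :: 'f fls)" "1 - fls_X ^ d \<noteq> (0 :: 'f fls)"
proof -
  have "(1 + fls_X ^ d) $$ 0 = (1 :: 'f)" "(1 - fls_X ^ d) $$ 0 = (1 :: 'f)" using d by simp_all
  then show "1 + fls_X ^ d \<noteq> (0 :: 'f fls)" "1 - fls_X ^ d \<noteq> (0 :: 'f fls)"
    by (metis fls_zero_nth zero_neq_one)+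
qed

lemma f_ne: "f \<noteq> 0"
  using one_pm_X_power_ne by (simp add: f_def)

definition pre :: "letter \<Rightarrow> 'f fls" where "pre c = (case c of La \<Rightarrow> 1 | Lb \<Rightarrow> f)"

lemma pre_ne: "pre c \<noteq> 0"
  by (cases c) (simp_all add: pre_def f_ne)

definition polar_power :: "letter \<Rightarrow> bool \<times> nat \<Rightarrow> 'f lend" where
  "polar_power c i = lend_mult (pre c) * lend_diag (\<lambda>n. residue (fst i) / (of_int n + eigen (fst i))) ^ Suc (snd i) *
    lend_mult (inverse (pre c))"

definition encode :: "(letter \<times> bool \<times> nat) list \<Rightarrow> (bool \<times> letter option) list" where
  "encode w = concat (map (\<lambda>(c, s, n). replicate n (s, None) @ [(s, Some c)]) w)"

lemma encode_simps [simp]: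
  "encode [] = []" "encode ((c, s, n) # w) = replicate n (s, None) @ (s, Some c) # encode w"
  by (simp_all add: encode_def)

lemma encode_eq_Nil [simp]: "encode w = [] \<longleftrightarrow> w = []"
  by (cases w) auto

lemma encode_valid: "valid (encode w)"
proof (induction w)
  case (Cons x w)
  obtain c s n where x: "x = (c, s, n)" by (cases x)
  have "valid (replicate n (s, None) @ (s, Some c) # u) \<and> fst (hd (replicate n (s, None) @ (s, Some c) # u)) = s"
    if "valid u" for u
    using that by (induction n) auto
  then show ?case using Cons by (simp add: x)
qed simp

lemma encode_inj: "encode w = encode w' \<Longrightarrow> w = w'"
proof (induction w arbitrary: w')
  case Nil
  then show ?case by (metis encode_eq_Nil encode_simps(1))
next
  case (Cons x w)
  obtain c s n where x: "x = (c, s, n)" by (cases x)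
  have "w' \<noteq> []" using Cons(2) by (auto simp: x)
  then obtain c' s' n' v where w': "w' = (c', s', n') # v" by (cases w') auto
  have "n = n' \<and> s = s' \<and> c = c' \<and> u = u'"
    if "replicate n (s, None) @ (s, Some c) # u = replicate n' (s', None) @ (s', Some c') # u'" for u u'
    using that
  proof (induction n arbitrary: n')
    case 0
    then show ?case by (cases n') auto
  next
    case (Suc n)
    then show ?case by (cases n') auto
  qed
  from this[of "encode w" "encode v"] show ?case using Cons unfolding x w' by auto
qed

lemma iter_replicate: "u \<noteq> [] \<Longrightarrow> iter (replicate n (s, None) @ u) = (polar s ^^ n) (iter u)"
  by (induction n) auto

lemma app_polar_power:
  "app (polar_power c (s, n)) g = pre c * (polar s ^^ Suc n) (inverse (pre c) * g)"
  by (simp add: polar_power_def app_power polar_def funpow_swap1)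

text \<open>Neighbouring blocks have different letters, so the conjugating factors between them
  combine to \<open>f\<close> or \<open>1 / f\<close> and never cancel; only the outermost one is
  left over, as a rational coefficient.\<close>

lemma app_word:
  assumes "distinct_adj (map fst ((c, i) # w))"
  shows "app (word_val polar_power ((c, i) # w)) (1 / (1 + fls_X ^ d)) = pre c * iter (encode ((c, i) # w))"
  using assms
proof (induction w arbitrary: c i)
  case Nil
  obtain s n where i: "i = (s, n)" by (cases i)
  have "inverse (pre c) * (1 / (1 + fls_X ^ d)) = coeff_fun (Some c) True"
    using one_pm_X_power_ne by (cases c) (simp_all add: pre_def f_def field_simps)
  then show ?case
    by (simp add: i app_polar_power iter_replicate funpow_swap1 del: coeff_fun.simps)
next
  case (Cons x w)
  obtain c' i' where x: "x = (c', i')" by (cases x)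
  obtain s n where i: "i = (s, n)" by (cases i)
  have "c \<noteq> c'" using Cons(2) by (simp add: x)
  then have *: "inverse (pre c) * (pre c' * g) = coeff_fun (Some c) False * g" for g
    by (cases c; cases c') (simp_all add: pre_def divide_inverse)
  have "app (word_val polar_power (x # w)) (1 / (1 + fls_X ^ d)) = pre c' * iter (encode (x # w))"
    using Cons.IH[of c' i'] Cons.prems by (simp add: x)
  then show ?case
    by (simp add: i word_val_simps(2)[of _ c] app_polar_power iter_replicate funpow_swap1 *
        del: coeff_fun.simps word_val_simps(2))
qed

lemma free_group_algebra:
  fixes e :: "'k::field \<Rightarrow> 'f lend" and \<iota> :: "'k \<Rightarrow> 'f"
  assumes e: "k_algebra e" "\<And>c. e c = lend_const (\<iota> c)" "\<And>c. \<iota> c = 0 \<Longrightarrow> c = 0"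
  shows "is_free_group_algebra_on e S (lend_mult f * S * lend_mult (inverse f))"
proof -
  define V where "V c = lend_mult (pre c) * S * lend_mult (inverse (pre c))" for c
  define V' where "V' c = lend_mult (pre c) * S' * lend_mult (inverse (pre c))" for c
  have pre: "lend_mult (pre c) * lend_mult (inverse (pre c)) = 1" "lend_mult (inverse (pre c)) * lend_mult (pre c) = 1" for c
    using pre_ne[of c] by (simp_all add: lend_mult_mult lend_mult_1)
  have conj: "(lend_mult (pre c) * A * lend_mult (inverse (pre c))) * (lend_mult (pre c) * B * lend_mult (inverse (pre c)))
      = lend_mult (pre c) * (A * B) * lend_mult (inverse (pre c))" for A B c
  proof -
    have "(lend_mult (pre c) * A * lend_mult (inverse (pre c))) * (lend_mult (pre c) * B * lend_mult (inverse (pre c)))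
      = lend_mult (pre c) * A * (lend_mult (inverse (pre c)) * lend_mult (pre c)) * B * lend_mult (inverse (pre c))"
      by (simp only: mult.assoc)
    then show ?thesis unfolding pre by (simp add: mult.assoc)
  qed
  have VV': "V c * V' c = 1" "V' c * V c = 1" for c
    unfolding V_def V'_def conj S_inverse by (simp_all add: pre)
  have polar: "(if s then S else S') - 1 = lend_diag (\<lambda>n. residue s / (of_int n + eigen s))" for s
    unfolding S_def S'_def lend_diag_1[symmetric]
    using gamma_ne eigen_ne_int[of _ s]
    by (cases s) (simp_all add: lend_diag_diff residue_def eigen_def field_simps,
        (intro arg_cong[where f = lend_diag] ext, simp add: field_simps)+)
  have power: "((if s then V c else V' c) - 1) ^ Suc n = polar_power c (s, n)" for c s n
  proof -
    define Q where "Q = (if s then S else S') - 1"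
    have 1: "(if s then V c else V' c) - 1 = lend_mult (pre c) * Q * lend_mult (inverse (pre c))"
      using pre(1)[of c] by (simp add: Q_def V_def V'_def algebra_simps)
    have "(lend_mult (pre c) * Q * lend_mult (inverse (pre c))) ^ Suc m =
        lend_mult (pre c) * Q ^ Suc m * lend_mult (inverse (pre c))" for m
    proof (induction m)
      case (Suc m)
      show ?case unfolding power_Suc[of _ "Suc m"] Suc conj ..
    qed simp
    then show ?thesis unfolding 1 by (simp add: polar_power_def Q_def polar)
  qed
  have "is_free_group_algebra_on e (V La) (V Lb)"
  proof (rule free_group_algebra_via_polar_words[OF e(1) VV'])
    fix F :: "(letter \<times> bool \<times> nat) list set" and \<kappa>
    assume F: "finite F" "\<And>w. w \<in> F \<Longrightarrow> distinct_adj (map fst w)"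
      and rel: "(\<Sum>w\<in>F. e (\<kappa> w) * word_val (\<lambda>c (s, n). ((if s then V c else V' c) - 1) ^ Suc n) w) = 0"
    \<comment> \<open>The empty word returns the start series 1 / (1 + X^d) itself. It is counted as
      a rational coefficient of \<open>iter [] = 1\<close>.\<close>
    define q where "q w = fls_const (\<iota> (\<kappa> w)) * (case w of [] \<Rightarrow> 1 / (1 + fls_X ^ d) | x # _ \<Rightarrow> pre (fst x))" for w
    have EV: "(\<lambda>c (s, n). ((if s then V c else V' c) - 1) ^ Suc n) = polar_power"
      by (intro ext) (simp add: power del: power_Suc split: prod.split)
    have word: "app (e (\<kappa> w) * word_val polar_power w) (1 / (1 + fls_X ^ d)) = q w * iter (encode w)" if "w \<in> F" for w
    proof (cases w)
      case (Cons x u)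
      then show ?thesis using F(2)[OF that] app_word[of "fst x" "snd x" u] by (simp add: q_def e(2) mult.assoc)
    qed (simp add: q_def e(2))
    have "(\<Sum>w\<in>F. q w * iter (encode w)) = 0"
      using arg_cong[OF rel, of "\<lambda>A. app A (1 / (1 + fls_X ^ d))"] unfolding EV
      by (simp add: app_sum word del: app_ring_ops(6))
    moreover have inj: "inj_on encode F" by (rule inj_onI) (rule encode_inj)
    ultimately have sum: "(\<Sum>u\<in>encode ` F. q (the_inv_into F encode u) * iter u) = 0"
      by (simp add: sum.reindex the_inv_into_f_f)
    have const: "fls_const c \<in> rational_fls d" for c :: 'f
      using rational_flsI[OF d, of "[:c:]"] by (simp add: poly_fls_pCons)
    have "q w \<in> rational_fls d" for w
    proof -
      have "1 / (1 + fls_X ^ d) \<in> (rational_fls d :: 'f fls set)" "f \<in> rational_fls d"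
        using coeff_fun_rational[of "Some La" True] coeff_fun_rational[of "Some La" False] by simp_all
      then have "(case w of [] \<Rightarrow> 1 / (1 + fls_X ^ d) | x # _ \<Rightarrow> pre (fst x)) \<in> rational_fls d"
        using const[of 1] by (auto simp: pre_def split: list.split letter.split)
      then show ?thesis unfolding q_def by (rule rational_fls_mult[OF d const])
    qed
    then have "\<forall>u\<in>encode ` F. q (the_inv_into F encode u) = 0"
      using F(1) by (intro iter_independent[OF _ _ _ sum]) (auto simp: encode_valid)
    then have "q w = 0" if "w \<in> F" for w using that inj by (auto simp: the_inv_into_f_f)
    moreover have "(case w of [] \<Rightarrow> 1 / (1 + fls_X ^ d) | x # _ \<Rightarrow> pre (fst x)) \<noteq> 0" for w :: "(letter \<times> bool \<times> nat) list"
      using one_pm_X_power_ne pre_ne by (cases w) simp_all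
    ultimately show "\<forall>w\<in>F. \<kappa> w = 0"
      using e(3) by (simp add: q_def)
  qed
  moreover have "V La = S" "V Lb = lend_mult f * S * lend_mult (inverse f)"
    by (simp_all add: V_def pre_def lend_mult_1)
  ultimately show ?thesis by simp
qed

lemma free_algebra:
  fixes e :: "'k::field \<Rightarrow> 'f lend" and \<iota> :: "'k \<Rightarrow> 'f"
  assumes e: "k_algebra e" "\<And>c. e c = lend_const (\<iota> c)" "\<And>c. \<iota> c = 0 \<Longrightarrow> c = 0"
  shows "is_free_algebra_on e (S + S') (lend_mult f * (S + S') * lend_mult (inverse f))"
proof -
  have "(lend_mult f * S * lend_mult (inverse f)) * (lend_mult f * S' * lend_mult (inverse f)) =
      lend_mult f * (S * (lend_mult (inverse f) * lend_mult f) * S') * lend_mult (inverse f)"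
    by (simp only: mult.assoc)
  also have "\<dots> = 1" using f_ne by (simp add: lend_mult_mult lend_mult_1 S_inverse)
  finally show ?thesis
    using free_algebra_of_inverse_sums[OF e(1) free_group_algebra[OF e] S_inverse(1)]
    by (simp add: distrib_left distrib_right)
qed

end

section \<open>A representation of the enveloping algebra by series\<close>

definition fls_monom :: "int \<Rightarrow> 'a::zero \<Rightarrow> 'a fls" where
  "fls_monom i A = fls_shift (- i) (fls_const A)"

lemma fls_monom_nth [simp]: "fls_monom i A $$ n = (if n = i then A else 0)"
  by (simp add: fls_monom_def fls_const_nth)

lemma fls_monom_mult: "fls_monom i A * fls_monom j B = fls_monom (i + j) (A * B :: 'a::ring_1)"
  by (simp add: fls_monom_def fls_shifted_times_simps add.commute)

lemma fls_monom_add: "fls_monom i A + fls_monom i B = fls_monom i (A + B :: 'a::ring_1)"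
  and fls_monom_diff: "fls_monom i A - fls_monom i B = fls_monom i (A - B :: 'a::ring_1)"
  by (rule fls_eqI; simp)+

lemma fls_monom_0: "fls_monom 0 A = fls_const A"
  by (simp add: fls_monom_def)

lemma fls_monom_power: "fls_monom i A ^ n = fls_monom (int n * i) (A ^ n :: 'a::ring_1)"
  by (induction n) (simp_all add: fls_monom_0 fls_monom_mult algebra_simps)

definition base_const :: "'k::field \<Rightarrow> 'k fls lend" where
  "base_const c = lend_const (fls_const c)"

text \<open>Three layers: k lies in the field of Laurent series in 1/\<gamma>, endomorphisms act on
  Laurent series in X over that field, and these endomorphisms are the coefficients of Laurent
  series in t.\<close>

definition scalar :: "'k::field \<Rightarrow> 'k fls lend fls" where
  "scalar c = fls_const (base_const c)"

lemma k_algebra_base_const: "k_algebra (base_const :: 'k::field \<Rightarrow> _)"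
  unfolding k_algebra_def
proof (intro conjI allI)
  fix c d :: 'k and A
  show "base_const (1 :: 'k) = 1"
    by (rule lend_eqI) (simp add: base_const_def)
  show "base_const (c + d) = base_const c + base_const d"
    by (rule lend_eqI) (simp add: base_const_def distrib_right fls_plus_const[symmetric])
  show "base_const (c * d) = base_const c * base_const d"
    by (rule lend_eqI) (simp add: base_const_def mult.assoc fls_const_mult_const[symmetric] del: fls_const_mult_const)
  show "base_const c * A = A * base_const c"
    unfolding base_const_def by (rule lend_const_commute)
qed

lemma k_algebra_scalar: "k_algebra (scalar :: 'k::field \<Rightarrow> _)"
  unfolding k_algebra_def
proof (intro conjI allI)
  note b = k_algebra_one[OF k_algebra_base_const] k_algebra_add[OF k_algebra_base_const]
    k_algebra_mult[OF k_algebra_base_const]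
  fix c d :: 'k and A
  show "scalar (1 :: 'k) = 1" by (simp add: scalar_def b)
  show "scalar (c + d) = scalar c + scalar d" by (simp add: scalar_def b fls_plus_const)
  show "scalar (c * d) = scalar c * scalar d" by (simp add: scalar_def b)
  show "scalar c * A = A * scalar c"
    unfolding scalar_def by (rule fls_eqI) (simp add: k_algebra_commute[OF k_algebra_base_const])
qed

text \<open>A transcendental over k. Its reciprocal is the series variable, so that the degree of a
  polynomial in \<open>gamma\<close> is visible as its lowest exponent.\<close>

definition gamma :: "'k::field fls" where "gamma = fls_X_inv"

definition op_v :: "'k::field_char_0 fls lend" where
  "op_v = lend_diag (\<lambda>n. gamma - of_int n)"

text \<open>For z = 1 the relation yx - xy = 1 gives V = xy + 1/2, hence x = (V - 1/2) y^(-1), with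
  y acting as multiplication by X.\<close>

definition op_x :: "'k::field_char_0 fls lend" where
  "op_x = lend_diag (\<lambda>n. gamma - of_int n - 1 / 2) * lend_mult fls_X_inv"

definition op_y :: "'k::field_char_0 fls lend" where
  "op_y = lend_mult fls_X"

lemma app_op_x_nth: "app op_x g $$ n = (gamma - of_int n - 1 / 2) * g $$ (n + 1)"
  by (simp add: op_x_def fls_X_inv_times_conv_shift)

lemma app_op_y_nth: "app op_y g $$ n = g $$ (n - 1)"
  by (simp add: op_y_def fls_X_times_conv_shift)

lemma op_commutator: "op_y * op_x - op_x * op_y = 1"
  by (intro lend_eqI fls_eqI) (simp add: app_op_x_nth app_op_y_nth algebra_simps)

lemma op_anticommutator: "op_x * op_y + op_y * op_x = op_v + op_v"
  by (intro lend_eqI fls_eqI) (simp add: op_v_def app_op_x_nth app_op_y_nth algebra_simps)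

context
  fixes d :: nat
  assumes d: "d > 0"
begin

definition series_x :: "'k::field_char_0 fls lend fls" where "series_x = fls_monom (- 1) op_x"
definition series_y :: "'k::field_char_0 fls lend fls" where "series_y = fls_monom (- (int d - 1)) op_y"
definition series_z :: "'k::field_char_0 fls lend fls" where "series_z = fls_monom (- int d) 1"

lemma series_commutator: "series_y * series_x - series_x * series_y = series_z"
  by (simp add: series_x_def series_y_def series_z_def fls_monom_mult fls_monom_diff add.commute op_commutator)

lemma series_z_central: "series_z * series_x = series_x * series_z" "series_z * series_y = series_y * series_z"
  by (simp_all add: series_x_def series_y_def series_z_def fls_monom_mult add.commute)

section \<open>Ordered monomials and regularity of the representation\<close>

definition pbw :: "nat \<times> nat \<times> nat \<Rightarrow> 'k::field UH" where
  "pbw m = (case m of (c, a, b) \<Rightarrow> UH_of heis_z ^ c * UH_of heis_x ^ a * UH_of heis_y ^ b)"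

text \<open>The scalar produced by x^a. As a polynomial in \<open>gamma\<close> it is monic of
  degree a, which separates the different powers of x.\<close>

definition factors :: "nat \<Rightarrow> int \<Rightarrow> 'k::field_char_0 fls" where
  "factors a n = (\<Prod>l<a. gamma - of_int (n + int l) - 1 / 2)"

lemma fls_lead_factors: "fls_lead (- int a) 1 (factors a n :: 'k::field_char_0 fls)"
proof (induction a)
  case 0
  show ?case by (simp add: factors_def fls_lead_one)
next
  case (Suc a)
  have "2 * fls_const (1 / 2 :: 'k) = 1"
    unfolding mult_2 by (simp add: fls_plus_const)
  then have half: "(1 / 2 :: 'k fls) = fls_const (1 / 2)"
    by (metis nonzero_mult_div_cancel_left zero_neq_numeral)
  have "fls_lead (- 1) 1 (gamma - of_int (n + int a) - 1 / 2 :: 'k fls)"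
    by (simp add: fls_lead_def gamma_def half fls_of_int fls_const_nth del: of_int_add)
  from fls_lead_mult[OF Suc this]
  have "fls_lead (- int a + - 1) 1 (factors (Suc a) n :: 'k fls)" by (simp add: factors_def)
  moreover have "- int a + - 1 = - int (Suc a)" by simp
  ultimately show ?case by (simp only:)
qed

lemma app_op_x_power_nth:
  fixes g :: "'k::field_char_0 fls fls"
  shows "app (op_x ^ a) g $$ n = factors a n * g $$ (n + int a)"
proof (induction a arbitrary: n)
  case (Suc a)
  have "factors (Suc a) n = (gamma - of_int n - 1 / 2) * (factors a (n + 1) :: 'k fls)"
    unfolding factors_def by (subst prod.lessThan_Suc_shift) (simp add: add.assoc add.commute)
  moreover have "n + int (Suc a) = n + 1 + int a" by simp
  ultimately show ?case by (simp only: power_Suc app_ring_ops(6) app_op_x_nth Suc mult.assoc)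
qed (simp add: factors_def)

lemma app_op_y_power_nth: "app (op_y ^ b) g $$ n = g $$ (n - int b)"
  by (induction b arbitrary: n) (simp_all add: app_op_y_nth algebra_simps)

text \<open>The span of the ordered monomials is stable under left multiplication by x, y and z,
  hence a left ideal. As it contains 1, it is all of U(H).\<close>

lemma UH_mult_span_pbw:
  fixes u w :: "'k::field UH"
  defines "sp \<equiv> module.span (\<lambda>c u. UH_const c * u) (range pbw)"
  shows "w \<in> sp \<Longrightarrow> u * w \<in> sp"
proof -
  note e = UH_const_k_algebra[where 'k = 'k]
  interpret G: vector_space "\<lambda>c u. UH_const c * u :: 'k UH"
    by (rule k_algebra_vector_space[OF e])
  have sp: "sp = G.span (range pbw)" by (simp add: sp_def)
  have lift: "u * w \<in> sp" if "\<And>m. u * pbw m \<in> sp" "w \<in> sp" for u w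
    using that(2) unfolding sp
  proof (induction rule: G.span_induct_alt)
    case (step c b w)
    have "u * (UH_const c * b + w) = UH_const c * (u * b) + u * w"
      by (simp only: distrib_left mult.assoc[symmetric] k_algebra_commute[OF e, of c u])
    moreover have "u * b \<in> G.span (range pbw)" using step(1) that(1) unfolding sp by blast
    ultimately show ?case using G.span_add[OF G.span_scale step(2), of "u * b" c] by simp
  qed (simp add: G.span_zero)
  let ?x = "UH_of heis_x :: 'k UH" and ?y = "UH_of heis_y :: 'k UH" and ?z = "UH_of heis_z :: 'k UH"
  have yx: "?y * ?x = ?x * ?y + ?z"
    using UH_of_bracket[of "heis_y :: 'k heis" heis_x] by (simp add: heis_relations)
  have br0: "heis_bracket heis_z h = 0" for h :: "'k heis" by (simp add: heis_bracket_def heis_z_def zero_heis_def)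
  have UH0: "UH_of 0 = (0 :: 'k UH)" using UH_of_add[of 0 "0 :: 'k heis"] by simp
  have zh: "?z * UH_of h = UH_of h * ?z" for h
    using UH_of_bracket[of heis_z h] by (simp add: br0 UH0)
  have zpow: "UH_of h * ?z ^ c = ?z ^ c * UH_of h" for h c
    by (rule power_commuting_commutes[symmetric]) (rule zh)
  have "UH_const (of_nat n) = (of_nat n :: 'k UH)" for n
    by (induction n) (simp_all add: k_algebra_zero[OF e] k_algebra_one[OF e] k_algebra_add[OF e])
  then have of_nat: "of_nat n * u = UH_const (of_nat n) * u" for n and u :: "'k UH" by simp
  \<comment> \<open>For a = 0 the truncated exponent a - 1 does no harm, since its term carries the
    factor 0.\<close>
  have yxpow: "?y * ?x ^ a = ?x ^ a * ?y + of_nat a * (?z * ?x ^ (a - 1))" for a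
  proof (induction a)
    case (Suc a)
    have "?y * ?x ^ Suc a = ?x * (?y * ?x ^ a) + ?z * ?x ^ a"
      by (simp add: mult.assoc[symmetric] yx distrib_right)
    also have "\<dots> = ?x * (?x ^ a * ?y) + (?x * (of_nat a * (?z * ?x ^ (a - 1))) + ?z * ?x ^ a)"
      unfolding Suc by (simp only: distrib_left add.assoc)
    also have "?x * (of_nat a * (?z * ?x ^ (a - 1))) = of_nat a * (?z * ?x ^ a)"
    proof (cases a)
      case (Suc b)
      have "?x * (of_nat a * (?z * ?x ^ b)) = of_nat a * (?x * ?z * ?x ^ b)"
        by (simp only: mult.assoc[symmetric] mult_of_nat_commute[of a ?x])
      then show ?thesis by (simp add: Suc zh[symmetric] mult.assoc)
    qed simp
    finally show ?case by (simp add: algebra_simps)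
  qed simp
  have mem: "?z ^ c * ?x ^ a * ?y ^ b \<in> sp" for c a b
  proof -
    have "pbw (c, a, b) \<in> sp" unfolding sp by (intro G.span_base rangeI)
    then show ?thesis by (simp only: pbw_def prod.case)
  qed
  have x: "?x * pbw m \<in> sp" for m
  proof (cases m)
    case (fields c a b)
    then show ?thesis using mem[of c "Suc a" b] by (simp add: pbw_def mult.assoc[symmetric] zpow)
  qed
  have z: "?z * pbw m \<in> sp" for m
  proof (cases m)
    case (fields c a b)
    then show ?thesis using mem[of "Suc c" a b] by (simp add: pbw_def mult.assoc)
  qed
  have y: "?y * pbw m \<in> sp" for m
  proof (cases m)
    case (fields c a b)
    have "?y * pbw m = ?z ^ c * (?y * ?x ^ a) * ?y ^ b"
      by (simp add: fields pbw_def mult.assoc[symmetric] zpow)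
    also have "\<dots> = ?z ^ c * ?x ^ a * ?y ^ Suc b + ?z ^ c * (of_nat a * (?z * ?x ^ (a - 1))) * ?y ^ b"
      unfolding yxpow by (simp only: distrib_left distrib_right mult.assoc power_Suc)
    also have "?z ^ c * (of_nat a * (?z * ?x ^ (a - 1))) * ?y ^ b =
        UH_const (of_nat a) * (?z ^ Suc c * ?x ^ (a - 1) * ?y ^ b)"
      by (simp only: of_nat[symmetric] mult.assoc[symmetric] mult_of_nat_commute[of a "?z ^ c"] power_Suc2)
    finally show ?thesis
      using mem[of c a "Suc b"] mem[of "Suc c" "a - 1" b] by (simp only: sp G.span_add G.span_scale)
  qed
  have "\<forall>w. w \<in> sp \<longrightarrow> u * w \<in> sp" for u
  proof (induction u rule: UH_induct)
    case (const c)
    then show ?case unfolding sp by (simp add: G.span_scale)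
  next
    case (of_heis h)
    have h: "h = heis_scale (cx h) heis_x + heis_scale (cy h) heis_y + heis_scale (cz h) heis_z"
      by (cases h) (simp add: heis_ops heis_x_def heis_y_def heis_z_def)
    have "UH_of h * w = UH_const (cx h) * (?x * w) + UH_const (cy h) * (?y * w) + UH_const (cz h) * (?z * w)" for w
      by (subst h) (simp only: UH_of_add UH_of_scale distrib_right mult.assoc)
    moreover have "UH_const (cx h) * (?x * w) + UH_const (cy h) * (?y * w) + UH_const (cz h) * (?z * w) \<in> sp"
      if "w \<in> sp" for w
      using lift[OF x that] lift[OF y that] lift[OF z that] unfolding sp
      by (intro G.span_add G.span_scale)
    ultimately show ?case by simp
  next
    case (add u v)
    then show ?case unfolding sp by (simp add: distrib_right G.span_add)
  next
    case (mult u v)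
    then show ?case by (simp add: mult.assoc)
  qed
  then show "w \<in> sp \<Longrightarrow> u * w \<in> sp" by blast
qed

lemma UH_pbw_expansion:
  fixes u :: "'k::field UH"
  obtains T \<kappa> where "finite T" "u = (\<Sum>m\<in>T. UH_const (\<kappa> m) * pbw m)" "\<And>m. m \<in> T \<Longrightarrow> \<kappa> m \<noteq> 0"
proof -
  note e = UH_const_k_algebra[where 'k = 'k]
  interpret G: vector_space "\<lambda>c u. UH_const c * u :: 'k UH"
    by (rule k_algebra_vector_space[OF e])
  have "pbw (0, 0, 0) \<in> G.span (range pbw)" by (intro G.span_base rangeI)
  then have "1 \<in> G.span (range pbw :: 'k UH set)"
    by (simp only: pbw_def prod.case power_0 mult_1_left)
  from UH_mult_span_pbw[OF this, of u] have "u \<in> G.span (range pbw)" by simp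
  then obtain B r where B: "finite B" "B \<subseteq> range pbw" "u = (\<Sum>b\<in>B. UH_const (r b) * b)"
    by (auto simp: G.span_explicit)
  obtain T where T: "inj_on (pbw :: _ \<Rightarrow> 'k UH) T" "B = pbw ` T"
    using B(2) by (metis subset_image_inj)
  have fin: "finite T" using B(1) T finite_image_iff by blast
  have "u = (\<Sum>m\<in>T. UH_const (r (pbw m)) * pbw m)"
    unfolding B(3) T(2) by (simp add: sum.reindex[OF T(1)])
  also have "\<dots> = (\<Sum>m\<in>{m \<in> T. r (pbw m) \<noteq> 0}. UH_const (r (pbw m)) * pbw m)"
    by (rule sum.mono_neutral_right[OF fin]) (auto simp: k_algebra_zero[OF e])
  finally show ?thesis using fin by (intro that[of "{m \<in> T. r (pbw m) \<noteq> 0}" "\<lambda>m. r (pbw m)"]) auto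
qed

text \<open>
  The initial term of the image of a nonzero element: first the highest weight \<open>d c + a + (d - 1) b\<close>,
  then the largest shift \<open>a - b\<close>, and finally the largest \<open>a\<close>, which is the degree in \<open>gamma\<close>.
\<close>

lemma representation_regular:
  fixes \<rho> :: "'k::field_char_0 UH \<Rightarrow> 'k fls lend fls"
  assumes \<rho>: "k_algebra_hom UH_const scalar \<rho>" "\<rho> (UH_of heis_x) = series_x"
    "\<rho> (UH_of heis_y) = series_y" "\<rho> (UH_of heis_z) = series_z"
    and u: "u \<noteq> 0" and A: "\<rho> u * A = 0"
  shows "A = 0"
proof -
  note e = UH_const_k_algebra[where 'k = 'k]
  obtain T \<kappa> where T: "finite T" "u = (\<Sum>m\<in>T. UH_const (\<kappa> m) * pbw m)" "\<And>m. m \<in> T \<Longrightarrow> \<kappa> m \<noteq> 0"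
    by (rule UH_pbw_expansion[of u]) blast
  have Tne: "T \<noteq> {}" using u T(2) by auto
  define wt where "wt m = (case m of (c, a, b) \<Rightarrow> int (d * c) + int a + (int d - 1) * int b)" for m :: "nat \<times> nat \<times> nat"
  define sh where "sh m = (case m of (c, a, b) \<Rightarrow> int a - int b)" for m :: "nat \<times> nat \<times> nat"
  define xd where "xd m = (case m of (c, a, b) \<Rightarrow> a)" for m :: "nat \<times> nat \<times> nat"
  define opr where "opr m = (case m of (c, a, b) \<Rightarrow> (op_x ^ a * op_y ^ b :: 'k fls lend))" for m :: "nat \<times> nat \<times> nat"
  have pbw: "\<rho> (UH_const c * pbw m) = fls_monom (- wt m) (base_const c * opr m)" for c m
  proof (cases m)
    case (fields i a b)
    show ?thesis
      unfolding fields pbw_def wt_def opr_def prod.case k_algebra_hom_mult[OF \<rho>(1)] k_algebra_hom_const[OF \<rho>(1)]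
        k_algebra_hom_power[OF e k_algebra_scalar \<rho>(1)] \<rho>(2-4) scalar_def
        series_x_def series_y_def series_z_def fls_monom_power fls_monom_0[symmetric] fls_monom_mult
      by (simp add: algebra_simps)
  qed
  have \<rho>u: "\<rho> u = (\<Sum>m\<in>T. fls_monom (- wt m) (base_const (\<kappa> m) * opr m))"
    unfolding T(2) k_algebra_hom_sum[OF \<rho>(1)] pbw ..
  define N where "N = Max (wt ` T)"
  define T1 where "T1 = {m \<in> T. wt m = N}"
  define B where "B = (\<Sum>m\<in>T1. base_const (\<kappa> m) * opr m)"
  have wtN: "wt m \<le> N" if "m \<in> T" for m unfolding N_def using T(1) that by (intro Max_ge) auto
  have "N \<in> wt ` T" unfolding N_def using T(1) Tne by (intro Max_in) auto
  then have T1: "finite T1" "T1 \<noteq> {}" using T(1) by (auto simp: T1_def)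
  have lead: "fls_lead (- N) B (\<rho> u)"
  proof -
    have "(\<rho> u) $$ i = 0" if "i < - N" for i
      unfolding \<rho>u fls_nth_sum using wtN that by (intro sum.neutral) force
    moreover have "(\<rho> u) $$ (- N) = B"
      unfolding \<rho>u fls_nth_sum B_def T1_def
      using T(1) by (intro sum.mono_neutral_cong_right) auto
    ultimately show ?thesis by (simp add: fls_lead_def)
  qed
  define D where "D = Max (sh ` T1)"
  define T2 where "T2 = {m \<in> T1. sh m = D}"
  have shD: "sh m \<le> D" if "m \<in> T1" for m unfolding D_def using T1(1) that by (intro Max_ge) auto
  have "D \<in> sh ` T1" unfolding D_def using T1 by (intro Max_in) auto
  then have T2: "finite T2" "T2 \<noteq> {}" using T1(1) by (auto simp: T2_def)
  \<comment> \<open>Shift and power of x determine the power of y; the weight then determines the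
    power of z because d > 0.\<close>
  have xd_inj: "m = m'" if "m \<in> T2" "m' \<in> T2" "xd m = xd m'" for m m'
  proof -
    obtain c a b c' a' b' where m: "m = (c, a, b)" "m' = (c', a', b')" by (cases m; cases m')
    have "a = a'" "b = b'" using that by (auto simp: m xd_def T2_def sh_def)
    moreover have "wt m = wt m'" using that by (simp add: T2_def T1_def)
    ultimately show ?thesis using d by (simp add: m wt_def)
  qed
  have B_inj: "g = 0" if "app B g = 0" for g
  proof (rule ccontr)
    assume g: "g \<noteq> 0"
    define n where "n = fls_subdegree g"
    have gn: "g $$ n \<noteq> 0" and below: "\<And>i. i < n \<Longrightarrow> g $$ i = 0"
      using g by (auto simp: n_def)
    \<comment> \<open>A monomial of shift s carries the coefficient of g at i to the place i - s. At
      n - D the lowest coefficient of g is therefore reached exactly by the monomials of maximal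
      shift D, and smaller shifts meet only zeros.\<close>
    have nth: "app (base_const (\<kappa> m) * opr m) g $$ (n - D) =
        fls_const (\<kappa> m) * (factors (xd m) (n - D) * g $$ (n - D + sh m))" for m
      by (cases m) (simp add: base_const_def opr_def xd_def sh_def app_op_x_power_nth app_op_y_power_nth algebra_simps)
    have "0 = app B g $$ (n - D)" using that by simp
    also have "\<dots> = (\<Sum>m\<in>T1. fls_const (\<kappa> m) * (factors (xd m) (n - D) * g $$ (n - D + sh m)))"
      by (simp only: B_def app_sum fls_nth_sum nth)
    also have "\<dots> = (\<Sum>m\<in>T2. fls_const (\<kappa> m) * (factors (xd m) (n - D) * g $$ n))"
    proof (rule sum.mono_neutral_cong_right[OF T1(1)])
      show "\<forall>m\<in>T1 - T2. fls_const (\<kappa> m) * (factors (xd m) (n - D) * g $$ (n - D + sh m)) = 0"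
        using shD by (force simp: T2_def intro: below)
    qed (auto simp: T2_def)
    also have "\<dots> = (\<Sum>m\<in>T2. fls_const (\<kappa> m) * factors (xd m) (n - D)) * g $$ n"
      by (simp add: sum_distrib_right mult.assoc)
    finally have 0: "(\<Sum>m\<in>T2. fls_const (\<kappa> m) * factors (xd m) (n - D)) = 0" using gn by simp
    have "Max (xd ` T2) \<in> xd ` T2" using T2 by (intro Max_in) auto
    \<comment> \<open>The monomial with the highest power of x is the only one to contribute to the
      highest power of \<open>gamma\<close>.\<close>
    then obtain m0 where m0: "m0 \<in> T2" "xd m0 = Max (xd ` T2)" by auto
    have le: "xd m \<le> xd m0" if "m \<in> T2" for m unfolding m0(2) using T2(1) that by (intro Max_ge) auto
    have "0 = (\<Sum>m\<in>T2. fls_const (\<kappa> m) * factors (xd m) (n - D)) $$ (- int (xd m0))" by (simp add: 0)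
    also have "\<dots> = (\<Sum>m\<in>T2. if m = m0 then \<kappa> m else 0)"
      unfolding fls_nth_sum
    proof (rule sum.cong[OF refl])
      fix m assume m: "m \<in> T2"
      show "(fls_const (\<kappa> m) * factors (xd m) (n - D)) $$ (- int (xd m0)) = (if m = m0 then \<kappa> m else 0)"
      proof (cases "m = m0")
        case False
        then have "xd m < xd m0" using le[OF m] xd_inj[OF m m0(1)] by fastforce
        then show ?thesis using False fls_lead_factors[of "xd m" "n - D", where 'k = 'k] by (simp add: fls_lead_def)
      qed (use fls_lead_factors[of "xd m" "n - D", where 'k = 'k] in \<open>simp add: fls_lead_def\<close>)
    qed
    also have "\<dots> = \<kappa> m0" using T2(1) m0(1) by simp
    finally show False using T(3)[of m0] m0(1) by (simp add: T2_def T1_def)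
  qed
  show "A = 0"
  proof (rule ccontr)
    assume "A \<noteq> 0"
    define m where "m = fls_subdegree A"
    have "fls_lead m (A $$ m) A" by (simp add: fls_lead_def m_def)
    from fls_lead_mult[OF lead this] have "B * A $$ m = 0" by (simp add: A fls_lead_def)
    then have "app B (app (A $$ m) g) = 0" for g by (simp flip: app_ring_ops(6))
    then have "A $$ m = 0" using B_inj by (intro lend_eqI) simp
    then show False using \<open>A \<noteq> 0\<close> by (simp add: m_def)
  qed
qed

lemma representation_exists:
  obtains \<rho> :: "'k::field_char_0 UH \<Rightarrow> 'k fls lend fls" where
    "k_algebra_hom UH_const scalar \<rho>" "\<rho> (UH_of heis_x) = series_x" "\<rho> (UH_of heis_y) = series_y"
    "\<And>u A. u \<noteq> 0 \<Longrightarrow> \<rho> u * A = 0 \<Longrightarrow> A = 0"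
proof -
  note e = k_algebra_scalar[where 'k = 'k]
  define F where "F h = scalar (cx h) * series_x + scalar (cy h) * series_y + scalar (cz h) * series_z"
    for h :: "'k heis"
  have mul: "(scalar p * a) * (scalar q * b) = scalar (p * q) * (a * b)" for p q :: 'k and a b
  proof -
    have "(scalar p * a) * (scalar q * b) = scalar p * (a * scalar q) * b" by (simp only: mult.assoc)
    also have "a * scalar q = scalar q * a" by (rule k_algebra_commute[OF e, symmetric])
    finally show ?thesis by (simp only: mult.assoc k_algebra_mult[OF e])
  qed
  have yx: "series_y * series_x = series_x * series_y + series_z"
    using series_commutator by (simp add: algebra_simps)
  have diff: "scalar (p - q) = scalar p - scalar q" for p q :: 'k
    using k_algebra_add[OF e, of "p - q" q] by simp
  have "\<exists>!\<phi>. k_algebra_hom UH_const scalar \<phi> \<and> (\<forall>h. \<phi> (UH_of h) = F h)"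
  proof (rule UH_universal_property[OF e])
    fix g h :: "'k heis" and r
    show "F (g + h) = F g + F h"
      by (simp add: F_def plus_heis_def k_algebra_add[OF e] distrib_right)
    show "F (heis_scale r g) = scalar r * F g"
      by (simp add: F_def heis_scale_def k_algebra_mult[OF e] distrib_left mult.assoc)
    show "F (heis_bracket g h) = F g * F h - F h * F g"
    proof -
      have "F g * F h - F h * F g = scalar (cy g * cx h) * series_z - scalar (cx g * cy h) * series_z"
        by (simp only: F_def distrib_left distrib_right mul yx series_z_central mult.commute[of "cx h"]
            mult.commute[of "cy h"] mult.commute[of "cz h"]) (simp add: algebra_simps)
      then show ?thesis by (simp add: F_def heis_bracket_def k_algebra_zero[OF e] diff left_diff_distrib)
    qed
  qed
  then obtain \<rho> where \<rho>: "k_algebra_hom UH_const scalar \<rho>" "\<And>h. \<rho> (UH_of h) = F h" by blast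
  have "\<rho> (UH_of heis_x) = series_x" "\<rho> (UH_of heis_y) = series_y" "\<rho> (UH_of heis_z) = series_z"
    by (simp_all add: \<rho>(2) F_def heis_x_def heis_y_def heis_z_def k_algebra_one[OF e] k_algebra_zero[OF e])
  then show ?thesis using that[of \<rho>] \<rho>(1) representation_regular[of \<rho>] by blast
qed

end

section \<open>Transfer of freeness to the division ring of fractions\<close>

lemma involution_ext_extends:
  assumes "ore_division_ring_of_fractions j" "k_involution heis_scale heis_bracket \<eta>"
  shows "extends_involution j \<eta> (involution_ext j \<eta>)"
  unfolding involution_ext_def by (rule theI'[OF extends_involution_ex1[OF assms]])

text \<open>\<open>regular\<close> is all that is required of \<rho>: the values at nonzero elements
  need not be known to be invertible.\<close>

locale fractions =
  fixes j :: "'k::field_char_0 UH \<Rightarrow> 'd::division_ring" and \<rho> :: "'k UH \<Rightarrow> 'r::ring_1" and e' :: "'k \<Rightarrow> 'r"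
  assumes ore: "ore_division_ring_of_fractions j" and e': "k_algebra e'"
    and \<rho>: "k_algebra_hom UH_const e' \<rho>" and regular: "\<And>u A. u \<noteq> 0 \<Longrightarrow> \<rho> u * A = 0 \<Longrightarrow> A = 0"
begin

lemma j_ring: "j 1 = 1" "j (u + v) = j u + j v" "j (u * v) = j u * j v" "inj j"
  and right_fraction: "\<exists>u v. v \<noteq> 0 \<and> d = j u * inverse (j v)"
  using ore unfolding ore_division_ring_of_fractions_def by blast+

lemma j_0: "j 0 = 0"
  using j_ring(2)[of 0 0] by simp

lemma j_eq_0_iff: "j u = 0 \<longleftrightarrow> u = 0"
  using j_ring(4) j_0 by (metis injD)

lemma j_diff: "j (u - v) = j u - j v"
  using j_ring(2)[of "u - v" v] by simp

text \<open>The definition supplies right fractions. An anti-automorphism preserving the image of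
  U(H) turns them into left fractions; the extension of \<open>eta2\<close> is such a map.\<close>

lemma left_fraction: "\<exists>u v. v \<noteq> 0 \<and> j v * d = j u"
proof -
  define star where "star = involution_ext j eta2"
  have star: "star (a + b) = star a + star b" "star (j (UH_const c) * a) = j (UH_const c) * star a"
    "star (a * b) = star b * star a" "star (star a) = a" "star (j (UH_of h)) = j (UH_of (eta2 h))" for a b c h
    using involution_ext_extends[OF ore k_involution_etas(2)]
    unfolding star_def extends_involution_def by blast+
  have star1: "star 1 = 1" by (metis star(3,4) mult_1_left mult_1_right)
  have star0: "star 0 = 0" using star(1)[of 0 0] by simp
  have range: "\<exists>v. star (j u) = j v" for u
  proof (induction u rule: UH_induct)
    case (const c)
    show ?case using star(2)[of c 1] by (auto simp: star1)
  next
    case (of_heis h)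
    show ?case using star(5) by blast
  next
    case (add u v)
    then show ?case by (metis j_ring(2) star(1))
  next
    case (mult u v)
    then show ?case by (metis j_ring(3) star(3))
  qed
  obtain u v where uv: "v \<noteq> 0" "star d = j u * inverse (j v)" using right_fraction by blast
  then have "star d * j v = j u" by (simp add: mult.assoc j_eq_0_iff)
  then have "star (j v) * d = star (j u)" by (metis star(3,4))
  moreover have "star (j v) \<noteq> 0" using uv(1) by (metis star(4) star0 j_eq_0_iff)
  ultimately show ?thesis using range[of u] range[of v] by (metis j_0)
qed

lemma left_ore:
  fixes b c :: "'k UH"
  assumes "b \<noteq> 0"
  obtains p q where "p \<noteq> 0" "p * c = q * b"
proof -
  obtain p q where pq: "p \<noteq> 0" "j p * (j c * inverse (j b)) = j q" using left_fraction by blast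
  have "j p * j c = j p * (j c * inverse (j b)) * j b" using assms by (simp add: mult.assoc j_eq_0_iff)
  then have "j (p * c) = j (q * b)" unfolding pq(2) j_ring(3) .
  then have "p * c = q * b" using j_ring(4) by (rule injD[rotated])
  then show ?thesis using that pq(1) by blast
qed

lemma no_zero_divisors: "u \<noteq> 0 \<Longrightarrow> (v :: 'k UH) \<noteq> 0 \<Longrightarrow> u * v \<noteq> 0"
  by (metis j_eq_0_iff j_ring(3) mult_eq_0_iff)

lemmas \<rho>_simps = k_algebra_hom_add[OF \<rho>] k_algebra_hom_mult[OF \<rho>] k_algebra_hom_zero[OF \<rho>]
  k_algebra_hom_one[OF UH_const_k_algebra e' \<rho>] k_algebra_hom_const[OF \<rho>] k_algebra_hom_uminus[OF \<rho>]

text \<open>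
  The graph of the partial extension of \<open>\<rho>\<close> to fractions; it is single-valued because the values of \<open>\<rho>\<close>
  at nonzero elements are left regular.
\<close>

definition rel :: "'d \<Rightarrow> 'r \<Rightarrow> bool" where
  "rel a A \<longleftrightarrow> (\<exists>u v. v \<noteq> 0 \<and> j v * a = j u \<and> \<rho> v * A = \<rho> u)"

lemma relI: "v \<noteq> 0 \<Longrightarrow> j v * a = j u \<Longrightarrow> \<rho> v * A = \<rho> u \<Longrightarrow> rel a A"
  unfolding rel_def by blast

lemma rel_j: "rel (j u) (\<rho> u)"
  by (rule relI[of 1]) (simp_all add: j_ring \<rho>_simps)

lemma rel_zero: "rel 0 0"
  using rel_j[of 0] by (simp add: j_0 \<rho>_simps)

lemma rel_const: "rel (j (UH_const c)) (e' c)"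
  using rel_j[of "UH_const c"] by (simp add: \<rho>_simps)

lemma rel_add:
  assumes "rel a A" "rel b B"
  shows "rel (a + b) (A + B)"
proof -
  obtain u v where 1: "v \<noteq> 0" "j v * a = j u" "\<rho> v * A = \<rho> u" using assms(1) unfolding rel_def by blast
  obtain u' v' where 2: "v' \<noteq> 0" "j v' * b = j u'" "\<rho> v' * B = \<rho> u'" using assms(2) unfolding rel_def by blast
  obtain p q where pq: "p \<noteq> 0" "p * v = q * v'" using left_ore[OF 2(1)] by metis
  show ?thesis
  proof (rule relI[OF no_zero_divisors[OF pq(1) 1(1)]])
    have "j (p * v) * a = j p * j u" "j (p * v) * b = j q * j u'"
      by (simp add: j_ring mult.assoc 1, simp add: pq(2) j_ring mult.assoc 2)
    then show "j (p * v) * (a + b) = j (p * u + q * u')" by (simp add: distrib_left j_ring)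
    have "\<rho> (p * v) * A = \<rho> p * \<rho> u" "\<rho> (p * v) * B = \<rho> q * \<rho> u'"
      by (simp add: \<rho>_simps mult.assoc 1, simp add: pq(2) \<rho>_simps mult.assoc 2)
    then show "\<rho> (p * v) * (A + B) = \<rho> (p * u + q * u')" by (simp add: distrib_left \<rho>_simps)
  qed
qed

text \<open>The product of v^(-1) u and v'^(-1) u' is (p v)^(-1) (q u') once p u = q v', and the
  same calculation holds on the side of \<rho>.\<close>

lemma rel_mult:
  assumes "rel a A" "rel b B"
  shows "rel (a * b) (A * B)"
proof -
  obtain u v where 1: "v \<noteq> 0" "j v * a = j u" "\<rho> v * A = \<rho> u" using assms(1) unfolding rel_def by blast
  obtain u' v' where 2: "v' \<noteq> 0" "j v' * b = j u'" "\<rho> v' * B = \<rho> u'" using assms(2) unfolding rel_def by blast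
  obtain p q where pq: "p \<noteq> 0" "p * u = q * v'" using left_ore[OF 2(1)] by metis
  show ?thesis
  proof (rule relI[OF no_zero_divisors[OF pq(1) 1(1)]])
    have "j (p * v) * (a * b) = j p * (j v * a) * b" by (simp add: j_ring mult.assoc)
    also have "\<dots> = j (p * u) * b" by (simp add: 1 j_ring)
    also have "\<dots> = j (q * u')" by (simp add: pq(2) j_ring mult.assoc 2)
    finally show "j (p * v) * (a * b) = j (q * u')" .
    have "\<rho> (p * v) * (A * B) = \<rho> p * (\<rho> v * A) * B" by (simp add: \<rho>_simps mult.assoc)
    also have "\<dots> = \<rho> (p * u) * B" by (simp add: 1 \<rho>_simps)
    also have "\<dots> = \<rho> (q * u')" by (simp add: pq(2) \<rho>_simps mult.assoc 2)
    finally show "\<rho> (p * v) * (A * B) = \<rho> (q * u')" .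
  qed
qed

lemma rel_minus: "rel a A \<Longrightarrow> rel b B \<Longrightarrow> rel (a - b) (A - B)"
proof -
  have "j (- 1) = - 1" using j_diff[of 0 1] by (simp add: j_0 j_ring)
  then have "rel (- 1) (- 1)" using rel_j[of "- 1"] by (simp add: \<rho>_simps)
  then show "rel a A \<Longrightarrow> rel b B \<Longrightarrow> rel (a - b) (A - B)"
    using rel_add[of a A "- 1 * b" "- 1 * B"] rel_mult[of "- 1" "- 1" b B] by simp
qed

lemma rel_one: "rel 1 1"
  using rel_j[of 1] by (simp add: j_ring \<rho>_simps)

lemma rel_power: "rel a A \<Longrightarrow> rel (a ^ n) (A ^ n)"
  by (induction n) (simp_all add: rel_one rel_mult)

text \<open>Regularity enters here. Since \<open>rel\<close> is compatible with the ring operations,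
  a relation between fractions forces the corresponding expression in the target ring to be
  0.\<close>

lemma rel_0D:
  assumes "rel 0 A"
  shows "A = 0"
proof -
  obtain u v where "v \<noteq> 0" "j v * 0 = j u" "\<rho> v * A = \<rho> u" using assms unfolding rel_def by blast
  then show ?thesis using regular[of v A] j_eq_0_iff[of u] by (simp add: \<rho>_simps)
qed

text \<open>Numerator and denominator exchange their roles. The numerator is nonzero, as otherwise 0
  would be related to A and A would vanish.\<close>

lemma rel_inverse:
  assumes "rel a A" "A * A' = 1"
  shows "a \<noteq> 0" "rel (inverse a) A'"
proof -
  obtain u v where 1: "v \<noteq> 0" "j v * a = j u" "\<rho> v * A = \<rho> u" using assms(1) unfolding rel_def by blast
  have "(1 :: 'r) \<noteq> 0" by simp
  then show a: "a \<noteq> 0" using rel_0D assms by (metis mult_zero_left)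
  then have "u \<noteq> 0" using 1 by (metis j_0 j_eq_0_iff mult_eq_0_iff)
  then show "rel (inverse a) A'"
  proof (rule relI)
    show "j u * inverse a = j v" unfolding 1(2)[symmetric] using a by (simp add: mult.assoc)
    show "\<rho> u * A' = \<rho> v" unfolding 1(3)[symmetric] by (simp add: mult.assoc assms(2))
  qed
qed

lemma k_algebra_fractions: "k_algebra (\<lambda>c. j (UH_const c))"
  unfolding k_algebra_def
proof (intro conjI allI)
  note e = UH_const_k_algebra
  fix c d and a :: 'd
  show "j (UH_const 1) = 1" "j (UH_const (c + d)) = j (UH_const c) + j (UH_const d)"
    "j (UH_const (c * d)) = j (UH_const c) * j (UH_const d)"
    by (simp_all add: k_algebra_one[OF e] k_algebra_add[OF e] k_algebra_mult[OF e] j_ring)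
  have comm: "j (UH_const c) * j u = j u * j (UH_const c)" for u
    using k_algebra_commute[OF e, of c u] by (metis j_ring(3))
  obtain u v where uv: "v \<noteq> 0" "j v * a = j u" using left_fraction by blast
  have "j v * (j (UH_const c) * a) = j (UH_const c) * (j v * a)"
    by (simp only: mult.assoc[symmetric] comm)
  also have "\<dots> = j v * (a * j (UH_const c))"
    unfolding uv(2) comm unfolding uv(2)[symmetric] mult.assoc ..
  finally show "j (UH_const c) * a = a * j (UH_const c)" using uv(1) by (simp add: j_eq_0_iff)
qed

lemma rel_sum: "(\<And>i. i \<in> I \<Longrightarrow> rel (f i) (F i)) \<Longrightarrow> rel (sum f I) (sum F I)"
  by (induction I rule: infinite_finite_induct) (simp_all add: rel_zero rel_add)

lemma transfer_free_algebra:
  assumes "is_free_algebra_on e' A' B'" "rel A A'" "rel B B'"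
  shows "is_free_algebra_on (\<lambda>c. j (UH_const c)) A B"
  unfolding is_free_algebra_on_iff[OF k_algebra_fractions]
proof (intro allI impI)
  fix p :: "letter free_monoid \<Rightarrow>\<^sub>0 'k"
  assume 0: "(\<Sum>g\<in>Poly_Mapping.keys p. j (UH_const (Poly_Mapping.lookup p g)) * monoid_val (letter_case A B) g) = 0"
  have "rel (prod_list (map (letter_case A B) l)) (prod_list (map (letter_case A' B') l))" for l
  proof (induction l)
    case (Cons c l)
    then show ?case using assms(2,3) by (cases c) (simp_all add: rel_mult)
  qed (simp add: rel_one)
  then have "rel (monoid_val (letter_case A B) g) (monoid_val (letter_case A' B') g)" for g
    by (cases g) simp
  then have "rel (\<Sum>g\<in>Poly_Mapping.keys p. j (UH_const (Poly_Mapping.lookup p g)) * monoid_val (letter_case A B) g)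
      (\<Sum>g\<in>Poly_Mapping.keys p. e' (Poly_Mapping.lookup p g) * monoid_val (letter_case A' B') g)"
    by (intro rel_sum rel_mult rel_const)
  then show "p = 0" using assms(1) unfolding 0 is_free_algebra_on_iff[OF e'] by (blast dest: rel_0D)
qed

lemma transfer_free_group_algebra:
  assumes "is_free_group_algebra_on e' A' B'" "rel A A'" "rel B B'"
  shows "is_free_group_algebra_on (\<lambda>c. j (UH_const c)) A B"
proof -
  obtain \<phi> where \<phi>: "k_algebra_hom (Poly_Mapping.single 0) e' \<phi>" "inj \<phi>"
    "\<phi> (Poly_Mapping.single (fg_gen La) 1) = A'" "\<phi> (Poly_Mapping.single (fg_gen Lb) 1) = B'"
    using assms(1) unfolding is_free_group_algebra_on_def by (elim exE conjE)
  let ?e = "\<lambda>c. j (UH_const c)"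
  note e = k_algebra_fractions
  note \<phi>1 = k_algebra_hom_one[OF k_algebra_monoid_algebra e' \<phi>(1)]
  have gens: "rel (letter_case A B c) (\<phi> (Poly_Mapping.single (fg_gen c) 1))" for c
    using assms(2,3) \<phi>(3,4) by (cases c) simp_all
  have invs: "\<phi> (Poly_Mapping.single (fg_gen c) 1) * \<phi> (Poly_Mapping.single (- fg_gen c) 1) = 1" for c
    by (simp add: k_algebra_hom_mult[OF \<phi>(1), symmetric] mult_single \<phi>1)
  \<comment> \<open>Invertibility of the images makes A and B nonzero, so that the free group acts
    by units of the division ring.\<close>
  note ne = rel_inverse(1)[OF gens invs]
  obtain m where m: "\<And>g h. m (g + h) = m g * m h" "m 0 = 1" "\<And>c. m (fg_gen c) = letter_case A B c"
    "\<And>c. m (- fg_gen c) = inverse (letter_case A B c)"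
    using free_group_hom_exists[of "letter_case A B" "\<lambda>c. inverse (letter_case A B c)"] ne
    by (metis left_inverse right_inverse)
  have mul: "\<phi> (Poly_Mapping.single (g + h) 1) = \<phi> (Poly_Mapping.single g 1) * \<phi> (Poly_Mapping.single h 1)" for g h
    by (simp add: k_algebra_hom_mult[OF \<phi>(1), symmetric] mult_single)
  have rel_m: "rel (m g) (\<phi> (Poly_Mapping.single g 1))" for g
  proof (induction g rule: free_group_induct)
    case zero
    show ?case using rel_one by (simp add: m(2) \<phi>1)
  next
    case (gen c g)
    show ?case using rel_mult[OF gens[of c] gen] by (simp add: mul m)
  next
    case (inv c g)
    show ?case
      using rel_mult[OF rel_inverse(2)[OF gens invs, of c] inv] by (simp add: mul m)
  qed
  note hom = k_algebra_hom_meval[of ?e m, OF e m(1,2)]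
  have rel_\<phi>: "rel (meval ?e m p) (\<phi> p)" for p
  proof (induction p rule: poly_mapping_single_induct)
    case zero
    show ?case using rel_zero by (simp add: k_algebra_hom_zero[OF hom] k_algebra_hom_zero[OF \<phi>(1)])
  next
    case (add p g c)
    have "Poly_Mapping.single g c = Poly_Mapping.single 0 c * Poly_Mapping.single g 1" by (simp add: mult_single)
    then have "\<phi> (Poly_Mapping.single g c) = e' c * \<phi> (Poly_Mapping.single g 1)"
      by (simp only: k_algebra_hom_mult[OF \<phi>(1)] k_algebra_hom_const[OF \<phi>(1)])
    then show ?case
      using rel_add[OF rel_mult[OF rel_const rel_m] add, of c g]
      by (simp add: k_algebra_hom_add[OF hom] k_algebra_hom_add[OF \<phi>(1)] meval_single[OF e])
  qed
  have "inj (meval ?e m)"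
  proof (rule k_algebra_hom_inj[OF hom])
    fix p assume "meval ?e m p = 0"
    then have "\<phi> p = \<phi> 0" using rel_\<phi>[of p] by (simp add: rel_0D k_algebra_hom_zero[OF \<phi>(1)])
    then show "p = 0" by (rule injD[OF \<phi>(2)])
  qed
  then show ?thesis
    by (rule is_free_group_algebra_onI[OF hom])
       (simp_all add: meval_single[OF e] m k_algebra_one[OF e])
qed

end

section \<open>Symmetric elements\<close>

context
  fixes j :: "'k::field_char_0 UH \<Rightarrow> 'd::division_ring" and \<eta> :: "'k heis \<Rightarrow> 'k heis"
  assumes ore: "ore_division_ring_of_fractions j" and \<eta>: "k_involution heis_scale heis_bracket \<eta>"
begin

abbreviation (input) star :: "'d \<Rightarrow> 'd" where "star \<equiv> involution_ext j \<eta>"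

lemma star_add: "star (a + b) = star a + star b"
  and star_scale: "star (j (UH_const c) * a) = j (UH_const c) * star a"
  and star_mult: "star (a * b) = star b * star a"
  and star_star: "star (star a) = a"
  and star_of_heis: "star (j (UH_of h)) = j (UH_of (\<eta> h))"
  using involution_ext_extends[OF ore \<eta>] unfolding extends_involution_def by blast+

lemma star_one: "star 1 = 1"
  by (metis star_mult star_star mult_1_left mult_1_right)

lemma star_diff: "star (a - b) = star a - star b"
  using star_add[of "a - b" b] by simp

lemma star_zero: "star 0 = 0"
  using star_diff[of 0 0] by simp

lemma star_inverse: "star (inverse a) = inverse (star a)"
proof (cases "a = 0")
  case False
  then have "star a * star (inverse a) = 1" by (simp add: star_mult[symmetric] star_one)
  then show ?thesis by (metis inverse_unique)
qed (simp add: star_zero)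

lemma star_power: "star (a ^ n) = star a ^ n"
  by (induction n) (simp_all add: star_one star_mult power_commutes)

text \<open>Exchanging p and q exchanges the two summands once the factors have been reversed; a
  common sign cancels in each quotient.\<close>

lemma symmetric_quotient_sum:
  assumes star: "star p = q \<and> star q = p \<or> star p = - q \<and> star q = - p"
  shows "star (p * inverse q + inverse p * q) = p * inverse q + inverse p * q"
proof -
  have "star (p * inverse q + inverse p * q) = inverse p * q + p * inverse q"
    using star by (auto simp: star_add star_mult star_inverse)
  then show ?thesis by (simp add: add.commute)
qed

text \<open>All factors in a and in b commute neither with s nor in general with each other, but
  reversal followed by the exchange of a and b restores the product literally. This accounts for the
  order a^(-1) b s a b^(-1).\<close>

lemma symmetric_conjugate:
  assumes "star s = s" and star: "star a = b \<and> star b = a \<or> star a = - b \<and> star b = - a"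
  shows "star (inverse a * b * s * a * inverse b) = inverse a * b * s * a * inverse b"
  using assms by (auto simp: star_mult star_inverse mult.assoc)

text \<open>The two signs treat the three involutions at once. With equal signs z is negated and V
  fixed, with different signs z is fixed and V negated; in both cases p and q are exchanged up to
  sign.\<close>

lemma symmetric_heisenberg:
  fixes x y :: 'd and \<epsilon>x \<epsilon>y :: bool
  defines "z \<equiv> y * x - x * y" and "V \<equiv> j (UH_const (1/2)) * (x * y + y * x)"
  defines "p \<equiv> V - j (UH_const (1/3)) * z" and "q \<equiv> V + j (UH_const (1/3)) * z"
  assumes x: "star x = (if \<epsilon>x then x else - x)" and y: "star y = (if \<epsilon>y then y else - y)"
  shows "star z = (if \<epsilon>x = \<epsilon>y then - z else z)"
    and "star (inverse z * (p * inverse q + inverse p * q) * inverse z) =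
      inverse z * (p * inverse q + inverse p * q) * inverse z" (is ?S1)
    and "star (z * (p * inverse q + inverse p * q) * z) = z * (p * inverse q + inverse p * q) * z" (is ?S2)
proof -
  show z: "star z = (if \<epsilon>x = \<epsilon>y then - z else z)"
    by (simp add: z_def star_diff star_mult x y)
  have V: "star V = (if \<epsilon>x = \<epsilon>y then V else - V)"
    unfolding V_def star_scale by (simp add: star_add star_mult x y algebra_simps)
  have "star p = q \<and> star q = p \<or> star p = - q \<and> star q = - p"
    by (simp add: p_def q_def star_add star_diff star_scale V z)
  from symmetric_quotient_sum[OF this] show ?S1 ?S2
    by (simp_all add: star_mult star_inverse z mult.assoc)
qed

end

section \<open>Freeness in the series ring and in the division ring\<close>

text \<open>Words of length n land in the exponent n i of t. Because i is nonzero, a relation splits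
  into its parts of fixed length, which are relations between w and w'.\<close>

lemma is_free_algebra_on_monom:
  fixes w w' :: "'k::field fls lend"
  assumes free: "is_free_algebra_on base_const w w'" and i: "i \<noteq> 0"
  shows "is_free_algebra_on scalar (fls_monom i w) (fls_monom i w')"
  unfolding is_free_algebra_on_iff[OF k_algebra_scalar]
proof (intro allI impI)
  fix p :: "letter free_monoid \<Rightarrow>\<^sub>0 'k"
  let ?K = "Poly_Mapping.keys p"
  assume rel: "(\<Sum>g\<in>?K. scalar (Poly_Mapping.lookup p g) *
    monoid_val (letter_case (fls_monom i w) (fls_monom i w')) g) = 0"
  define word where "word g = (case g of Word l \<Rightarrow> l)" for g :: "letter free_monoid"
  have val: "monoid_val (letter_case (fls_monom i w) (fls_monom i w')) g =
      fls_monom (int (length (word g)) * i) (prod_list (map (letter_case w w') (word g)))" for g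
  proof -
    have "prod_list (map (letter_case (fls_monom i w) (fls_monom i w')) l) =
        fls_monom (int (length l) * i) (prod_list (map (letter_case w w') l))" for l
    proof (induction l)
      case (Cons c l)
      have "letter_case (fls_monom i w) (fls_monom i w') c = fls_monom i (letter_case w w' c)" by (cases c) simp_all
      then show ?case using Cons by (simp add: fls_monom_mult algebra_simps)
    qed (simp add: fls_monom_0)
    then show ?thesis by (cases g) (simp add: word_def)
  qed
  have "Poly_Mapping.lookup p g = 0" if g: "g \<in> ?K" for g
  proof -
    define n where "n = length (word g)"
    have "(\<Sum>h\<in>?K. scalar (Poly_Mapping.lookup p h) * monoid_val (letter_case (fls_monom i w) (fls_monom i w')) h)
        $$ (int n * i) = 0" unfolding rel by simp
    then have "(\<Sum>h\<in>?K. if length (word h) = n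
        then base_const (Poly_Mapping.lookup p h) * prod_list (map (letter_case w w') (word h)) else 0) = 0"
      using i by (simp add: fls_nth_sum val scalar_def if_distrib[of "\<lambda>x. _ * x"] eq_commute[of n] cong: if_cong)
    then have "(\<Sum>h\<in>{h \<in> ?K. length (word h) = n}.
        base_const (Poly_Mapping.lookup p h) * prod_list (map (letter_case w w') (word h))) = 0"
      by (simp add: sum.If_cases Int_def)
    moreover have "inj_on word A" for A
      by (rule inj_onI) (auto simp: word_def split: free_monoid.splits)
    ultimately show ?thesis
      using g by (intro free_algebra_indep[OF k_algebra_base_const free, of "{h \<in> ?K. length (word h) = n}" word])
        (simp_all add: n_def)
  qed
  then have "Poly_Mapping.lookup p g = 0" for g using not_in_keys_iff_lookup_eq_zero[of g p] by blast
  then show "p = 0" by (intro poly_mapping_eqI) simp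
qed

lemma third_not_int: "2 * fls_const (1 / 3) \<noteq> (of_int n :: 'k::field_char_0 fls)"
proof
  assume "2 * fls_const (1 / 3) = (of_int n :: 'k fls)"
  then have "(2 * fls_const (1 / 3) :: 'k fls) $$ 0 = of_int n $$ 0" by simp
  then have "1 / 3 + 1 / 3 = (of_int n :: 'k)" unfolding mult_2 by (simp add: fls_of_int_nth)
  then have "of_int 2 = (of_int (n * 3) :: 'k)" by (simp add: field_simps)
  then have "2 = n * 3" by (simp only: of_int_eq_iff)
  then show False by presburger
qed

text \<open>\<open>gamma\<close> has a pole in its own variable and so differs from every constant;
  the remaining condition is that 2/3 is not an integer.\<close>

lemma polar_words_gamma:
  assumes "d > 0"
  shows "polar_words d (gamma :: 'k::field_char_0 fls) (fls_const (1 / 3))"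
proof
  show "gamma + fls_const (1 / 3) \<noteq> (of_int n :: 'k fls)" "gamma - fls_const (1 / 3) \<noteq> (of_int n :: 'k fls)" for n
  proof -
    have "(gamma + fls_const (1 / 3) :: 'k fls) $$ (- 1) \<noteq> of_int n $$ (- 1)"
      "(gamma - fls_const (1 / 3) :: 'k fls) $$ (- 1) \<noteq> of_int n $$ (- 1)"
      by (simp_all add: gamma_def fls_of_int_nth fls_const_nth)
    then show "gamma + fls_const (1 / 3) \<noteq> (of_int n :: 'k fls)" "gamma - fls_const (1 / 3) \<noteq> (of_int n :: 'k fls)"
      by metis+
  qed
  show "fls_const (1 / 3) \<noteq> (0 :: 'k fls)" by simp
qed (use assms third_not_int in auto)

text \<open>Uniform in d, to be used with d = 2 and d = 3. The map \<open>K\<close> produces the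
  second generator from the first in every assertion.\<close>

lemma heisenberg_freeness:
  fixes j :: "'k::field_char_0 UH \<Rightarrow> 'd::division_ring" and e :: "'k \<Rightarrow> 'd"
    and x y z V S S1 S2 :: 'd and d :: nat
  defines "a \<equiv> z ^ (d - 1) + y ^ d" and "b \<equiv> z ^ (d - 1) - y ^ d"
  defines "p \<equiv> V - e (1 / 3) * z" and "q \<equiv> V + e (1 / 3) * z"
  assumes ore: "ore_division_ring_of_fractions j" and e: "e = (\<lambda>c. j (UH_const c))" and d: "d > 0"
    and x: "x = j (UH_of heis_x)" and y: "y = j (UH_of heis_y)" and z: "z = y * x - x * y"
    and V: "V = e (1 / 2) * (x * y + y * x)"
    and S: "S = p * inverse q" and S1: "S1 = inverse z * (S + inverse p * q) * inverse z"
    and S2: "S2 = z * (S + inverse p * q) * z"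
    and K: "\<And>s. K s = inverse a * b * s * a * inverse b"
  shows "is_free_group_algebra_on e S (K S)"
    and "is_free_algebra_on e S1 (K S1)"
    and "is_free_group_algebra_on e (1 + S1) (1 + K S1)"
    and "is_free_algebra_on e (S1\<^sup>2) ((K S1)\<^sup>2)"
    and "is_free_group_algebra_on e (1 + S1\<^sup>2) (1 + (K S1)\<^sup>2)"
    and "is_free_algebra_on e (S2\<^sup>2) ((K S2)\<^sup>2)"
proof -
  obtain \<rho> :: "'k UH \<Rightarrow> 'k fls lend fls" where rep: "k_algebra_hom UH_const scalar \<rho>"
    "\<rho> (UH_of heis_x) = series_x" "\<rho> (UH_of heis_y) = series_y d"
    "\<And>u A. u \<noteq> 0 \<Longrightarrow> \<rho> u * A = 0 \<Longrightarrow> A = 0"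
    by (rule representation_exists[OF d]) blast
  interpret fractions j \<rho> scalar
    by unfold_locales (rule ore k_algebra_scalar rep; assumption?)+
  interpret P: polar_words d "gamma :: 'k fls" "fls_const (1 / 3)" by (rule polar_words_gamma[OF d])
  let ?m = "fls_monom :: int \<Rightarrow> 'k fls lend \<Rightarrow> 'k fls lend fls"
  note ek = k_algebra_fractions[folded e]
  have rel_x: "rel x (?m (- 1) op_x)" using rel_j[of "UH_of heis_x"] by (simp add: x rep series_x_def[OF d])
  have rel_y: "rel y (?m (- (int d - 1)) op_y)" using rel_j[of "UH_of heis_y"] by (simp add: y rep series_y_def[OF d])
  have rel_z: "rel z (?m (- int d) 1)"
    using rel_minus[OF rel_mult[OF rel_y rel_x] rel_mult[OF rel_x rel_y]]
    by (simp add: z fls_monom_mult fls_monom_diff add.commute op_commutator)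
  have rel_e: "rel (e c) (?m 0 (base_const c))" for c
    using rel_const[of c] by (simp add: e scalar_def fls_monom_0)
  have diag: "base_const c = lend_diag (\<lambda>_. fls_const c)" for c :: 'k
    by (intro lend_eqI fls_eqI) (simp add: base_const_def)
  have half: "base_const (1 / 2) * (op_v + op_v) = (op_v :: 'k fls lend)"
  proof -
    have "base_const (1 / 2) * (op_v + op_v) = base_const (1 / 2 + 1 / 2) * (op_v :: 'k fls lend)"
      by (simp only: k_algebra_add[OF k_algebra_base_const] distrib_left distrib_right)
    then show ?thesis by (simp add: k_algebra_one[OF k_algebra_base_const])
  qed
  have rel_V: "rel V (?m (- int d) op_v)"
    using rel_mult[OF rel_e[of "1 / 2"] rel_add[OF rel_mult[OF rel_x rel_y] rel_mult[OF rel_y rel_x]]]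
    by (simp add: V fls_monom_mult fls_monom_add add.commute[of _ "- 1"] op_anticommutator half)
  have rel_p: "rel p (?m (- int d) (lend_diag (\<lambda>n. gamma - of_int n - fls_const (1 / 3))))"
    using rel_minus[OF rel_V rel_mult[OF rel_e[of "1 / 3"] rel_z]]
    by (simp add: p_def fls_monom_mult fls_monom_diff op_v_def diag lend_diag_diff)
  have rel_q: "rel q (?m (- int d) (lend_diag (\<lambda>n. gamma - of_int n + fls_const (1 / 3))))"
    using rel_add[OF rel_V rel_mult[OF rel_e[of "1 / 3"] rel_z]]
    by (simp add: q_def fls_monom_mult fls_monom_add op_v_def diag lend_diag_add)
  have diag_inv: "lend_diag \<phi> * lend_diag (\<lambda>n. inverse (\<phi> n)) = 1" if "\<And>n. \<phi> n \<noteq> 0" for \<phi> :: "int \<Rightarrow> 'k fls"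
    using that by (simp add: lend_diag_mult lend_diag_1)
  have rel_p': "rel (inverse p) (?m (int d) (lend_diag (\<lambda>n. inverse (gamma - of_int n - fls_const (1 / 3)))))"
    by (rule rel_inverse[OF rel_p]) (simp add: fls_monom_mult diag_inv[OF P.gamma_ne(2)] fls_monom_0)
  have rel_q': "rel (inverse q) (?m (int d) (lend_diag (\<lambda>n. inverse (gamma - of_int n + fls_const (1 / 3)))))"
    by (rule rel_inverse[OF rel_q]) (simp add: fls_monom_mult diag_inv[OF P.gamma_ne(1)] fls_monom_0)
  have rel_S: "rel S (?m 0 P.S)"
    using rel_mult[OF rel_p rel_q']
    unfolding S fls_monom_mult lend_diag_mult P.S_def by (simp add: field_class.field_divide_inverse[of "_ - _"])
  have rel_S': "rel (inverse p * q) (?m 0 P.S')"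
    using rel_mult[OF rel_p' rel_q]
    unfolding fls_monom_mult lend_diag_mult P.S'_def by (simp add: field_class.field_divide_inverse[of "_ + _"] mult.commute)
  define W where "W = P.S + P.S'"
  have rel_W: "rel (S + inverse p * q) (?m 0 W)"
    using rel_add[OF rel_S rel_S'] by (simp add: fls_monom_add W_def)
  have rel_z': "rel (inverse z) (?m (int d) 1)"
    by (rule rel_inverse[OF rel_z]) (simp add: fls_monom_mult fls_monom_0)
  have rel_S1: "rel S1 (?m (2 * int d) W)"
    using rel_mult[OF rel_mult[OF rel_z' rel_W] rel_z'] by (simp add: S1 fls_monom_mult)
  have rel_S2: "rel S2 (?m (- (2 * int d)) W)"
    using rel_mult[OF rel_mult[OF rel_z rel_W] rel_z] by (simp add: S2 fls_monom_mult)
  \<comment> \<open>The common exponent of z^(d-1) and y^d. It cancels between the factors of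
    \<open>K\<close>, so that conjugation does not change the exponent of t.\<close>
  define i where "i = - (int d * (int d - 1))"
  have rel_yd: "rel (y ^ d) (?m i (lend_mult (fls_X ^ d)))"
    using rel_power[OF rel_y, of d] by (simp add: fls_monom_power i_def op_y_def lend_mult_power algebra_simps)
  have "int (d - 1) * (- int d) = i" using d by (simp add: i_def of_nat_diff algebra_simps)
  then have rel_zd: "rel (z ^ (d - 1)) (?m i 1)"
    using rel_power[OF rel_z, of "d - 1"] by (simp only: fls_monom_power power_one)
  have rel_a: "rel a (?m i (lend_mult (1 + fls_X ^ d)))"
    using rel_add[OF rel_zd rel_yd] by (simp add: a_def fls_monom_add lend_mult_1[symmetric] lend_mult_add)
  have rel_b: "rel b (?m i (lend_mult (1 - fls_X ^ d)))"
    using rel_minus[OF rel_zd rel_yd] by (simp add: b_def fls_monom_diff lend_mult_1[symmetric] lend_mult_diff)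
  have rel_a': "rel (inverse a) (?m (- i) (lend_mult (inverse (1 + fls_X ^ d))))"
    by (rule rel_inverse[OF rel_a])
       (simp add: fls_monom_mult lend_mult_mult right_inverse[OF P.one_pm_X_power_ne(1)] lend_mult_1 fls_monom_0)
  have rel_b': "rel (inverse b) (?m (- i) (lend_mult (inverse (1 - fls_X ^ d))))"
    by (rule rel_inverse[OF rel_b])
       (simp add: fls_monom_mult lend_mult_mult right_inverse[OF P.one_pm_X_power_ne(2)] lend_mult_1 fls_monom_0)
  define cj where "cj A = lend_mult P.f * A * lend_mult (inverse P.f)" for A
  have rel_K: "rel (K s) (?m n (cj A))" if "rel s (?m n A)" for s n A
  proof -
    have 1: "lend_mult (inverse (1 + fls_X ^ d)) * lend_mult (1 - fls_X ^ d) = lend_mult P.f"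
      "lend_mult (1 + fls_X ^ d) * lend_mult (inverse (1 - fls_X ^ d)) = lend_mult (inverse P.f)"
      by (simp_all add: lend_mult_mult P.f_def divide_inverse mult.commute)
    have "rel (K s) (?m n (lend_mult (inverse (1 + fls_X ^ d)) * lend_mult (1 - fls_X ^ d) * A *
        lend_mult (1 + fls_X ^ d) * lend_mult (inverse (1 - fls_X ^ d))))"
      using rel_mult[OF rel_mult[OF rel_mult[OF rel_mult[OF rel_a' rel_b] that] rel_a] rel_b']
      by (simp add: K fls_monom_mult)
    then show ?thesis using 1 by (simp add: cj_def mult.assoc)
  qed
  have cj_power: "cj A ^ n = cj (A ^ n)" for A n
  proof (induction n)
    case 0
    then show ?case by (simp add: cj_def lend_mult_mult P.f_ne lend_mult_1)
  next
    case (Suc n)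
    have "cj A * cj B = lend_mult P.f * A * (lend_mult (inverse P.f) * lend_mult P.f) * B * lend_mult (inverse P.f)" for B
      by (simp only: cj_def mult.assoc)
    then have "cj A * cj B = cj (A * B)" for B
      by (simp add: lend_mult_mult P.f_ne lend_mult_1) (simp add: cj_def mult.assoc)
    then show ?case using Suc by simp
  qed
  have inj: "inj (fls_const :: 'k fls lend \<Rightarrow> 'k fls lend fls)" by (rule injI) (metis fls_const_nth)
  have hom: "k_algebra_hom base_const scalar (fls_const :: 'k fls lend \<Rightarrow> _)"
    by (simp add: k_algebra_hom_def scalar_def fls_plus_const)
  note base = k_algebra_base_const[where 'k = 'k] base_const_def
  have base_inj: "fls_const c = (0 :: 'k fls) \<Longrightarrow> c = 0" for c by simp
  have group: "is_free_group_algebra_on base_const P.S (cj P.S)"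
    unfolding cj_def by (rule P.free_group_algebra[OF base base_inj])
  have free: "is_free_algebra_on base_const W (cj W)"
    unfolding cj_def W_def by (rule P.free_algebra[OF base base_inj])
  show "is_free_group_algebra_on e S (K S)"
    unfolding e using rel_S rel_K[OF rel_S]
    by (intro transfer_free_group_algebra[OF is_free_group_algebra_on_hom[OF group hom inj]])
       (simp_all add: fls_monom_0)
  show free1: "is_free_algebra_on e S1 (K S1)"
    unfolding e using d
    by (intro transfer_free_algebra[OF is_free_algebra_on_monom[OF free] rel_S1 rel_K[OF rel_S1]]) simp
  show "is_free_algebra_on e (S1\<^sup>2) ((K S1)\<^sup>2)"
    by (rule is_free_algebra_on_powers[OF ek free1]) simp
  \<comment> \<open>\<open>S2\<close> has the negative exponent -2d; the splitting by length only
    needs it to be nonzero.\<close>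
  have free2: "is_free_algebra_on e S2 (K S2)"
    unfolding e using d
    by (intro transfer_free_algebra[OF is_free_algebra_on_monom[OF free] rel_S2 rel_K[OF rel_S2]]) simp
  show "is_free_algebra_on e (S2\<^sup>2) ((K S2)\<^sup>2)"
    by (rule is_free_algebra_on_powers[OF ek free2]) simp
  \<comment> \<open>Here the exponent has to be positive, as it is for \<open>S1\<close> (2d) and
    its square (4d).\<close>
  have magnus': "is_free_group_algebra_on scalar (1 + ?m n A) (1 + ?m n B)"
    if "is_free_algebra_on base_const A B" "n > 0" for A B n
    by (rule magnus[OF k_algebra_base_const that _ _ k_algebra_scalar]) (simp_all add: fls_lead_def scalar_def)
  show "is_free_group_algebra_on e (1 + S1) (1 + K S1)"
    unfolding e
    by (intro transfer_free_group_algebra[OF magnus'[OF free, of "2 * int d"]] rel_add[OF rel_one]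
        rel_S1 rel_K[OF rel_S1]) (use d in simp)
  have free': "is_free_algebra_on base_const (W\<^sup>2) (cj (W\<^sup>2))"
    unfolding cj_power[symmetric] by (rule is_free_algebra_on_powers[OF k_algebra_base_const free]) simp
  have sq: "rel (S1\<^sup>2) (?m (4 * int d) (W\<^sup>2))" "rel ((K S1)\<^sup>2) (?m (4 * int d) (cj (W\<^sup>2)))"
    using rel_power[OF rel_S1, of 2] rel_power[OF rel_K[OF rel_S1], of 2] by (simp_all add: fls_monom_power cj_power)
  show "is_free_group_algebra_on e (1 + S1\<^sup>2) (1 + (K S1)\<^sup>2)"
    unfolding e
    by (intro transfer_free_group_algebra[OF magnus'[OF free', of "4 * int d"]] rel_add[OF rel_one] sq) (use d in simp)
qed

theorem theorem4p5:
  fixes j :: "'k::field_char_0 UH \<Rightarrow> 'd::division_ring"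
    and e :: "'k \<Rightarrow> 'd"
    and x y z V S T S1 S2 T1 T2 T3 T4 :: 'd
  assumes ore: "ore_division_ring_of_fractions j"
    and e: "e = (\<lambda>c. j (UH_const c))"
    and x: "x = j (UH_of heis_x)" and y: "y = j (UH_of heis_y)"
    and z: "z = y * x - x * y"
    and V: "V = e (1/2) * (x * y + y * x)"
    and S: "S = (V - e (1/3) * z) * inverse (V + e (1/3) * z)"
    and T: "T = inverse (z + y^2) * (z - y^2) * S * (z + y^2) * inverse (z - y^2)"
    and S1: "S1 = inverse z * ((V - e (1/3) * z) * inverse (V + e (1/3) * z)
                             + inverse (V - e (1/3) * z) * (V + e (1/3) * z)) * inverse z"
    and S2: "S2 = z * ((V - e (1/3) * z) * inverse (V + e (1/3) * z)
                     + inverse (V - e (1/3) * z) * (V + e (1/3) * z)) * z"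
    and T1: "T1 = inverse (z + y^2) * (z - y^2) * S1 * (z + y^2) * inverse (z - y^2)"
    and T2: "T2 = inverse (z^2 + y^3) * (z^2 - y^3) * S1 * (z^2 + y^3) * inverse (z^2 - y^3)"
    and T3: "T3 = inverse (z + y^2) * (z - y^2) * S2 * (z + y^2) * inverse (z - y^2)"
    and T4: "T4 = inverse (z^2 + y^3) * (z^2 - y^3) * S2 * (z^2 + y^3) * inverse (z^2 - y^3)"
  shows
   "is_free_group_algebra_on e S T \<and>
    (\<forall>a \<in> {S1, S1^2, T1, T1^2}. symmetric_wrt j eta2 a \<and> symmetric_wrt j eta3 a) \<and>
    is_free_algebra_on e S1 T1 \<and>
    is_free_group_algebra_on e (1 + S1) (1 + T1) \<and>
    is_free_algebra_on e (S1^2) (T1^2) \<and>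
    is_free_group_algebra_on e (1 + S1^2) (1 + T1^2) \<and>
    (\<forall>a \<in> {S1, S1^2, T2, T2^2}. symmetric_wrt j eta1 a) \<and>
    is_free_algebra_on e S1 T2 \<and>
    is_free_group_algebra_on e (1 + S1) (1 + T2) \<and>
    is_free_algebra_on e (S1^2) (T2^2) \<and>
    is_free_group_algebra_on e (1 + S1^2) (1 + T2^2) \<and>
    (\<forall>a \<in> {S2, S2^2, T3, T3^2}. symmetric_wrt j eta2 a \<and> symmetric_wrt j eta3 a) \<and>
    is_free_algebra_on e (S2^2) (T3^2) \<and>
    (\<forall>a \<in> {S2, S2^2, T4, T4^2}. symmetric_wrt j eta1 a) \<and>
    is_free_algebra_on e (S2^2) (T4^2)"
proof -
  define p where "p = V - e (1/3) * z"
  define q where "q = V + e (1/3) * z"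
  define K2 where "K2 s = inverse (z + y\<^sup>2) * (z - y\<^sup>2) * s * (z + y\<^sup>2) * inverse (z - y\<^sup>2)" for s
  define K3 where "K3 s = inverse (z\<^sup>2 + y ^ 3) * (z\<^sup>2 - y ^ 3) * s * (z\<^sup>2 + y ^ 3) * inverse (z\<^sup>2 - y ^ 3)" for s
  note S' = S[folded p_def q_def] and S1' = S1[folded p_def q_def, folded S[folded p_def q_def]]
    and S2' = S2[folded p_def q_def, folded S[folded p_def q_def]]
  have T': "T = K2 S" "T1 = K2 S1" "T2 = K3 S1" "T3 = K2 S2" "T4 = K3 S2"
    by (simp_all add: T T1 T2 T3 T4 K2_def K3_def)
  note f2 = heisenberg_freeness[where j = j and d = 2 and K = K2, OF ore e _ x y z V]
  note f3 = heisenberg_freeness[where j = j and d = 3 and K = K3, OF ore e _ x y z V]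
  have free2: "is_free_group_algebra_on e S (K2 S)" "is_free_algebra_on e S1 (K2 S1)"
    "is_free_group_algebra_on e (1 + S1) (1 + K2 S1)" "is_free_algebra_on e (S1\<^sup>2) ((K2 S1)\<^sup>2)"
    "is_free_group_algebra_on e (1 + S1\<^sup>2) (1 + (K2 S1)\<^sup>2)" "is_free_algebra_on e (S2\<^sup>2) ((K2 S2)\<^sup>2)"
    by (rule f2[of S S1 S2]; simp add: S' S1' S2' K2_def p_def q_def)+
  have free3: "is_free_algebra_on e S1 (K3 S1)"
    "is_free_group_algebra_on e (1 + S1) (1 + K3 S1)" "is_free_algebra_on e (S1\<^sup>2) ((K3 S1)\<^sup>2)"
    "is_free_group_algebra_on e (1 + S1\<^sup>2) (1 + (K3 S1)\<^sup>2)" "is_free_algebra_on e (S2\<^sup>2) ((K3 S2)\<^sup>2)"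
    by (rule f3[of S S1 S2]; simp add: S' S1' S2' K3_def p_def q_def)+
  have j_ring: "j (u + v) = j u + j v" for u v
    using ore unfolding ore_division_ring_of_fractions_def by blast
  \<comment> \<open>The involutions were computed in coordinates of the Lie algebra, so signs have
    to be carried through \<open>UH_of\<close> and j.\<close>
  have j_neg: "j (UH_of (Heis (- c) (- c') (- c''))) = - j (UH_of (Heis c c' c''))" for c c' c''
  proof -
    have "UH_of (Heis (- c) (- c') (- c'')) + UH_of (Heis c c' c'') = UH_of 0"
      by (simp add: UH_of_add[symmetric] plus_heis_def zero_heis_def)
    moreover have "UH_of (0 :: 'k heis) = 0" using UH_of_add[of 0 "0 :: 'k heis"] by simp
    moreover have "j 0 = 0" using j_ring[of 0 0] by simp
    ultimately show ?thesis by (metis j_ring eq_neg_iff_add_eq_0)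
  qed
  note neg = j_neg[of 1 0 0, simplified] j_neg[of 0 1 0, simplified]
  have 1: "involution_ext j eta1 x = (if True then x else - x)" "involution_ext j eta1 y = (if False then y else - y)"
    unfolding x y star_of_heis[OF ore k_involution_etas(1)] using neg by (simp_all add: eta1_def heis_x_def heis_y_def)
  have 2: "involution_ext j eta2 x = (if True then x else - x)" "involution_ext j eta2 y = (if True then y else - y)"
    unfolding x y star_of_heis[OF ore k_involution_etas(2)] by (simp_all add: eta2_def heis_x_def heis_y_def)
  have 3: "involution_ext j eta3 x = (if False then x else - x)" "involution_ext j eta3 y = (if False then y else - y)"
    unfolding x y star_of_heis[OF ore k_involution_etas(3)] using neg by (simp_all add: eta3_def heis_x_def heis_y_def)
  have e': "j (UH_const c) = e c" for c by (simp add: e)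
  note sym = symmetric_heisenberg[OF ore, where x = x and y = y, folded z, unfolded e', folded V, folded S1 S2]
  have sq: "involution_ext j \<eta> (s\<^sup>2) = s\<^sup>2"
    if "k_involution heis_scale heis_bracket \<eta>" "involution_ext j \<eta> s = s" for \<eta> s
    using star_power[OF ore that(1), of s 2] that(2) by simp
  \<comment> \<open>As z is negated and y^2 fixed for either sign of y, z + y^2 goes to -(z - y^2).
    This serves both \<open>eta2\<close> and \<open>eta3\<close>.\<close>
  have K2: "involution_ext j \<eta> (K2 s) = K2 s"
    if \<eta>: "k_involution heis_scale heis_bracket \<eta>" and "involution_ext j \<eta> s = s"
      "involution_ext j \<eta> z = - z" "involution_ext j \<eta> y = (if c then y else - y)" for \<eta> s c
    unfolding K2_def using that(3,4)
    by (intro symmetric_conjugate[OF ore \<eta> that(2)])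
       (simp add: star_add[OF ore \<eta>] star_diff[OF ore \<eta>] star_power[OF ore \<eta>])
  \<comment> \<open>As z is fixed and y negated, z^2 + y^3 and z^2 - y^3 are exchanged without a
    sign.\<close>
  have K3: "involution_ext j \<eta> (K3 s) = K3 s"
    if \<eta>: "k_involution heis_scale heis_bracket \<eta>" and "involution_ext j \<eta> s = s"
      "involution_ext j \<eta> z = z" "involution_ext j \<eta> y = - y" for \<eta> s
    unfolding K3_def using that(3,4)
    by (intro symmetric_conjugate[OF ore \<eta> that(2)])
       (simp add: star_add[OF ore \<eta>] star_diff[OF ore \<eta>] star_power[OF ore \<eta>])
  note sym1 = sym[OF k_involution_etas(1) 1] and sym2 = sym[OF k_involution_etas(2) 2]
    and sym3 = sym[OF k_involution_etas(3) 3]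
  have s2: "symmetric_wrt j eta2 a \<and> symmetric_wrt j eta3 a" if "a \<in> {s, s\<^sup>2, K2 s, (K2 s)\<^sup>2}" "s \<in> {S1, S2}" for a s
    using that sym2 sym3 sq[OF k_involution_etas(2)] sq[OF k_involution_etas(3)]
      K2[OF k_involution_etas(2) _ _ 2(2)] K2[OF k_involution_etas(3) _ _ 3(2)]
    by (auto simp: symmetric_wrt_def)
  have s1: "symmetric_wrt j eta1 a" if "a \<in> {s, s\<^sup>2, K3 s, (K3 s)\<^sup>2}" "s \<in> {S1, S2}" for a s
    using that sym1 sq[OF k_involution_etas(1)] K3[OF k_involution_etas(1)] 1(2)
    by (auto simp: symmetric_wrt_def)
  show ?thesis
    unfolding T' by (intro conjI free2 free3 ballI s1[of _ S1] s1[of _ S2]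
        s2[of _ S1, THEN conjunct1] s2[of _ S1, THEN conjunct2] s2[of _ S2, THEN conjunct1] s2[of _ S2, THEN conjunct2]) simp_all
qed

end
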